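(* Let $N\ge 2$ be an integer and let $f:[0,+\infty)\to\mathbb{R}$ be locally Lipschitz-continuous, with $f\ge 0$ on $[0,+\infty)$ and, writing $E=\{z\in[0,+\infty): f(z)=0\}$, $$\liminf_{s\to z^+}\frac{f(s)}{s-z}>0\quad\text{for all }z\in E.$$ Let $\Omega'=(0,+\infty)\times\mathbb{R}^{N-1}$, let $K^+$ be the set of all bounded nonnegative solutions $u$ of $\Delta u+f(u)=0$ in $\Omega'$ (with arbitrary continuous bounded nonnegative values $u_0$ at $x_1=0$) and, for $M\ge 0$, let $K^+_M=K^+\cap\{0\le u\le M\}$. Assume that $K^+$ is not empty. Then, for every sufficiently large $M\ge 0$, the trajectory dynamical system $(T_h,K^+_M)$ possesses a global attractor $A_{tr}$, which is bounded in $C^{2,\beta}_b(\overline{\Omega'})$ and then compact in $C^{2,\beta}_{loc}(\overline{\Omega'})$ for all $\beta\in[0,1)$, and satisfies $$A_{tr}=\Pi_{\overline{\Omega'}}K^+_M(\mathbb{R}^N),$$ where $K^+_M(\mathbb{R}^N)$ is the set of all bounded nonnegative solutions $u$ of $\Delta u+f(u)=0$ in $\mathbb{R}^N$ such that $0\le u\le M$, and $\Pi_{\overline{\Omega'}}$ denotes the restriction to $\overline{\Omega'}$. Lastly, for any $u\in K^+$ such that $0\le u\le M$, the functions $T_hu$ converge as $h\to+\infty$ in $C^{2,\beta}_{loc}(\overline{\Omega'})$ for all $\beta\in[0,1)$ to some $z\in E\cap[0,M]$ which is uniquely defined by $u$.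
   Context: Elements $u$ of $K^+$ are bounded, nonnegative, of class $C^2(\Omega')$ and continuous on $\overline{\Omega'}$; solutions in $\mathbb{R}^N$ are classical. $K^+$ and $K^+_M$ are endowed with the local topology induced by the embedding in $C^{2,\beta}_{loc}(\overline{\Omega'}\setminus\{x_1=0\})$ for all $\beta\in[0,1)$. The semi-flow is $(T_hu)(x_1,x_2,\ldots,x_N)=u(x_1+h,x_2,\ldots,x_N)$, $h\ge 0$; it maps $K^+_M$ into itself. For a closed set $F\subset\mathbb{R}^N$ and $\beta\in[0,1)$, $C^{2,\beta}_b(F)$ is the space of functions $w:F\to\mathbb{R}$ with $\|w\|_{C^{2,\beta}_b(F)}=\sup_{x\in F}\|w\|_{C^{2,\beta}(\overline{B(x,1)}\cap F)}<\infty$, where $B(x,1)$ is the open Euclidean ball of radius $1$ centered at $x$; $C^{2,\beta}_{loc}(F)$ carries the topology of $C^{2,\beta}$-convergence on compact subsets of $F$. Real numbers are identified with constant functions. A global attractor of $(T_h,K^+_M)$ is a set $A_{tr}\subset K^+_M$ such that: $A_{tr}$ is compact in $C^{2,\beta}_{loc}(\overline{\Omega'})$ for all $\beta\in[0,1)$; $T_hA_{tr}=A_{tr}$ for all $h\ge 0$; and $A_{tr}$ attracts bounded sets, i.e. for every $B\subset K^+_M$ (all such $B$ are bounded in $L^\infty(\Omega')$), every $\beta\in[0,1)$ and every neighbourhood $\mathcal{O}$ of $A_{tr}$ in $C^{2,\beta}_{loc}(\overline{\Omega'})$, there is $h_0>0$ such that $T_hB\subset\mathcal{O}$ for all $h\ge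 h_0$. *)

theory Defs
  imports "HOL-Analysis.Analysis"
begin

text \<open>
  Functions on a set \<open>F\<close> are represented by total functions that are \<open>undefined\<close> outside \<open>F\<close>
  (\<^const>\<open>extensional\<close>, \<^const>\<open>restrict\<close>), so that equality of functions on \<open>F\<close> is HOL equality.

  Derivatives on \<open>F\<close> are Frechet derivatives within \<open>F\<close>.  On an open set these are the usual
  derivatives.  On the closure of a half-space (a convex set with nonempty interior) they are
  unique, and being \<open>C\<^sup>2\<close> in the sense below means that all partial derivatives of order at most 2
  in the interior extend continuously to the closure.
\<close>

definition pderiv_on :: "'a::euclidean_space set \<Rightarrow> 'a \<Rightarrow> ('a \<Rightarrow> real) \<Rightarrow> 'a \<Rightarrow> real" where
  "pderiv_on F b w x = frechet_derivative w (at x within F) b"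

definition C2_on :: "'a::euclidean_space set \<Rightarrow> ('a \<Rightarrow> real) \<Rightarrow> bool" where
  "C2_on F w \<longleftrightarrow> w differentiable_on F \<and>
     (\<forall>b\<in>Basis. continuous_on F (pderiv_on F b w) \<and> pderiv_on F b w differentiable_on F \<and>
       (\<forall>c\<in>Basis. continuous_on F (pderiv_on F c (pderiv_on F b w))))"

definition laplacian_on :: "'a::euclidean_space set \<Rightarrow> ('a \<Rightarrow> real) \<Rightarrow> 'a \<Rightarrow> real" where
  "laplacian_on F w x = (\<Sum>b\<in>Basis. pderiv_on F b (pderiv_on F b w) x)"

definition sup_norm_on :: "'a set \<Rightarrow> ('a \<Rightarrow> real) \<Rightarrow> ennreal" where
  "sup_norm_on K g = (SUP x\<in>K. ennreal \<bar>g x\<bar>)"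

text \<open>For \<open>\<beta> = 0\<close> this is the oscillation, so that \<open>C2_norm F 0 K\<close> is equivalent to the usual
  \<open>C\<^sup>2\<close> norm on \<open>K\<close>.\<close>

definition holder_seminorm_on :: "real \<Rightarrow> 'a::metric_space set \<Rightarrow> ('a \<Rightarrow> real) \<Rightarrow> ennreal" where
  "holder_seminorm_on \<beta> K g =
     (SUP (x, y)\<in>{(x, y). x \<in> K \<and> y \<in> K \<and> x \<noteq> y}. ennreal (\<bar>g x - g y\<bar> / dist x y powr \<beta>))"

text \<open>The \<open>C\<^sup>2\<^sup>,\<^sup>\<beta>\<close> norm on a part \<open>K\<close> of \<open>F\<close>.  The derivatives are taken within \<open>F\<close>, which gives
  them a meaning on every compact \<open>K \<subseteq> F\<close>, also on those with empty interior.\<close>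

definition C2_norm :: "'a::euclidean_space set \<Rightarrow> real \<Rightarrow> 'a set \<Rightarrow> ('a \<Rightarrow> real) \<Rightarrow> ennreal" where
  "C2_norm F \<beta> K w =
     sup_norm_on K w + (\<Sum>b\<in>Basis. sup_norm_on K (pderiv_on F b w)) +
     (\<Sum>b\<in>Basis. \<Sum>c\<in>Basis. sup_norm_on K (pderiv_on F c (pderiv_on F b w)) +
        holder_seminorm_on \<beta> K (pderiv_on F c (pderiv_on F b w)))"

definition C2_b_norm :: "'a::euclidean_space set \<Rightarrow> real \<Rightarrow> ('a \<Rightarrow> real) \<Rightarrow> ennreal" where
  "C2_b_norm F \<beta> w = (SUP x\<in>F. C2_norm F \<beta> (closure (ball x 1) \<inter> F) w)"

definition C2_b :: "'a::euclidean_space set \<Rightarrow> real \<Rightarrow> ('a \<Rightarrow> real) set" where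
  "C2_b F \<beta> = {w \<in> extensional F. C2_on F w \<and> C2_b_norm F \<beta> w < \<infinity>}"

definition bounded_in_C2_b ::
  "'a::euclidean_space set \<Rightarrow> real \<Rightarrow> ('a \<Rightarrow> real) set \<Rightarrow> bool" where
  "bounded_in_C2_b F \<beta> A \<longleftrightarrow> A \<subseteq> C2_b F \<beta> \<and> (\<exists>C::real. \<forall>w\<in>A. C2_b_norm F \<beta> w \<le> ennreal C)"

definition C2_loc :: "'a::euclidean_space set \<Rightarrow> real \<Rightarrow> ('a \<Rightarrow> real) set" where
  "C2_loc F \<beta> = {w \<in> extensional F. C2_on F w \<and>
     (\<forall>K. compact K \<and> K \<subseteq> F \<longrightarrow> C2_norm F \<beta> K w < \<infinity>)}"

definition C2_loc_topology ::
  "'a::euclidean_space set \<Rightarrow> real \<Rightarrow> ('a \<Rightarrow> real) topology" where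
  "C2_loc_topology F \<beta> = topology (\<lambda>U. U \<subseteq> C2_loc F \<beta> \<and>
     (\<forall>u\<in>U. \<exists>K \<epsilon>. compact K \<and> K \<subseteq> F \<and> \<epsilon> > 0 \<and>
        {v \<in> C2_loc F \<beta>. C2_norm F \<beta> K (\<lambda>x. v x - u x) < ennreal \<epsilon>} \<subseteq> U))"

lemma C2_norm_mono:
  assumes "K \<subseteq> L" shows "C2_norm F \<beta> K w \<le> C2_norm F \<beta> L w"
  unfolding C2_norm_def sup_norm_on_def holder_seminorm_on_def
  by (intro add_mono sum_mono SUP_subset_mono) (use assms in auto)

lemma openin_C2_loc_topology:
  "openin (C2_loc_topology F \<beta>) U \<longleftrightarrow> U \<subseteq> C2_loc F \<beta> \<and>
     (\<forall>u\<in>U. \<exists>K \<epsilon>. compact K \<and> K \<subseteq> F \<and> \<epsilon> > 0 \<and>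
        {v \<in> C2_loc F \<beta>. C2_norm F \<beta> K (\<lambda>x. v x - u x) < ennreal \<epsilon>} \<subseteq> U)"
proof -
  let ?B = "\<lambda>u K \<epsilon>. {v \<in> C2_loc F \<beta>. C2_norm F \<beta> K (\<lambda>x. v x - u x) < ennreal \<epsilon>}"
  let ?P = "\<lambda>U. U \<subseteq> C2_loc F \<beta> \<and>
     (\<forall>u\<in>U. \<exists>K \<epsilon>. compact K \<and> K \<subseteq> F \<and> \<epsilon> > 0 \<and> ?B u K \<epsilon> \<subseteq> U)"
  have "istopology ?P"
    unfolding istopology_def
  proof (rule conjI; intro allI impI)
    fix S T assume S: "?P S" and T: "?P T"
    show "?P (S \<inter> T)"
    proof (intro conjI ballI)
      show "S \<inter> T \<subseteq> C2_loc F \<beta>" using S by auto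
    next
      fix u assume u: "u \<in> S \<inter> T"
      obtain K d where K: "compact K" "K \<subseteq> F" "d > 0" "?B u K d \<subseteq> S"
        using S u by (meson IntD1)
      obtain L e where L: "compact L" "L \<subseteq> F" "e > 0" "?B u L e \<subseteq> T"
        using T u by (meson IntD2)
      have "?B u (K \<union> L) (min d e) \<subseteq> S \<inter> T"
      proof
        fix v assume v: "v \<in> ?B u (K \<union> L) (min d e)"
        have "C2_norm F \<beta> K (\<lambda>x. v x - u x) < ennreal d"
          using v C2_norm_mono[of K "K \<union> L" F \<beta> "\<lambda>x. v x - u x"]
            ennreal_leI[of "min d e" d] by (auto intro: le_less_trans less_le_trans)
        moreover have "C2_norm F \<beta> L (\<lambda>x. v x - u x) < ennreal e"
          using v C2_norm_mono[of L "K \<union> L" F \<beta> "\<lambda>x. v x - u x"]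
            ennreal_leI[of "min d e" e] by (auto intro: le_less_trans less_le_trans)
        ultimately show "v \<in> S \<inter> T" using v K(4) L(4) by auto
      qed
      then show "\<exists>K \<epsilon>. compact K \<and> K \<subseteq> F \<and> \<epsilon> > 0 \<and> ?B u K \<epsilon> \<subseteq> S \<inter> T"
        using K L by (intro exI[of _ "K \<union> L"] exI[of _ "min d e"]) auto
    qed
  next
    fix \<K> assume *: "\<forall>U\<in>\<K>. ?P U"
    show "?P (\<Union>\<K>)"
    proof (intro conjI ballI)
      show "\<Union>\<K> \<subseteq> C2_loc F \<beta>" using * by blast
    next
      fix u assume "u \<in> \<Union>\<K>"
      then obtain U where U: "U \<in> \<K>" "u \<in> U" by blast
      then obtain K e where "compact K" "K \<subseteq> F" "e > 0" "?B u K e \<subseteq> U"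
        using * by meson
      then show "\<exists>K \<epsilon>. compact K \<and> K \<subseteq> F \<and> \<epsilon> > 0 \<and> ?B u K \<epsilon> \<subseteq> \<Union>\<K>"
        using U by (meson Union_upper order_trans)
    qed
  qed
  then show ?thesis
    unfolding C2_loc_topology_def by (simp add: topology_inverse')
qed

lemma topspace_C2_loc_topology: "topspace (C2_loc_topology F \<beta>) = C2_loc F \<beta>"
proof
  show "topspace (C2_loc_topology F \<beta>) \<subseteq> C2_loc F \<beta>"
    using openin_C2_loc_topology openin_topspace by blast
  have "openin (C2_loc_topology F \<beta>) (C2_loc F \<beta>)"
    unfolding openin_C2_loc_topology
    by (auto intro!: exI[of _ "{}"] exI[of _ "1::real"])
  then show "C2_loc F \<beta> \<subseteq> topspace (C2_loc_topology F \<beta>)"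
    by (rule openin_subset)
qed

text \<open>With \<open>\<Omega>\<close> the open half-space this is \<open>K\<^sup>+\<close>; with \<open>\<Omega> = UNIV\<close> it is the set of bounded
  nonnegative classical solutions in the whole space.\<close>

definition bnn_solutions :: "'a::euclidean_space set \<Rightarrow> (real \<Rightarrow> real) \<Rightarrow> ('a \<Rightarrow> real) set" where
  "bnn_solutions \<Omega> f = {u \<in> extensional (closure \<Omega>).
     C2_on \<Omega> u \<and> continuous_on (closure \<Omega>) u \<and> bounded (u ` closure \<Omega>) \<and>
     (\<forall>x\<in>closure \<Omega>. 0 \<le> u x) \<and> (\<forall>x\<in>\<Omega>. laplacian_on \<Omega> u x + f (u x) = 0)}"

definition bnn_solutions_le ::
  "'a::euclidean_space set \<Rightarrow> (real \<Rightarrow> real) \<Rightarrow> real \<Rightarrow> ('a \<Rightarrow> real) set" where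
  "bnn_solutions_le \<Omega> f M = {u \<in> bnn_solutions \<Omega> f. \<forall>x\<in>closure \<Omega>. u x \<le> M}"

definition shift ::
  "(real \<times> 'b::euclidean_space) set \<Rightarrow> real \<Rightarrow> (real \<times> 'b \<Rightarrow> real) \<Rightarrow> real \<times> 'b \<Rightarrow> real" where
  "shift F h u = restrict (\<lambda>(x1, x'). u (x1 + h, x')) F"

text \<open>In the attraction property every subset \<open>B\<close> of the phase space \<open>X\<close> is admitted, since the
  phase spaces of interest are bounded in the sup norm.\<close>

definition global_attractor ::
  "'a::euclidean_space set \<Rightarrow> (real \<Rightarrow> ('a \<Rightarrow> real) \<Rightarrow> ('a \<Rightarrow> real)) \<Rightarrow>
   ('a \<Rightarrow> real) set \<Rightarrow> ('a \<Rightarrow> real) set \<Rightarrow> bool" where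
  "global_attractor F T X A \<longleftrightarrow> A \<subseteq> X \<and>
     (\<forall>\<beta>\<in>{0..<1}. compactin (C2_loc_topology F \<beta>) A) \<and>
     (\<forall>h\<ge>0. T h ` A = A) \<and>
     (\<forall>B \<beta> U. B \<subseteq> X \<and> \<beta> \<in> {0..<1} \<and> openin (C2_loc_topology F \<beta>) U \<and> A \<subseteq> U \<longrightarrow>
        (\<exists>h0>0. \<forall>h\<ge>h0. T h ` B \<subseteq> U))"

definition zero_set :: "(real \<Rightarrow> real) \<Rightarrow> real set" where
  "zero_set f = {z \<in> {0..}. f z = 0}"

end

theory Submission imports Defs "HOL-Complex_Analysis.Great_Picard" begin

text \<open>
  Everything rests on the maximum principle; no potential theory is used.

  Regularity: reflecting \<open>v\<close> in a hyperplane and comparing the odd part with a quadratic barrier gives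
  \<open>\<bar>\<partial>\<^sub>e v(x)\<bar> \<le> N osc(v) / r + r sup \<bar>\<Delta>v\<bar>\<close> on a ball of radius \<open>r\<close>.  Applied to \<open>v(x + k) - v(x)\<close> on balls
  whose radius is a large multiple of \<open>\<bar>k\<bar>\<close>, this makes the modulus of continuity of the gradient
  contract from scale to scale, hence the gradient is Hoelder continuous with every exponent
  \<open>\<beta> < 1\<close>.  Applied to difference quotients of \<open>u - z\<close>, where \<open>f(z) = 0\<close>, it bounds the \<open>C\<^sup>2\<^sup>,\<^sup>\<beta>\<close> norm
  of \<open>u - z\<close> linearly by its sup norm on a slightly larger ball.

  Liouville property: a bounded nonnegative solution on the whole space, with infimum \<open>m\<close>, satisfies
  \<open>f(m) = 0\<close>.  If it were not constant it would exceed \<open>m\<close> everywhere, and since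
  \<open>f(s) \<ge> c (s - m)\<close> just above \<open>m\<close>, the subsolutions \<open>m + \<epsilon> (R\<^sup>2 - \<bar>x - y\<bar>\<^sup>2)\<^sup>2\<close> would lie below it for all
  centres \<open>y\<close> with one \<open>\<epsilon>\<close>, contradicting the definition of \<open>m\<close>.  The argument survives
  locally uniform limits, so by compactness solutions with values in \<open>[0, M]\<close> on a large ball are
  uniformly close to a zero of \<open>f\<close> near its centre.

  Hence the attractor consists of the constants in \<open>E \<inter> [0, M]\<close>.  As \<open>E\<close> is closed and has empty
  interior, the intermediate value theorem forces \<open>u(h, 0)\<close> to converge.
\<close>

section \<open>Laplacians and the minimum principle\<close>

text \<open>Solutions are classical by definition, so the regularity theory consists of a priori
  bounds. The first obstacle is that \<open>f\<close> is merely Lipschitz: the equation cannot be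
  differentiated, hence the difference quotients, whose Laplacians are at most \<Lambda> times the
  corresponding quotients of \<open>u\<close>. The second is the boundary x1 = 0, where the data are
  only continuous; every estimate is therefore interior, and trajectories are examined only after a
  shift by at least 9, the radius that the estimates consume. The bound linear in u - z lets
  compactness act at the level of uniform convergence: comparisons are made on the approximating
  solutions, and sup-norm closeness to a zero z is upgraded to
  \<open>C\<^sup>2\<^sup>,\<^sup>\<beta>\<close> closeness afterwards, because f(z) = 0 makes f(u)
  small together with u - z. Centres of balls are arbitrary throughout, so that all bounds are
  uniform in the initial data, as the attraction of whole sets demands.\<close>

text \<open>Second derivatives along the coordinate lines are all that the minimum principle needs, and unlike
  Frechet differentiability they pass to reflected functions without effort.\<close>

definition has_laplacian :: "('a::euclidean_space \<Rightarrow> real) \<Rightarrow> real \<Rightarrow> 'a \<Rightarrow> bool" where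
  "has_laplacian u l x \<longleftrightarrow> (\<exists>p q. l = (\<Sum>b\<in>Basis. q b) \<and>
     (\<forall>b\<in>Basis. (\<forall>\<^sub>F t in nhds 0. ((\<lambda>t. u (x + t *\<^sub>R b)) has_real_derivative p b t) (at t)) \<and>
        (p b has_real_derivative q b) (at 0)))"

lemma has_laplacianI:
  assumes "\<And>b. b \<in> Basis \<Longrightarrow>
      \<forall>\<^sub>F t in nhds 0. ((\<lambda>t. u (x + t *\<^sub>R b)) has_real_derivative p b t) (at t)"
    and "\<And>b. b \<in> Basis \<Longrightarrow> (p b has_real_derivative q b) (at 0)"
    and "l = (\<Sum>b\<in>Basis. q b)"
  shows "has_laplacian u l x"
  unfolding has_laplacian_def using assms by blast

lemma has_laplacian_lincomb:
  assumes "has_laplacian u k x" "has_laplacian v l x"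
  shows "has_laplacian (\<lambda>x. \<alpha> * u x + \<beta> * v x) (\<alpha> * k + \<beta> * l) x"
proof -
  from assms(1) obtain p q where pq: "k = (\<Sum>b\<in>Basis. q b)"
     "\<And>b. b \<in> Basis \<Longrightarrow> \<forall>\<^sub>F t in nhds 0. ((\<lambda>t. u (x + t *\<^sub>R b)) has_real_derivative p b t) (at t)"
     "\<And>b. b \<in> Basis \<Longrightarrow> (p b has_real_derivative q b) (at 0)"
    unfolding has_laplacian_def by blast
  from assms(2) obtain r s where rs: "l = (\<Sum>b\<in>Basis. s b)"
     "\<And>b. b \<in> Basis \<Longrightarrow> \<forall>\<^sub>F t in nhds 0. ((\<lambda>t. v (x + t *\<^sub>R b)) has_real_derivative r b t) (at t)"
     "\<And>b. b \<in> Basis \<Longrightarrow> (r b has_real_derivative s b) (at 0)"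
    unfolding has_laplacian_def by blast
  show ?thesis
  proof (rule has_laplacianI)
    fix b :: 'a assume b: "b \<in> Basis"
    show "\<forall>\<^sub>F t in nhds 0. ((\<lambda>t. \<alpha> * u (x + t *\<^sub>R b) + \<beta> * v (x + t *\<^sub>R b)) has_real_derivative
        \<alpha> * p b t + \<beta> * r b t) (at t)"
      using pq(2)[OF b] rs(2)[OF b] by eventually_elim (intro DERIV_add DERIV_cmult)
    show "((\<lambda>t. \<alpha> * p b t + \<beta> * r b t) has_real_derivative \<alpha> * q b + \<beta> * s b) (at 0)"
      using pq(3)[OF b] rs(3)[OF b] by (intro DERIV_add DERIV_cmult)
  qed (simp add: pq(1) rs(1) sum.distrib sum_distrib_left)
qed

lemma has_laplacian_const: "has_laplacian (\<lambda>_. c) 0 (x::'a::euclidean_space)"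
  unfolding has_laplacian_def by (rule exI[of _ "\<lambda>_ _. 0"], rule exI[of _ "\<lambda>_. 0"]) simp

lemma has_laplacian_add:
  "has_laplacian u k x \<Longrightarrow> has_laplacian v l x \<Longrightarrow> has_laplacian (\<lambda>x. u x + v x) (k + l) x"
  using has_laplacian_lincomb[of u k x v l 1 1] by simp

lemma has_laplacian_diff:
  "has_laplacian u k x \<Longrightarrow> has_laplacian v l x \<Longrightarrow> has_laplacian (\<lambda>x. u x - v x) (k - l) x"
  using has_laplacian_lincomb[of u k x v l 1 "-1"] by simp

lemma has_laplacian_cmult:
  "has_laplacian u k x \<Longrightarrow> has_laplacian (\<lambda>x. c * u x) (c * k) x"
  using has_laplacian_lincomb[of u k x u k c 0] by simp

lemma has_laplacian_add_const:
  "has_laplacian u k x \<Longrightarrow> has_laplacian (\<lambda>x. u x + c) k x"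
  using has_laplacian_add[OF _ has_laplacian_const, of u k x c] by simp

lemma has_laplacian_translate:
  assumes "has_laplacian u l (x + k)"
  shows "has_laplacian (\<lambda>x. u (x + k)) l x"
proof -
  have "(x + t *\<^sub>R b) + k = (x + k) + t *\<^sub>R b" for t b by simp
  then show ?thesis using assms unfolding has_laplacian_def by presburger
qed

text \<open>The reflection in the hyperplane through \<open>c\<close> orthogonal to \<open>e\<close>
  permutes coordinate lines: lines in direction \<open>e\<close> are reversed, the others are
  translated, so every pure second derivative keeps its value.\<close>

lemma has_laplacian_reflect:
  fixes x e :: "'a::euclidean_space"
  assumes e: "e \<in> Basis" and u: "has_laplacian u l (x - (2 * ((x - c) \<bullet> e)) *\<^sub>R e)"
  shows "has_laplacian (\<lambda>x. u (x - (2 * ((x - c) \<bullet> e)) *\<^sub>R e)) l x"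
proof -
  let ?y = "x - (2 * ((x - c) \<bullet> e)) *\<^sub>R e"
  from u obtain p q where pq: "l = (\<Sum>b\<in>Basis. q b)"
     "\<And>b. b \<in> Basis \<Longrightarrow> \<forall>\<^sub>F t in nhds 0. ((\<lambda>t. u (?y + t *\<^sub>R b)) has_real_derivative p b t) (at t)"
     "\<And>b. b \<in> Basis \<Longrightarrow> (p b has_real_derivative q b) (at 0)"
    unfolding has_laplacian_def by blast
  have neg: "filterlim (\<lambda>t::real. - t) (nhds 0) (nhds 0)"
    using tendsto_minus[of "\<lambda>t. t" 0 "nhds (0::real)"] by (simp add: filterlim_ident)
  have line: "(x + t *\<^sub>R b) - (2 * (((x + t *\<^sub>R b) - c) \<bullet> e)) *\<^sub>R e
      = (if b = e then ?y + (- t) *\<^sub>R e else ?y + t *\<^sub>R b)" if "b \<in> Basis" for b t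
  proof -
    have inner: "((x + t *\<^sub>R b) - c) \<bullet> e = (x - c) \<bullet> e + t * (b \<bullet> e)"
      by (simp add: inner_simps)
    have "(2 * (a + t)) *\<^sub>R e = (2 * a) *\<^sub>R e + (t *\<^sub>R e + t *\<^sub>R e)" for a
    proof -
      have "2 * (a + t) = 2 * a + (t + t)" by simp
      then show ?thesis by (simp only: scaleR_left_distrib)
    qed
    then have "(x + t *\<^sub>R e) - (2 * (a + t)) *\<^sub>R e = x - (2 * a) *\<^sub>R e + (- t) *\<^sub>R e" for a
      by simp
    then show ?thesis
      unfolding inner using that e by (cases "b = e") (simp_all add: inner_Basis)
  qed
  show ?thesis
  proof (rule has_laplacianI[where p="\<lambda>b t. if b = e then - p b (- t) else p b t"])
    fix b :: 'a assume b: "b \<in> Basis"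
    show "\<forall>\<^sub>F t in nhds 0. ((\<lambda>t. u ((x + t *\<^sub>R b) - (2 * (((x + t *\<^sub>R b) - c) \<bullet> e)) *\<^sub>R e))
       has_real_derivative (if b = e then - p b (- t) else p b t)) (at t)"
    proof (cases "b = e")
      case True
      have "\<forall>\<^sub>F t in nhds 0. ((\<lambda>t. u (?y + t *\<^sub>R e)) has_real_derivative p e (- t)) (at (- t))"
        by (rule eventually_compose_filterlim[OF pq(2)[OF e] neg])
      then show ?thesis
        unfolding True line[OF e] if_P[OF refl]
      proof eventually_elim
        case (elim t)
        from iffD1[OF DERIV_mirror elim] show ?case by simp
      qed
    next
      case False
      then show ?thesis unfolding line[OF b] using pq(2)[OF b] by simp
    qed
    have "(p b has_real_derivative q b) (at (- 0))" using pq(3)[OF b] by simp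
    from DERIV_minus[OF iffD1[OF DERIV_mirror this]]
    have neg': "((\<lambda>t. - p b (- t)) has_real_derivative q b) (at 0)" by (simp only: minus_minus)
    show "((\<lambda>t. if b = e then - p b (- t) else p b t) has_real_derivative q b) (at 0)"
    proof (cases "b = e")
      case True
      show ?thesis unfolding if_P[OF True] by (rule neg')
    next
      case False
      show ?thesis unfolding if_not_P[OF False] by (rule pq(3)[OF b])
    qed
  qed (rule pq(1))
qed

text \<open>Along a coordinate line the squared norm is the quadratic polynomial
  \<open>\<sigma> b\<close>, so the chain rule works at the centre too. \<open>P'\<close> is
  required only near the squared norm in question, which admits profiles that are singular at
  0.\<close>

lemma has_laplacian_radial:
  fixes c :: "'a::euclidean_space" and P P' :: "real \<Rightarrow> real"
  assumes P: "\<forall>\<^sub>F s in nhds ((norm (x - c))\<^sup>2). (P has_real_derivative P' s) (at s)"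
    and P': "(P' has_real_derivative P'') (at ((norm (x - c))\<^sup>2))"
  shows "has_laplacian (\<lambda>x. P ((norm (x - c))\<^sup>2))
    (4 * P'' * (norm (x - c))\<^sup>2 + 2 * DIM('a) * P' ((norm (x - c))\<^sup>2)) x"
proof -
  define s where "s = (norm (x - c))\<^sup>2"
  define \<sigma> where "\<sigma> b t = s + 2 * t * ((x - c) \<bullet> b) + t\<^sup>2" for b and t :: real
  have line: "(norm ((x + t *\<^sub>R b) - c))\<^sup>2 = \<sigma> b t" if "b \<in> Basis" for b t
    using that unfolding \<sigma>_def s_def power2_norm_eq_inner
    by (simp add: inner_simps power2_eq_square algebra_simps inner_commute)
  have d\<sigma>: "(\<sigma> b has_real_derivative 2 * ((x - c) \<bullet> b) + 2 * t) (at t)" for b t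
    unfolding \<sigma>_def by (auto intro!: derivative_eq_intros)
  show ?thesis
  proof (rule has_laplacianI[where p="\<lambda>b t. P' (\<sigma> b t) * (2 * ((x - c) \<bullet> b) + 2 * t)"
        and q="\<lambda>b. 4 * P'' * ((x - c) \<bullet> b)\<^sup>2 + 2 * P' s"])
    fix b :: 'a assume b: "b \<in> Basis"
    have "(\<sigma> b \<longlongrightarrow> \<sigma> b 0) (nhds 0)"
      using DERIV_isCont[OF d\<sigma>[of b 0]] by (simp only: isCont_def tendsto_at_iff_tendsto_nhds)
    then have "(\<sigma> b \<longlongrightarrow> s) (nhds 0)" by (simp add: \<sigma>_def)
    then have "\<forall>\<^sub>F t in nhds 0. (P has_real_derivative P' (\<sigma> b t)) (at (\<sigma> b t))"
      using P unfolding filterlim_iff s_def by blast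
    then show "\<forall>\<^sub>F t in nhds 0. ((\<lambda>t. P ((norm ((x + t *\<^sub>R b) - c))\<^sup>2)) has_real_derivative
        P' (\<sigma> b t) * (2 * ((x - c) \<bullet> b) + 2 * t)) (at t)"
      unfolding line[OF b] by (auto elim!: eventually_mono intro: DERIV_chain2 d\<sigma>)
    have "((\<lambda>t. P' (\<sigma> b t)) has_real_derivative P'' * (2 * ((x - c) \<bullet> b) + 2 * 0)) (at 0)"
      by (rule DERIV_chain2[OF _ d\<sigma>]) (use P' in \<open>simp add: \<sigma>_def s_def\<close>)
    then show "((\<lambda>t. P' (\<sigma> b t) * (2 * ((x - c) \<bullet> b) + 2 * t)) has_real_derivative
        4 * P'' * ((x - c) \<bullet> b)\<^sup>2 + 2 * P' s) (at 0)"
      by (auto intro!: derivative_eq_intros simp: \<sigma>_def power2_eq_square)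
  next
    have "(\<Sum>b\<in>Basis. ((x - c) \<bullet> b)\<^sup>2) = s"
      unfolding s_def power2_norm_eq_inner by (subst euclidean_inner) (simp add: power2_eq_square)
    then show "4 * P'' * (norm (x - c))\<^sup>2 + 2 * DIM('a) * P' ((norm (x - c))\<^sup>2)
        = (\<Sum>b\<in>Basis. 4 * P'' * ((x - c) \<bullet> b)\<^sup>2 + 2 * P' s)"
      by (simp add: sum.distrib s_def flip: sum_distrib_left)
  qed
qed

lemma has_laplacian_coordinate:
  fixes e :: "'a::euclidean_space" and P P' :: "real \<Rightarrow> real"
  assumes e: "e \<in> Basis" and P: "\<And>s. (P has_real_derivative P' s) (at s)"
    and P': "(P' has_real_derivative P'') (at ((x - c) \<bullet> e))"
  shows "has_laplacian (\<lambda>x. P ((x - c) \<bullet> e)) P'' x"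
proof (rule has_laplacianI[where p="\<lambda>b t. P' ((x - c) \<bullet> e + t * (b \<bullet> e)) * (b \<bullet> e)"
        and q="\<lambda>b. P'' * (b \<bullet> e)"])
  fix b :: 'a assume b: "b \<in> Basis"
  have line: "((x + t *\<^sub>R b) - c) \<bullet> e = (x - c) \<bullet> e + t * (b \<bullet> e)" for t
    by (simp add: inner_simps)
  show "\<forall>\<^sub>F t in nhds 0. ((\<lambda>t. P (((x + t *\<^sub>R b) - c) \<bullet> e)) has_real_derivative
      P' ((x - c) \<bullet> e + t * (b \<bullet> e)) * (b \<bullet> e)) (at t)"
    unfolding line
    by (intro always_eventually allI DERIV_chain2[OF P]) (auto intro!: derivative_eq_intros)
  have "((\<lambda>t. P' ((x - c) \<bullet> e + t * (b \<bullet> e))) has_real_derivative P'' * (b \<bullet> e)) (at 0)"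
    by (rule DERIV_chain2[where f=P']) (use P' in \<open>auto intro!: derivative_eq_intros\<close>)
  then have "((\<lambda>t. P' ((x - c) \<bullet> e + t * (b \<bullet> e)) * (b \<bullet> e)) has_real_derivative
      P'' * (b \<bullet> e) * (b \<bullet> e)) (at 0)"
    by (rule DERIV_cmult_right)
  moreover have "P'' * (b \<bullet> e) * (b \<bullet> e) = P'' * (b \<bullet> e)"
    using b e by (simp add: inner_Basis)
  ultimately show "((\<lambda>t. P' ((x - c) \<bullet> e + t * (b \<bullet> e)) * (b \<bullet> e)) has_real_derivative
      P'' * (b \<bullet> e)) (at 0)" by simp
next
  have "(\<Sum>b\<in>Basis. b \<bullet> e) = (\<Sum>b\<in>Basis. if b = e then 1 else 0)"
    using e by (intro sum.cong refl) (simp add: inner_Basis)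
  then show "P'' = (\<Sum>b\<in>Basis. P'' * (b \<bullet> e))"
    using e by (simp flip: sum_distrib_left)
qed

lemma local_min_second_derivative_nonneg:
  fixes g :: "real \<Rightarrow> real"
  assumes g: "\<forall>\<^sub>F t in nhds 0. (g has_real_derivative g' t) (at t)"
    and g': "(g' has_real_derivative d) (at 0)"
    and min: "\<forall>\<^sub>F t in nhds 0. g 0 \<le> g t"
  shows "0 \<le> d"
proof (rule ccontr)
  assume "\<not> 0 \<le> d"
  then have "d < 0" by simp
  obtain e where e: "e > 0" "\<And>t. \<bar>t\<bar> < e \<Longrightarrow> (g has_real_derivative g' t) (at t)" "\<And>t. \<bar>t\<bar> < e \<Longrightarrow> g 0 \<le> g t"
    using eventually_conj[OF g min] unfolding eventually_nhds_metric by (auto simp: dist_real_def)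
  have "g' 0 = 0"
    using e by (intro DERIV_local_min[of g "g' 0" 0 e]) auto
  from DERIV_neg_dec_right[OF g' \<open>d < 0\<close>] obtain r where r: "r > 0" "\<And>h. 0 < h \<Longrightarrow> h < r \<Longrightarrow> g' h < 0"
    using \<open>g' 0 = 0\<close> by auto
  define t where "t = min e r / 2"
  have t: "0 < t" "t < e" "t < r" using e(1) r(1) by (auto simp: t_def)
  have "g t < g 0"
  proof (rule DERIV_neg_imp_decreasing_open[OF t(1)])
    show "\<exists>y. (g has_real_derivative y) (at s) \<and> y < 0" if "0 < s" "s < t" for s
      using that t e(2)[of s] r(2)[of s] by auto
    show "continuous_on {0..t} g"
    proof (intro continuous_at_imp_continuous_on ballI)
      fix s assume "s \<in> {0..t}"
      then show "isCont g s" using t e(2)[of s] by (intro DERIV_isCont[of g "g' s"]) auto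
    qed
  qed
  then show False using e(3)[of t] t by simp
qed

lemma has_laplacian_local_min:
  assumes u: "has_laplacian u l x" and min: "\<forall>\<^sub>F y in nhds x. u x \<le> u y"
  shows "0 \<le> l"
proof -
  from u obtain p q where pq: "l = (\<Sum>b\<in>Basis. q b)"
     "\<And>b. b \<in> Basis \<Longrightarrow> \<forall>\<^sub>F t in nhds 0. ((\<lambda>t. u (x + t *\<^sub>R b)) has_real_derivative p b t) (at t)"
     "\<And>b. b \<in> Basis \<Longrightarrow> (p b has_real_derivative q b) (at 0)"
    unfolding has_laplacian_def by blast
  have "0 \<le> q b" if b: "b \<in> Basis" for b
  proof (rule local_min_second_derivative_nonneg[OF pq(2)[OF b] pq(3)[OF b]])
    have "((\<lambda>t. x + t *\<^sub>R b) \<longlongrightarrow> x + 0 *\<^sub>R b) (nhds 0)"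
      by (intro tendsto_intros filterlim_ident)
    then show "\<forall>\<^sub>F t in nhds 0. u (x + 0 *\<^sub>R b) \<le> u (x + t *\<^sub>R b)"
      using min by (simp add: filterlim_iff) blast
  qed
  then show ?thesis unfolding pq(1) by (rule sum_nonneg)
qed

text \<open>An interior minimum forces a nonnegative Laplacian. Strict negativity makes the
  contradiction immediate, so the comparison functions below are built with a strict margin.\<close>

lemma minimum_principle:
  fixes w :: "'a::euclidean_space \<Rightarrow> real"
  assumes S: "bounded S" "open S" and w: "continuous_on (closure S) w"
    and lap: "\<And>x. x \<in> S \<Longrightarrow> \<exists>l<0. has_laplacian w l x"
    and fr: "\<And>x. x \<in> frontier S \<Longrightarrow> 0 \<le> w x"
    and x: "x \<in> closure S"
  shows "0 \<le> w x"
proof (rule ccontr)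
  assume neg: "\<not> 0 \<le> w x"
  have "compact (closure S)" using S(1) by simp
  moreover have "closure S \<noteq> {}" using x by (metis empty_iff)
  ultimately have "\<exists>y\<in>closure S. \<forall>z\<in>closure S. w y \<le> w z"
    using w by (rule continuous_attains_inf)
  then obtain y where y: "y \<in> closure S" "\<And>z. z \<in> closure S \<Longrightarrow> w y \<le> w z" by blast
  have "y \<in> S"
  proof (rule ccontr)
    assume "y \<notin> S"
    then have "y \<in> frontier S" using y(1) S(2) by (simp add: frontier_def interior_open)
    from fr[OF this] y(2)[OF x] neg show False by linarith
  qed
  then obtain l where l: "l < 0" "has_laplacian w l y" using lap by blast
  have "\<forall>\<^sub>F z in nhds y. z \<in> S" using \<open>y \<in> S\<close> S(2) eventually_nhds by blast
  then have "\<forall>\<^sub>F z in nhds y. w y \<le> w z"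
    by eventually_elim (use y(2) closure_subset in blast)
  from has_laplacian_local_min[OF l(2) this] l(1) show False by simp
qed

section \<open>Interior gradient and Hoelder estimates\<close>

text \<open>With \<open>R\<close> the reflection in the hyperplane through \<open>c\<close>
  orthogonal to \<open>e\<close>, the function v - v \<circ> R vanishes on the flat face of the
  half-ball, and its slope at \<open>c\<close> is 2 D. A barrier that dominates it on the half-ball
  and vanishes at \<open>c\<close> bounds 2 D by its own slope.\<close>

lemma gradient_estimate_upper:
  fixes v :: "'a::euclidean_space \<Rightarrow> real" and a B :: real
  assumes e: "e \<in> Basis" and r: "0 < r"
    and cont: "continuous_on (cball c r) v"
    and lap: "\<And>x. x \<in> ball c r \<Longrightarrow> \<exists>l. \<bar>l\<bar> \<le> B \<and> has_laplacian v l x"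
    and osc: "\<And>x. x \<in> cball c r \<Longrightarrow> \<bar>v x - v c\<bar> \<le> a"
    and D: "((\<lambda>t. v (c + t *\<^sub>R e)) has_real_derivative D) (at 0)"
  shows "D \<le> DIM('a) * a / r + B * r"
proof -
  have a: "0 \<le> a" using osc[of c] r by force
  have B: "0 \<le> B" using lap[of c] r by force
  let ?N = "real DIM('a)"
  define R where "R x = x - (2 * ((x - c) \<bullet> e)) *\<^sub>R e" for x
  have ne: "norm e = 1" "e \<bullet> e = 1" using e by auto
  have dR: "dist c (R x) = dist c x" for x
  proof -
    define y where "y = x - c"
    have "(norm (y - (2 * (y \<bullet> e)) *\<^sub>R e))\<^sup>2 = (norm y)\<^sup>2"
      using ne(2) by (simp add: power2_norm_eq_inner inner_diff_left inner_diff_right inner_commute algebra_simps)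
    then have "norm (y - (2 * (y \<bullet> e)) *\<^sub>R e) = norm y" by simp
    moreover have "R x - c = y - (2 * (y \<bullet> e)) *\<^sub>R e" by (simp add: R_def y_def)
    ultimately show ?thesis by (metis dist_commute dist_norm y_def)
  qed
  have contR: "continuous_on T R" for T unfolding R_def by (intro continuous_intros)
  have main: "2 * D \<le> (2 * a * ?N / r\<^sup>2 + B + \<eta>) * r" if \<eta>: "0 < \<eta>" for \<eta>
  proof (rule ccontr)
    \<comment> \<open>The quadratic part of the barrier has Laplacian 4 a N /
      \<open>r\<^sup>2\<close>, the concave part -2 A. This \<open>A\<close> leaves -2 B - 2 \<eta>,
      which beats the at most 2 B coming from v and its reflection; \<eta> makes the inequality
      strict.\<close>
    define A where "A = 2 * a * ?N / r\<^sup>2 + B + \<eta>"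
    assume "\<not> 2 * D \<le> (2 * a * ?N / r\<^sup>2 + B + \<eta>) * r"
    then have neg: "A * r - 2 * D < 0" by (simp add: A_def)
    have A: "0 < A" unfolding A_def using a B \<eta> by (intro add_nonneg_pos add_nonneg_nonneg) auto
    define S where "S = ball c r \<inter> {x. 0 < (x - c) \<bullet> e}"
    define w where "w x = (2 * a / r\<^sup>2 * (norm (x - c))\<^sup>2 + A * (((x - c) \<bullet> e) * (r - (x - c) \<bullet> e)))
       - (v x - v (R x))" for x
    have "open S" unfolding S_def by (intro open_Int open_ball open_Collect_less continuous_intros)
    have "bounded S" unfolding S_def by (intro bounded_Int) auto
    have clS: "closure S \<subseteq> cball c r \<inter> {x. 0 \<le> (x - c) \<bullet> e}"
      unfolding S_def
      by (intro closure_minimal closed_Int closed_cball closed_Collect_le continuous_intros) auto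
    have w_cont: "continuous_on (closure S) w"
    proof -
      have "continuous_on (closure S) v" using cont clS continuous_on_subset by blast
      moreover have "continuous_on (closure S) (\<lambda>x. v (R x))"
        using clS dR by (intro continuous_on_compose2[OF cont contR]) auto
      ultimately show ?thesis unfolding w_def by (intro continuous_intros)
    qed
    have w_lap: "\<exists>l<0. has_laplacian w l x" if x: "x \<in> S" for x
    proof -
      have xb: "x \<in> ball c r" "R x \<in> ball c r" using x dR[of x] by (auto simp: S_def)
      obtain l m where l: "\<bar>l\<bar> \<le> B" "has_laplacian v l x" and m: "\<bar>m\<bar> \<le> B" "has_laplacian v m (R x)"
        using lap[OF xb(1)] lap[OF xb(2)] by blast
      have 1: "has_laplacian (\<lambda>x. 2 * a / r\<^sup>2 * (norm (x - c))\<^sup>2)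
          (4 * 0 * (norm (x - c))\<^sup>2 + 2 * DIM('a) * (2 * a / r\<^sup>2)) x"
        by (rule has_laplacian_radial[where P="\<lambda>s. 2 * a / r\<^sup>2 * s" and P'="\<lambda>_. 2 * a / r\<^sup>2"])
          (intro always_eventually allI DERIV_cmult_Id DERIV_const)+
      have 2: "has_laplacian (\<lambda>x. A * (((x - c) \<bullet> e) * (r - (x - c) \<bullet> e))) (- 2 * A) x"
        by (rule has_laplacian_coordinate[where P="\<lambda>s. A * (s * (r - s))" and P'="\<lambda>s. A * (r - 2 * s)", OF e])
          (auto intro!: derivative_eq_intros simp: algebra_simps)
      have 3: "has_laplacian (\<lambda>x. v (R x)) m x"
        using m(2) unfolding R_def by (rule has_laplacian_reflect[OF e])
      have "has_laplacian w ((4 * 0 * (norm (x - c))\<^sup>2 + 2 * DIM('a) * (2 * a / r\<^sup>2) + - 2 * A) - (l - m)) x"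
        unfolding w_def by (intro has_laplacian_diff has_laplacian_add 1 2 3 l)
      moreover have "(4 * 0 * (norm (x - c))\<^sup>2 + 2 * DIM('a) * (2 * a / r\<^sup>2) + - 2 * A) - (l - m) < 0"
        using l(1) m(1) \<eta> unfolding A_def by (simp add: algebra_simps)
      ultimately show ?thesis by blast
    qed
    have w_fr: "0 \<le> w x" if x: "x \<in> frontier S" for x
    proof -
      have "x \<in> closure S" "x \<notin> S"
        using x \<open>open S\<close> by (auto simp: frontier_def interior_open)
      then have xc: "x \<in> cball c r" "0 \<le> (x - c) \<bullet> e" using clS by auto
      have "(x - c) \<bullet> e \<le> norm (x - c)" using Cauchy_Schwarz_ineq2[of "x - c" e] ne by auto
      also have "\<dots> \<le> r" using xc by (simp add: dist_norm norm_minus_commute)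
      finally have "0 \<le> A * (((x - c) \<bullet> e) * (r - (x - c) \<bullet> e))" using xc A by simp
      moreover have "v x - v (R x) \<le> 2 * a / r\<^sup>2 * (norm (x - c))\<^sup>2"
      \<comment> \<open>The frontier is the flat face, where the odd part vanishes, together with
        the hemisphere, where it is at most 2 a, the value of the quadratic there.\<close>
      proof (cases "(x - c) \<bullet> e = 0")
        case True
        then have "R x = x" by (simp add: R_def)
        then show ?thesis using a by simp
      next
        case False
        then have "dist c x = r" using \<open>x \<notin> S\<close> xc by (auto simp: S_def)
        then have "2 * a / r\<^sup>2 * (norm (x - c))\<^sup>2 = 2 * a"
          using r by (simp add: dist_norm norm_minus_commute)
        moreover have "R x \<in> cball c r" using xc dR[of x] by simp
        ultimately show ?thesis using osc[OF xc(1)] osc[of "R x"] by linarith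
      qed
      ultimately show ?thesis unfolding w_def by linarith
    qed
    \<comment> \<open>\<open>h\<close> is \<open>w\<close> on the ray from \<open>c\<close> in
      direction \<open>e\<close>, extended smoothly enough to be differentiated at 0. It vanishes at
      0 and is nonnegative to the right, so its slope A r - 2 D cannot be negative.\<close>
    define h where "h t = 2 * a / r\<^sup>2 * t\<^sup>2 + A * (t * (r - t)) - (v (c + t *\<^sub>R e) - v (c + (- t) *\<^sub>R e))" for t
    have h_pos: "0 \<le> h t" if "0 < t" "t < r" for t
    proof -
      have "c + t *\<^sub>R e \<in> S" using that ne by (simp add: S_def dist_norm)
      then have "0 \<le> w (c + t *\<^sub>R e)"
        using minimum_principle[OF \<open>bounded S\<close> \<open>open S\<close> w_cont w_lap w_fr] closure_subset by blast
      moreover have "R (c + t *\<^sub>R e) = c + (- t) *\<^sub>R e"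
      proof -
        have "R (c + t *\<^sub>R e) = c + t *\<^sub>R e - (2 * t) *\<^sub>R e" using ne by (simp add: R_def)
        also have "(2 * t) *\<^sub>R e = t *\<^sub>R e + t *\<^sub>R e"
          using scaleR_left_distrib[of t t e] by (simp only: mult_2)
        finally show ?thesis by simp
      qed
      ultimately show ?thesis using ne by (simp add: w_def h_def)
    qed
    have "((\<lambda>t. v (c + (- t) *\<^sub>R e)) has_real_derivative - D) (at 0)"
    proof -
      have "((\<lambda>t. v (c + t *\<^sub>R e)) has_real_derivative D) (at (- 0))" using D by simp
      from iffD1[OF DERIV_mirror this] show ?thesis .
    qed
    moreover have "((\<lambda>t. 2 * a / r\<^sup>2 * t\<^sup>2 + A * (t * (r - t))) has_real_derivative A * r) (at 0)"
      using r by (auto intro!: derivative_eq_intros)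
    ultimately have "(h has_real_derivative (A * r - (D - - D))) (at 0)"
      unfolding h_def using D by (intro DERIV_diff)
    then have "(h has_real_derivative (A * r - 2 * D)) (at 0)" by simp
    from DERIV_neg_dec_right[OF this neg]
    obtain d where d: "0 < d" "\<And>t. 0 < t \<Longrightarrow> t < d \<Longrightarrow> h t < h 0" by auto
    define t where "t = min d r / 2"
    have "0 < t" "t < d" "t < r" using d r by (auto simp: t_def)
    with h_pos[of t] d(2)[of t] show False by (simp add: h_def)
  qed
  have "2 * D \<le> 2 * (DIM('a) * a / r + B * r)"
  proof (rule field_le_epsilon)
    fix \<epsilon> :: real assume "0 < \<epsilon>"
    then have "2 * D \<le> (2 * a * ?N / r\<^sup>2 + B + \<epsilon> / r) * r" using main[of "\<epsilon> / r"] r by simp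
    also have "\<dots> = 2 * (?N * a / r) + B * r + \<epsilon>"
      using r by (simp add: field_simps power2_eq_square)
    also have "\<dots> \<le> 2 * (?N * a / r + B * r) + \<epsilon>" using B r by simp
    finally show "2 * D \<le> 2 * (?N * a / r + B * r) + \<epsilon>" .
  qed
  then show ?thesis by simp
qed

lemma gradient_estimate:
  fixes v :: "'a::euclidean_space \<Rightarrow> real" and a B :: real
  assumes e: "e \<in> Basis" and r: "0 < r"
    and cont: "continuous_on (cball c r) v"
    and lap: "\<And>x. x \<in> ball c r \<Longrightarrow> \<exists>l. \<bar>l\<bar> \<le> B \<and> has_laplacian v l x"
    and osc: "\<And>x. x \<in> cball c r \<Longrightarrow> \<bar>v x - v c\<bar> \<le> a"
    and D: "((\<lambda>t. v (c + t *\<^sub>R e)) has_real_derivative D) (at 0)"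
  shows "\<bar>D\<bar> \<le> DIM('a) * a / r + B * r"
proof -
  have "- D \<le> DIM('a) * a / r + B * r"
  proof (rule gradient_estimate_upper[OF e r, where v="\<lambda>x. - v x"])
    show "\<exists>l. \<bar>l\<bar> \<le> B \<and> has_laplacian (\<lambda>x. - v x) l x" if x: "x \<in> ball c r" for x
    proof -
      obtain l where "\<bar>l\<bar> \<le> B" "has_laplacian v l x" using lap[OF x] by blast
      then show ?thesis using has_laplacian_cmult[of v l x "-1"] by (intro exI[of _ "- l"]) simp
    qed
    show "\<bar>- v x - - v c\<bar> \<le> a" if "x \<in> cball c r" for x using osc[OF that] by linarith
  qed (use cont D in \<open>auto intro!: continuous_intros DERIV_minus\<close>)
  moreover have "D \<le> DIM('a) * a / r + B * r"
    by (rule gradient_estimate_upper[OF e r cont lap osc D])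
  ultimately show ?thesis by linarith
qed

section \<open>Gradients as explicit data and their Hoelder continuity\<close>

text \<open>The gradient is an argument and not a chosen derivative, so that translates and
  difference quotients carry theirs along by the same formula.\<close>

definition has_partials :: "'a::euclidean_space set \<Rightarrow> ('a \<Rightarrow> real) \<Rightarrow> ('a \<Rightarrow> 'a \<Rightarrow> real) \<Rightarrow> bool" where
  "has_partials S v D \<longleftrightarrow> (\<forall>x\<in>S. (v has_derivative (\<lambda>k. \<Sum>c\<in>Basis. (k \<bullet> c) * D c x)) (at x))"

lemma has_partials_subset: "has_partials S v D \<Longrightarrow> T \<subseteq> S \<Longrightarrow> has_partials T v D"
  unfolding has_partials_def by blast

lemma has_partials_line:
  assumes v: "has_partials S v D" and x: "x + t *\<^sub>R k \<in> S"
  shows "((\<lambda>t. v (x + t *\<^sub>R k)) has_real_derivative (\<Sum>c\<in>Basis. (k \<bullet> c) * D c (x + t *\<^sub>R k))) (at t)"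
proof -
  have 1: "((\<lambda>t. x + t *\<^sub>R k) has_derivative (\<lambda>s. s *\<^sub>R k)) (at t)"
    by (auto intro!: derivative_eq_intros)
  have 2: "(v has_derivative (\<lambda>k'. \<Sum>c\<in>Basis. (k' \<bullet> c) * D c (x + t *\<^sub>R k))) (at (x + t *\<^sub>R k))"
    using v x unfolding has_partials_def by blast
  show ?thesis
    using has_derivative_compose[OF 1 2] unfolding has_field_derivative_def
    by (rule has_derivative_eq_rhs) (auto simp: sum_distrib_left sum_distrib_right mult_ac)
qed

lemma sum_inner_Basis_mult:
  fixes e :: "'a::euclidean_space"
  assumes "e \<in> Basis"
  shows "(\<Sum>c\<in>Basis. (e \<bullet> c) * D c) = (D e :: real)"
proof -
  have "(\<Sum>c\<in>Basis. (e \<bullet> c) * D c) = (\<Sum>c\<in>Basis. if c = e then D e else 0)"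
    using assms by (intro sum.cong refl) (auto simp: inner_Basis)
  then show ?thesis using assms by simp
qed

lemma has_partials_basis_line:
  assumes v: "has_partials S v D" and x: "x + t *\<^sub>R e \<in> S" and e: "e \<in> Basis"
  shows "((\<lambda>t. v (x + t *\<^sub>R e)) has_real_derivative D e (x + t *\<^sub>R e)) (at t)"
  using has_partials_line[OF v x] sum_inner_Basis_mult[OF e, of "\<lambda>c. D c (x + t *\<^sub>R e)"] by simp

lemma has_partials_continuous: "has_partials S v D \<Longrightarrow> continuous_on S v"
  unfolding has_partials_def
  by (meson continuous_at_imp_continuous_on has_derivative_continuous)

text \<open>The factor \<open>s\<close> is 1 for the plain differences in the Hoelder iteration and
  1 / h for difference quotients.\<close>

lemma has_partials_translate_diff:
  assumes "has_partials S v D" "\<And>x. x \<in> T \<Longrightarrow> x \<in> S \<and> x + k \<in> S"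
  shows "has_partials T (\<lambda>x. s * (v (x + k) - v x)) (\<lambda>c x. s * (D c (x + k) - D c x))"
  unfolding has_partials_def
proof
  fix x assume "x \<in> T"
  then have 1: "(v has_derivative (\<lambda>k. \<Sum>c\<in>Basis. (k \<bullet> c) * D c x)) (at x)"
    and 2: "(v has_derivative (\<lambda>k'. \<Sum>c\<in>Basis. (k' \<bullet> c) * D c (x + k))) (at (x + k))"
    using assms unfolding has_partials_def by blast+
  have 3: "((\<lambda>x. x + k) has_derivative (\<lambda>h. h)) (at x)"
    by (auto intro!: derivative_eq_intros)
  show "((\<lambda>x. s * (v (x + k) - v x)) has_derivative
      (\<lambda>k'. \<Sum>c\<in>Basis. (k' \<bullet> c) * (s * (D c (x + k) - D c x)))) (at x)"
    by (rule has_derivative_eq_rhs,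
        rule has_derivative_mult_right[OF has_derivative_diff[OF has_derivative_compose[OF 3 2] 1]])
      (simp add: fun_eq_iff sum_subtractf sum_distrib_left algebra_simps)
qed

text \<open>A bound in place of a right-hand side: the gradient estimates see only its size, and
  differences of translates inherit it.\<close>

definition laplacian_bounded :: "'a::euclidean_space set \<Rightarrow> ('a \<Rightarrow> real) \<Rightarrow> real \<Rightarrow> bool" where
  "laplacian_bounded S v B \<longleftrightarrow> (\<forall>x\<in>S. \<exists>l. \<bar>l\<bar> \<le> B \<and> has_laplacian v l x)"

lemma laplacian_bounded_translate_diff:
  assumes v: "laplacian_bounded S v B" and T: "\<And>x. x \<in> T \<Longrightarrow> x \<in> S \<and> x + k \<in> S"
  shows "laplacian_bounded T (\<lambda>x. v (x + k) - v x) (2 * B)"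
  unfolding laplacian_bounded_def
proof
  fix x assume "x \<in> T"
  then obtain l m where l: "\<bar>l\<bar> \<le> B" "has_laplacian v l x" and m: "\<bar>m\<bar> \<le> B" "has_laplacian v m (x + k)"
    using T v unfolding laplacian_bounded_def by blast
  have "has_laplacian (\<lambda>x. v (x + k) - v x) (m - l) x"
    by (intro has_laplacian_diff has_laplacian_translate l m)
  then show "\<exists>l. \<bar>l\<bar> \<le> 2 * B \<and> has_laplacian (\<lambda>x. v (x + k) - v x) l x"
    using l m by (intro exI[of _ "m - l"]) auto
qed

lemma partials_estimate:
  fixes v :: "'a::euclidean_space \<Rightarrow> real" and a B :: real
  assumes v: "has_partials S v D" "laplacian_bounded S v B"
    and r: "0 < r" "cball x r \<subseteq> S" and e: "e \<in> Basis"
    and osc: "\<And>y. y \<in> cball x r \<Longrightarrow> \<bar>v y - v x\<bar> \<le> a"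
  shows "\<bar>D e x\<bar> \<le> DIM('a) * a / r + B * r"
proof (rule gradient_estimate[OF e r(1), where v=v and c=x])
  show "continuous_on (cball x r) v"
    using has_partials_continuous[OF v(1)] r(2) continuous_on_subset by blast
  show "\<exists>l. \<bar>l\<bar> \<le> B \<and> has_laplacian v l y" if "y \<in> ball x r" for y
    using v(2) r(2) that ball_subset_cball unfolding laplacian_bounded_def by blast
  have "x \<in> S" using r by auto
  then show "((\<lambda>t. v (x + t *\<^sub>R e)) has_real_derivative D e x) (at 0)"
    using has_partials_basis_line[OF v(1), of x 0 e] e by simp
qed (rule osc)

text \<open>Mean value theorem for v(y + t k) - v(x + t k) in t. It turns a modulus of continuity of
  the gradient into a bound on the oscillation of v(. + k) - v with an additional factor |k|; this
  factor is the gain in the iteration over scales.\<close>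

lemma partials_difference_bound:
  fixes v :: "'a::euclidean_space \<Rightarrow> real" and d m :: real
  assumes v: "has_partials S v D" and k: "norm k \<le> d"
    and seg: "\<And>t. 0 \<le> t \<Longrightarrow> t \<le> 1 \<Longrightarrow> y + t *\<^sub>R k \<in> S \<and> x + t *\<^sub>R k \<in> S"
    and bd: "\<And>t c. 0 \<le> t \<Longrightarrow> t \<le> 1 \<Longrightarrow> c \<in> Basis \<Longrightarrow> \<bar>D c (y + t *\<^sub>R k) - D c (x + t *\<^sub>R k)\<bar> \<le> m"
  shows "\<bar>(v (y + k) - v y) - (v (x + k) - v x)\<bar> \<le> DIM('a) * d * m"
proof -
  define p where "p t = v (y + t *\<^sub>R k) - v (x + t *\<^sub>R k)" for t
  define p' where "p' t = (\<Sum>c\<in>Basis. (k \<bullet> c) * D c (y + t *\<^sub>R k)) - (\<Sum>c\<in>Basis. (k \<bullet> c) * D c (x + t *\<^sub>R k))" for t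
  have "(p has_real_derivative p' t) (at t)" if "0 \<le> t" "t \<le> 1" for t
    unfolding p_def p'_def using seg[OF that]
    by (intro DERIV_diff has_partials_line[OF v]) auto
  then obtain t where t: "0 < t" "t < 1" "p 1 - p 0 = (1 - 0) * p' t"
    using MVT2[of 0 1 p p'] by auto
  have "\<bar>p' t\<bar> = \<bar>\<Sum>c\<in>Basis. (k \<bullet> c) * (D c (y + t *\<^sub>R k) - D c (x + t *\<^sub>R k))\<bar>"
    unfolding p'_def by (simp add: sum_subtractf right_diff_distrib)
  also have "\<dots> \<le> (\<Sum>c\<in>(Basis::'a set). d * m)"
  proof (rule order_trans[OF sum_abs], rule sum_mono)
    fix c :: 'a assume c: "c \<in> Basis"
    have "\<bar>k \<bullet> c\<bar> \<le> d" using Basis_le_norm[OF c, of k] k by linarith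
    then show "\<bar>(k \<bullet> c) * (D c (y + t *\<^sub>R k) - D c (x + t *\<^sub>R k))\<bar> \<le> d * m"
      unfolding abs_mult using bd[of t c] t c by (intro mult_mono) auto
  qed
  finally show ?thesis using t(3) by (simp add: p_def)
qed

text \<open>The bound is linear in a + B and its constant depends only on \<beta> and the dimension.
  Of the margin 5, one unit pays for the plain gradient bound and four for the shrinking of the
  balls during the iteration.\<close>

lemma gradient_holder:
  assumes \<beta>: "0 \<le> \<beta>" "\<beta> < 1"
  shows "\<exists>C\<ge>0. \<forall>(v::'a::euclidean_space \<Rightarrow> real) D c R a B. has_partials (ball c (R + 5)) v D \<longrightarrow>
     laplacian_bounded (ball c (R + 5)) v B \<longrightarrow> 0 \<le> B \<longrightarrow>
     (\<forall>x\<in>ball c (R + 5). \<bar>v x\<bar> \<le> a) \<longrightarrow>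
     (\<forall>x\<in>ball c R. \<forall>y\<in>ball c R. \<forall>e\<in>Basis. \<bar>D e x - D e y\<bar> \<le> C * (a + B) * dist x y powr \<beta>)"
proof -
  define N where "N = real DIM('a)"
  have N: "1 \<le> N" unfolding N_def by (simp add: DIM_positive Suc_leI)
  \<comment> \<open>\<open>q\<close> is the ratio of consecutive scales.  Passing from \<open>q\<^sup>j\<close> to \<open>q\<^sup>j\<^sup>+\<^sup>1\<close> multiplies the modulus of continuity
    of the gradient by \<open>N\<^sup>2 q\<close>, and \<open>N\<^sup>2 q \<le> q\<^sup>\<beta> / 2\<close> leaves room for the source term.\<close>
  define q where "q = min (1/2) ((1 / (2 * N\<^sup>2)) powr (1 / (1 - \<beta>)))"
  have q: "0 < q" "q \<le> 1/2" using N unfolding q_def by auto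
  define \<mu> where "\<mu> = q powr \<beta>"
  have \<mu>: "0 < \<mu>" "\<mu> \<le> 1" "q \<le> \<mu>"
    unfolding \<mu>_def using q \<beta> powr_mono'[of \<beta> 1 q] powr_mono'[of 0 \<beta> q] by auto
  have "q powr (1 - \<beta>) \<le> ((1 / (2 * N\<^sup>2)) powr (1 / (1 - \<beta>))) powr (1 - \<beta>)"
    using q \<beta> unfolding q_def by (intro powr_mono2) auto
  also have "\<dots> = 1 / (2 * N\<^sup>2)" using \<beta> N by (simp add: powr_powr)
  finally have "q powr (1 - \<beta>) * \<mu> \<le> 1 / (2 * N\<^sup>2) * \<mu>" using \<mu> by (intro mult_right_mono) auto
  then have "q \<le> 1 / (2 * N\<^sup>2) * \<mu>"
    unfolding \<mu>_def using q by (simp flip: powr_add)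
  then have contr: "N\<^sup>2 * q \<le> \<mu> / 2" using N by (simp add: field_simps)
  \<comment> \<open>The numerator collects the coefficients of \<open>K\<close> below, which is 4 N
    a + 2 B + 4 B / q. The division by \<mu> pays for rounding a distance up to the next power of
    \<open>q\<close>.\<close>
  define C where "C = (4 * N + 2 + 4 / q) / \<mu>"
  have C0: "0 \<le> C" unfolding C_def using N q \<mu> by (intro divide_nonneg_nonneg add_nonneg_nonneg) auto
  show ?thesis
  proof (rule exI[of _ C], rule conjI[OF C0], intro allI impI ballI)
    fix v :: "'a \<Rightarrow> real" and D R a B and c x y e :: 'a
    assume v: "has_partials (ball c (R + 5)) v D" "laplacian_bounded (ball c (R + 5)) v B"
      and B: "0 \<le> B" and va: "\<forall>x\<in>ball c (R + 5). \<bar>v x\<bar> \<le> a"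
      and x: "x \<in> ball c R" and y: "y \<in> ball c R" and e: "e \<in> Basis"
    have "x \<in> ball c (R + 5)" using x by simp
    then have a: "0 \<le> a" using va by force
    define G where "G = 2 * a * N + B"
    \<comment> \<open>2 G starts the iteration, since two gradients of size G differ by at most
      that. The other summand yields 4 B \<le> K \<mu>, so half of each new bound absorbs the source
      term.\<close>
    define K where "K = 2 * G + 4 * B / q"
    have G: "0 \<le> G" unfolding G_def using a B N by simp
    have K: "2 * G \<le> K" "0 \<le> K" "4 * B \<le> K * \<mu>"
    proof -
      show "2 * G \<le> K" unfolding K_def using B q by simp
      then show "0 \<le> K" using G by simp
      have "4 * B = 4 * B / q * q" using q by simp
      also have "\<dots> \<le> K * \<mu>" unfolding K_def using G B q \<mu> by (intro mult_mono) auto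
      finally show "4 * B \<le> K * \<mu>" .
    qed
    have grad: "\<bar>D e z\<bar> \<le> G" if z: "z \<in> ball c (R + 4)" and e: "e \<in> Basis" for z e
    proof -
      have sub: "cball z 1 \<subseteq> ball c (R + 5)"
      proof
        fix w assume "w \<in> cball z 1"
        then show "w \<in> ball c (R + 5)" using z dist_triangle[of c w z] by simp
      qed
      have "\<bar>v w - v z\<bar> \<le> 2 * a" if "w \<in> cball z 1" for w
      proof -
        have "w \<in> ball c (R + 5)" "z \<in> ball c (R + 5)" using that sub z by auto
        then have "\<bar>v w\<bar> \<le> a" "\<bar>v z\<bar> \<le> a" using va by auto
        then show ?thesis by linarith
      qed
      from partials_estimate[OF v _ sub e this] show ?thesis
        by (simp add: G_def N_def mult_ac)
    qed
    \<comment> \<open>The radius R + 4 \<open>q ^ j\<close> leaves room for one step: a point of the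
      smaller ball may move by \<open>q ^ j\<close> and then by \<open>k\<close>, and q \<le> 1/2
      keeps the result in the larger ball.\<close>
    define Q where "Q j \<longleftrightarrow> (\<forall>x\<in>ball c (R + 4 * q ^ j). \<forall>y\<in>ball c (R + 4 * q ^ j). \<forall>e\<in>Basis.
        dist x y \<le> q ^ j \<longrightarrow> \<bar>D e x - D e y\<bar> \<le> K * \<mu> ^ j)" for j
    have Q: "Q j" for j
    proof (induction j)
      case 0
      have "\<bar>D e x - D e y\<bar> \<le> K" if "x \<in> ball c (R + 4)" "y \<in> ball c (R + 4)" "e \<in> Basis" for x y e
        using grad[OF that(1,3)] grad[OF that(2,3)] K(1) by linarith
      then show ?case by (simp add: Q_def)
    next
      case (Suc j)
      have qj: "0 < q ^ j" "q ^ Suc j \<le> q ^ j / 2" using q by auto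
      show ?case
        unfolding Q_def
      proof (intro ballI impI)
        fix x y and e :: 'a
        assume x: "x \<in> ball c (R + 4 * q ^ Suc j)" and y: "y \<in> ball c (R + 4 * q ^ Suc j)"
          and e: "e \<in> Basis" and xy: "dist x y \<le> q ^ Suc j"
        define k where "k = y - x"
        have k: "norm k \<le> q ^ Suc j" using xy by (simp add: k_def dist_norm norm_minus_commute)
        have inside: "z + t *\<^sub>R k \<in> ball c (R + 4 * q ^ j)"
          if z: "z \<in> cball x (q ^ j)" and t: "0 \<le> t" "t \<le> 1" for z t
        proof -
          have "t * norm k \<le> 1 * q ^ Suc j" using t k by (intro mult_mono) auto
          then have "norm (t *\<^sub>R k) \<le> q ^ Suc j" using t by simp
          then have "dist z (z + t *\<^sub>R k) \<le> q ^ j / 2" using order_trans[OF _ qj(2)] by (simp add: dist_norm del: power_Suc)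
          moreover have "dist c x < R + 4 * q ^ Suc j" using x by simp
          moreover have "dist x z \<le> q ^ j" using z by simp
          moreover have "dist c (z + t *\<^sub>R k) \<le> dist c x + dist x z + dist z (z + t *\<^sub>R k)"
            using dist_triangle[of c "z + t *\<^sub>R k" x] dist_triangle[of x "z + t *\<^sub>R k" z] by linarith
          ultimately have "dist c (z + t *\<^sub>R k) < R + 4 * q ^ j" using qj by linarith
          then show ?thesis by simp
        qed
        have big: "ball c (R + 4 * q ^ j) \<subseteq> ball c (R + 5)"
        proof -
          have "q ^ j \<le> 1" using q by (intro power_le_one) auto
          then show ?thesis by (intro subset_ball) linarith
        qed
        \<comment> \<open>The gradient of \<open>W\<close> at \<open>x\<close> is the increment to
          be estimated. \<open>W\<close> oscillates little by the induction hypothesis, and the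
          gradient estimate is applied on the ball of radius \<open>q ^ j\<close>, larger than |k|
          by the factor 1 / q at least.\<close>
        define W where "W z = v (z + k) - v z" for z
        have T: "z \<in> ball c (R + 5) \<and> z + k \<in> ball c (R + 5)" if "z \<in> cball x (q ^ j)" for z
          using inside[OF that, of 0] inside[OF that, of 1] big by auto
        have W: "has_partials (cball x (q ^ j)) W (\<lambda>e z. D e (z + k) - D e z)"
          using has_partials_translate_diff[where T="cball x (q ^ j)" and k=k and s=1, OF v(1) T] by (simp add: W_def[abs_def])
        have WL: "laplacian_bounded (cball x (q ^ j)) W (2 * B)"
          using laplacian_bounded_translate_diff[where T="cball x (q ^ j)" and k=k, OF v(2) T] by (simp add: W_def[abs_def])
        have osc: "\<bar>W z - W x\<bar> \<le> N * q ^ Suc j * (K * \<mu> ^ j)" if z: "z \<in> cball x (q ^ j)" for z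
          unfolding W_def N_def
        proof (rule partials_difference_bound[OF v(1) k])
          fix t :: real assume t: "0 \<le> t" "t \<le> 1"
          have xx: "x \<in> cball x (q ^ j)" using qj by simp
          note in1 = inside[OF z t] and in2 = inside[OF xx t]
          then show "z + t *\<^sub>R k \<in> ball c (R + 5) \<and> x + t *\<^sub>R k \<in> ball c (R + 5)" using big by blast
          fix d :: 'a assume "d \<in> Basis"
          moreover have "dist (z + t *\<^sub>R k) (x + t *\<^sub>R k) \<le> q ^ j" using z by (simp add: dist_commute)
          ultimately show "\<bar>D d (z + t *\<^sub>R k) - D d (x + t *\<^sub>R k)\<bar> \<le> K * \<mu> ^ j"
            using Suc.IH in1 in2 unfolding Q_def by blast
        qed
        have "\<bar>D e (x + k) - D e x\<bar> \<le> N * (N * q ^ Suc j * (K * \<mu> ^ j)) / q ^ j + 2 * B * q ^ j"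
          using partials_estimate[OF W WL qj(1) order_refl e osc] by (simp add: N_def)
        also have "\<dots> = N\<^sup>2 * q * (K * \<mu> ^ j) + 2 * B * q ^ j"
          using q by (simp add: power2_eq_square)
        \<comment> \<open>The first half is the contraction \<open>contr\<close>; the second uses 4
          B \<le> K \<mu> and q \<le> \<mu>.\<close>
        also have "\<dots> \<le> \<mu> / 2 * (K * \<mu> ^ j) + K * \<mu> / 2 * \<mu> ^ j"
          using contr K \<mu> B q by (intro add_mono mult_mono power_mono) auto
        also have "\<dots> = K * \<mu> ^ Suc j" by simp
        finally show "\<bar>D e x - D e y\<bar> \<le> K * \<mu> ^ Suc j"
          by (simp add: k_def abs_minus_commute)
      qed
    qed
    have Kpos: "K / \<mu> \<le> C * (a + B)"
    proof -
      have "K = 4 * N * a + 2 * B + 4 / q * B" by (simp add: K_def G_def)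
      also have "\<dots> \<le> (4 * N + 2 + 4 / q) * a + (4 * N + 2 + 4 / q) * B"
        using N q a B by (simp add: distrib_right)
      also have "\<dots> = (C * \<mu>) * (a + B)"
      proof -
        have "C * \<mu> = 4 * N + 2 + 4 / q" using \<mu> by (simp add: C_def)
        then show ?thesis by (simp only: distrib_left)
      qed
      finally show ?thesis using \<mu> by (simp add: field_simps)
    qed
    have KK: "K \<le> K / \<mu>" using K \<mu> by (simp add: field_simps mult_left_le)
    define d where "d = dist x y"
    consider "d = 0" | "1 < d" | "0 < d" "d \<le> 1" unfolding d_def using zero_le_dist[of x y] by linarith
    then have "\<bar>D e x - D e y\<bar> \<le> K / \<mu> * d powr \<beta>"
    proof cases
      case 1 then show ?thesis by (simp add: d_def)
    next
      case 2
      have "\<bar>D e x - D e y\<bar> \<le> K"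
        using grad[of x e] grad[of y e] x y e K(1) by fastforce
      also have "\<dots> \<le> K / \<mu> * 1" using KK by simp
      also have "\<dots> \<le> K / \<mu> * d powr \<beta>"
        using 2 \<beta> K \<mu> by (intro mult_left_mono ge_one_powr_ge_zero) auto
      finally show ?thesis .
    next
      case 3
      have "\<exists>j. q ^ Suc j < d"
      proof -
        obtain n where "q ^ n < d" using real_arch_pow_inv[of d q] 3 q by auto
        moreover have "q ^ Suc n \<le> q ^ n" using q by (simp add: mult_left_le_one_le)
        ultimately show ?thesis by (intro exI[of _ n]) linarith
      qed
      \<comment> \<open>The scale with \<open>q ^ Suc j\<close> < d \<le> \<open>q ^ j\<close>: the
        right inequality makes \<open>Q j\<close> applicable, the left one turns \<mu>
        \<open>^ j\<close> back into a power of d.\<close>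
      define j where "j = (LEAST j. q ^ Suc j < d)"
      have j: "q ^ Suc j < d" unfolding j_def using \<open>\<exists>j. q ^ Suc j < d\<close> by (rule LeastI_ex)
      have "d \<le> q ^ j"
      proof (cases j)
        case 0 then show ?thesis using 3 by simp
      next
        case (Suc i)
        then have "\<not> q ^ Suc i < d" using not_less_Least[of i "\<lambda>j. q ^ Suc j < d"] unfolding j_def by simp
        then show ?thesis using Suc by simp
      qed
      moreover have "x \<in> ball c (R + 4 * q ^ j)" "y \<in> ball c (R + 4 * q ^ j)"
        using x y zero_less_power[OF q(1), of j] by (auto intro: order.strict_trans)
      ultimately have "\<bar>D e x - D e y\<bar> \<le> K * \<mu> ^ j"
        using Q[of j] e unfolding Q_def d_def by blast
      also have "\<dots> = K / \<mu> * (q ^ Suc j) powr \<beta>"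
        using q \<mu> unfolding \<mu>_def by (simp add: powr_mult powr_power flip: powr_realpow) (simp add: powr_powr mult.commute)
      also have "\<dots> \<le> K / \<mu> * d powr \<beta>"
        using j q \<beta> K \<mu> by (intro mult_left_mono powr_mono2) (auto simp del: power_Suc)
      finally show ?thesis .
    qed
    also have "\<dots> \<le> C * (a + B) * d powr \<beta>" by (intro mult_right_mono Kpos) simp
    finally show "\<bar>D e x - D e y\<bar> \<le> C * (a + B) * dist x y powr \<beta>" by (simp add: d_def)
  qed
qed

text \<open>The hypotheses on \<open>g\<close> are what a Lipschitz nonlinearity gives for the
  Laplacian of w = u - z. Difference quotients of \<open>w\<close> then have Laplacians bounded
  uniformly in the step, so the first-order estimates apply to them and survive the limit. The
  margin 8 is one for the gradient of \<open>w\<close>, one for the translation by h < 1, and six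
  for the Hoelder estimate on a ball of radius R + 1.\<close>

lemma second_partials_estimate:
  assumes \<beta>: "0 \<le> \<beta>" "\<beta> < 1" and \<Lambda>: "0 \<le> \<Lambda>"
  shows "\<exists>C\<ge>0. \<forall>(w::'a::euclidean_space \<Rightarrow> real) D H g c R a. has_partials (ball c (R + 8)) w D \<longrightarrow>
     (\<forall>x\<in>ball c (R + 8). \<forall>b\<in>Basis. \<forall>e\<in>Basis.
        ((\<lambda>t. D e (x + t *\<^sub>R b)) has_real_derivative H b e x) (at 0)) \<longrightarrow>
     (\<forall>x\<in>ball c (R + 8). has_laplacian w (g x) x \<and> \<bar>w x\<bar> \<le> a \<and> \<bar>g x\<bar> \<le> \<Lambda> * a) \<longrightarrow>
     (\<forall>x\<in>ball c (R + 8). \<forall>y\<in>ball c (R + 8). \<bar>g x - g y\<bar> \<le> \<Lambda> * \<bar>w x - w y\<bar>) \<longrightarrow>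
     (\<forall>x\<in>ball c R. \<forall>y\<in>ball c R. \<forall>b\<in>Basis. \<forall>e\<in>Basis.
        \<bar>D e x\<bar> \<le> C * a \<and> \<bar>H b e x\<bar> \<le> C * a \<and> \<bar>H b e x - H b e y\<bar> \<le> C * a * dist x y powr \<beta>)"
proof -
  define N where "N = real DIM('a)"
  have N: "1 \<le> N" unfolding N_def by (simp add: DIM_positive Suc_leI)
  obtain C0 where C0: "0 \<le> C0" and holder: "\<And>(v::'a \<Rightarrow> real) D c R a B.
     has_partials (ball c (R + 5)) v D \<Longrightarrow> laplacian_bounded (ball c (R + 5)) v B \<Longrightarrow> 0 \<le> B \<Longrightarrow>
     (\<forall>x\<in>ball c (R + 5). \<bar>v x\<bar> \<le> a) \<Longrightarrow>
     (\<forall>x\<in>ball c R. \<forall>y\<in>ball c R. \<forall>e\<in>Basis. \<bar>D e x - D e y\<bar> \<le> C0 * (a + B) * dist x y powr \<beta>)"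
    using gradient_holder[OF \<beta>, where 'a='a] by blast
  \<comment> \<open>Gradient estimate on unit balls: oscillation at most 2 a, Laplacian at most
    \<Lambda> a. The same factor appears once more for the quotients, whence A * A in
    \<open>C\<close>.\<close>
  define A where "A = 2 * N + \<Lambda>"
  have A: "0 \<le> A" unfolding A_def using N \<Lambda> by simp
  define C where "C = A + A * A + C0 * (A + \<Lambda> * A)"
  have C: "A \<le> C" "A * A \<le> C" "C0 * (A + \<Lambda> * A) \<le> C" "0 \<le> C"
    unfolding C_def using A C0 \<Lambda> by auto
  show ?thesis
  proof (rule exI[of _ C], rule conjI[OF C(4)], intro allI impI ballI)
    fix w g :: "'a \<Rightarrow> real" and D H R a and c x y b e :: 'a
    assume w: "has_partials (ball c (R + 8)) w D"
      and H: "\<forall>x\<in>ball c (R + 8). \<forall>b\<in>Basis. \<forall>e\<in>Basis.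
        ((\<lambda>t. D e (x + t *\<^sub>R b)) has_real_derivative H b e x) (at 0)"
      and wg: "\<forall>x\<in>ball c (R + 8). has_laplacian w (g x) x \<and> \<bar>w x\<bar> \<le> a \<and> \<bar>g x\<bar> \<le> \<Lambda> * a"
      and lip: "\<forall>x\<in>ball c (R + 8). \<forall>y\<in>ball c (R + 8). \<bar>g x - g y\<bar> \<le> \<Lambda> * \<bar>w x - w y\<bar>"
      and x: "x \<in> ball c R" and y: "y \<in> ball c R" and b: "b \<in> Basis" and e: "e \<in> Basis"
    have "x \<in> ball c (R + 8)" using x by simp
    then have a: "0 \<le> a" using wg by force
    have near: "z' \<in> ball c s'" if "z \<in> ball c s" "dist z z' \<le> 1" "s + 1 \<le> s'" for z z' s s'
      using that dist_triangle[of c z' z] by simp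
    have wL: "laplacian_bounded (ball c (R + 8)) w (\<Lambda> * a)"
      unfolding laplacian_bounded_def using wg by blast
    have grad: "\<bar>D e z\<bar> \<le> A * a" if z: "z \<in> ball c (R + 7)" and e: "e \<in> Basis" for z e
    proof -
      have sub: "cball z 1 \<subseteq> ball c (R + 8)" by (auto intro: near[OF z] simp del: mem_ball)
      have "\<bar>w z' - w z\<bar> \<le> 2 * a" if "z' \<in> cball z 1" for z'
      proof -
        have "z' \<in> ball c (R + 8)" "z \<in> ball c (R + 8)" using that sub z by auto
        then have "\<bar>w z'\<bar> \<le> a" "\<bar>w z\<bar> \<le> a" using wg by auto
        then show ?thesis by linarith
      qed
      from partials_estimate[OF w wL _ sub e this] show ?thesis
        by (simp add: A_def N_def algebra_simps)
    qed
    \<comment> \<open>\<open>v h\<close> is the difference quotient in direction \<open>b\<close>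
      and \<open>V h\<close> its gradient, so that \<open>V h e\<close> tends to the second
      derivative \<open>H b e\<close>.\<close>
    define v where "v h z = (1 / h) * (w (z + h *\<^sub>R b) - w z)" for h z
    define V where "V h e z = (1 / h) * (D e (z + h *\<^sub>R b) - D e z)" for h e z
    have quot: "\<bar>V h e z\<bar> \<le> A * A * a \<and> \<bar>V h e x - V h e y\<bar> \<le> C0 * (A + \<Lambda> * A) * a * dist x y powr \<beta>"
      if h: "0 < h" "h < 1" and z: "z \<in> ball c R" for h z
    proof -
      have seg: "z + t *\<^sub>R b \<in> ball c (R + 7)" if "z \<in> ball c (R + 6)" "0 \<le> t" "t \<le> h" for z t
        using near[OF that(1), of "z + t *\<^sub>R b"] that h b by (simp add: dist_norm)
      have inside: "z \<in> ball c (R + 8) \<and> z + h *\<^sub>R b \<in> ball c (R + 8)" if "z \<in> ball c (R + 6)" for z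
        using seg[OF that, of 0] seg[OF that, of h] h by auto
      have diff: "\<bar>w (z + h *\<^sub>R b) - w z\<bar> \<le> h * (A * a)" if z: "z \<in> ball c (R + 6)" for z
      proof -
        have "((\<lambda>t. w (z + t *\<^sub>R b)) has_real_derivative D b (z + t *\<^sub>R b)) (at t)" if "0 \<le> t" "t \<le> h" for t
          by (rule has_partials_basis_line[OF w _ b]) (use seg[OF z that] in auto)
        then obtain t where t: "0 < t" "t < h" "w (z + h *\<^sub>R b) - w (z + 0 *\<^sub>R b) = (h - 0) * D b (z + t *\<^sub>R b)"
          using MVT2[of 0 h "\<lambda>t. w (z + t *\<^sub>R b)" "\<lambda>t. D b (z + t *\<^sub>R b)"] h by auto
        have "\<bar>D b (z + t *\<^sub>R b)\<bar> \<le> A * a" using grad[OF seg[OF z, of t] b] t by simp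
        then show ?thesis using t(3) h by (simp add: abs_mult)
      qed
      have v: "has_partials (ball c (R + 6)) (v h) (V h)"
        using has_partials_translate_diff[where T="ball c (R + 6)" and k="h *\<^sub>R b" and s="1 / h", OF w inside]
        by (simp add: v_def[abs_def] V_def[abs_def])
      have v_bd: "\<bar>v h z\<bar> \<le> A * a" if "z \<in> ball c (R + 6)" for z
        using diff[OF that] h by (simp add: v_def abs_mult field_simps)
      have vL: "laplacian_bounded (ball c (R + 6)) (v h) (\<Lambda> * (A * a))"
        unfolding laplacian_bounded_def
      proof
        fix z assume z: "z \<in> ball c (R + 6)"
        have "has_laplacian (v h) ((1 / h) * (g (z + h *\<^sub>R b) - g z)) z"
          unfolding v_def[abs_def]
          by (intro has_laplacian_cmult has_laplacian_diff has_laplacian_translate)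
            (use wg inside[OF z] in auto)
        moreover have "\<bar>(1 / h) * (g (z + h *\<^sub>R b) - g z)\<bar> \<le> \<Lambda> * (A * a)"
        proof -
          have "\<bar>g (z + h *\<^sub>R b) - g z\<bar> \<le> \<Lambda> * \<bar>w (z + h *\<^sub>R b) - w z\<bar>" using lip inside[OF z] by blast
          also have "\<dots> \<le> \<Lambda> * (h * (A * a))" using diff[OF z] \<Lambda> by (intro mult_left_mono)
          finally show ?thesis using h by (simp add: abs_mult field_simps)
        qed
        ultimately show "\<exists>l. \<bar>l\<bar> \<le> \<Lambda> * (A * a) \<and> has_laplacian (v h) l z" by blast
      qed
      have "\<bar>V h e x - V h e y\<bar> \<le> C0 * (A * a + \<Lambda> * (A * a)) * dist x y powr \<beta>"
        using holder[of c "R + 1" "v h" "V h" "\<Lambda> * (A * a)" "A * a"] v vL v_bd \<Lambda> A a x y e by (simp add: add.assoc)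
      moreover have "\<bar>V h e z\<bar> \<le> A * A * a"
      proof -
        have sub: "cball z 1 \<subseteq> ball c (R + 6)" by (auto intro: near[OF z] simp del: mem_ball)
        have "\<bar>v h z' - v h z\<bar> \<le> 2 * (A * a)" if "z' \<in> cball z 1" for z'
        proof -
          have "z' \<in> ball c (R + 6)" "z \<in> ball c (R + 6)" using that sub z by auto
          then show ?thesis using v_bd[of z'] v_bd[of z] by linarith
        qed
        from partials_estimate[OF v vL _ sub e this] show ?thesis
          by (simp add: A_def N_def algebra_simps)
      qed
      ultimately show ?thesis by (simp add: algebra_simps)
    qed
    \<comment> \<open>\<open>H\<close> is only a pointwise derivative of \<open>D\<close>; this
      suffices because the bounds in \<open>quot\<close> do not depend on h.\<close>
    have lim: "((\<lambda>h. V h e z) \<longlongrightarrow> H b e z) (at_right 0)" if "z \<in> ball c R" for z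
    proof -
      have "z \<in> ball c (R + 8)" using that by simp
      then have "((\<lambda>t. D e (z + t *\<^sub>R b)) has_real_derivative H b e z) (at 0)" using H b e by blast
      then have "((\<lambda>h. V h e z) \<longlongrightarrow> H b e z) (at 0)" by (simp add: DERIV_def V_def)
      then show ?thesis by (rule tendsto_mono[rotated]) (simp add: at_le)
    qed
    have small: "\<forall>\<^sub>F h in at_right (0::real). 0 < h \<and> h < 1"
      by (rule eventually_at_rightI[of 0 1]) auto
    have "\<bar>H b e x\<bar> \<le> A * A * a"
      by (rule tendsto_upperbound[OF tendsto_rabs[OF lim[OF x]]])
        (use small quot[OF _ _ x] in \<open>auto elim!: eventually_mono\<close>)
    moreover have "\<bar>H b e x - H b e y\<bar> \<le> C0 * (A + \<Lambda> * A) * a * dist x y powr \<beta>"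
      by (rule tendsto_upperbound[OF tendsto_rabs[OF tendsto_diff[OF lim[OF x] lim[OF y]]]])
        (use small quot[OF _ _ x] in \<open>auto elim!: eventually_mono\<close>)
    moreover have "\<bar>D e x\<bar> \<le> A * a" using grad[of x e] x e by simp
    moreover have "A * a \<le> C * a" "A * A * a \<le> C * a"
      "C0 * (A + \<Lambda> * A) * a * dist x y powr \<beta> \<le> C * a * dist x y powr \<beta>"
      using C a by (auto intro!: mult_right_mono)
    ultimately show "\<bar>D e x\<bar> \<le> C * a \<and> \<bar>H b e x\<bar> \<le> C * a \<and> \<bar>H b e x - H b e y\<bar> \<le> C * a * dist x y powr \<beta>"
      by linarith
  qed
qed

section \<open>The Liouville property\<close>

lemma attained_min_interior:
  fixes w :: "'a::euclidean_space \<Rightarrow> real"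
  assumes r: "0 < r" and w: "continuous_on (cball c r) w"
    and bd: "\<And>x. dist c x = r \<Longrightarrow> w p < w x" and p: "p \<in> cball c r"
  obtains y where "y \<in> ball c r" "w y \<le> w p" "\<forall>\<^sub>F z in nhds y. w y \<le> w z"
proof -
  obtain y where y: "y \<in> cball c r" "\<And>z. z \<in> cball c r \<Longrightarrow> w y \<le> w z"
    using continuous_attains_inf[OF compact_cball _ w] p by fastforce
  have "dist c y \<noteq> r" using bd[of y] y(2)[OF p] by linarith
  then have yb: "y \<in> ball c r" using y(1) by simp
  then have "\<forall>\<^sub>F z in nhds y. z \<in> ball c r" using open_ball eventually_nhds by blast
  then have "\<forall>\<^sub>F z in nhds y. w y \<le> w z"
    by eventually_elim (use y(2) in auto)
  with yb y(2)[OF p] that show ?thesis by blast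
qed

text \<open>An infimum over the whole space need not be attained. Adding a |x - c|^2 to a function
  that is almost minimal at \<open>c\<close> lifts it on the unit sphere and forces an interior
  minimum, where the Laplacian of the perturbed function is nonnegative.\<close>

lemma almost_min_small_source:
  fixes u :: "'a::euclidean_space \<Rightarrow> real" and a :: real
  assumes cont: "continuous_on (cball c 1) u"
    and lap: "\<And>x. x \<in> ball c 1 \<Longrightarrow> has_laplacian u (- g x) x"
    and low: "\<And>x. dist c x = 1 \<Longrightarrow> u c < u x + a" and a: "0 \<le> a"
  shows "\<exists>y\<in>ball c 1. u y \<le> u c \<and> g y \<le> 2 * real DIM('a) * a"
proof -
  define w where "w x = u x + a * (norm (x - c))\<^sup>2" for x
  have "continuous_on (cball c 1) w" unfolding w_def by (intro continuous_intros cont)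
  moreover have "w c < w x" if "dist c x = 1" for x
    using low[OF that] that by (simp add: w_def dist_norm norm_minus_commute)
  ultimately obtain y where y: "y \<in> ball c 1" "w y \<le> w c" "\<forall>\<^sub>F z in nhds y. w y \<le> w z"
    using attained_min_interior[of 1 c w c] by auto
  have "has_laplacian (\<lambda>x. a * (norm (x - c))\<^sup>2)
      (4 * 0 * (norm (y - c))\<^sup>2 + real (2 * DIM('a)) * a) y"
    by (rule has_laplacian_radial[where P="\<lambda>s. a * s" and P'="\<lambda>_. a"])
      (intro always_eventually allI DERIV_cmult_Id DERIV_const)+
  from has_laplacian_add[OF lap[OF y(1)] this]
  have "has_laplacian w (- g y + real (2 * DIM('a)) * a) y" unfolding w_def by simp
  from has_laplacian_local_min[OF this y(3)] have "g y \<le> 2 * real DIM('a) * a" by simp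
  moreover have "u y \<le> u c"
  proof -
    have "0 \<le> a * (norm (y - c))\<^sup>2" using a by simp
    then show ?thesis using y(2) by (simp add: w_def)
  qed
  ultimately show ?thesis using y(1) by blast
qed

text \<open>A strong minimum principle in quantitative form, so that it can be applied along a
  sequence and passed to the limit. The profile is |x - p|^(-2 N), that is P(s) = s^(-N) in the
  squared norm: its Laplacian 2 N (N + 2) / s^(N + 1) is strictly positive in every dimension, which
  supplies the strict margin of \<open>minimum_principle\<close>.\<close>

lemma superharmonic_annulus_lower_bound:
  fixes u :: "'a::euclidean_space \<Rightarrow> real"
  assumes \<rho>: "0 < \<rho>" "\<rho> < L" and cont: "continuous_on (cball p L) u"
    and lap: "\<And>x. x \<in> ball p L \<Longrightarrow> \<exists>l\<le>0. has_laplacian u l x"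
    and inner: "\<And>x. dist p x = \<rho> \<Longrightarrow> m + \<eta> \<le> u x" and outer: "\<And>x. dist p x = L \<Longrightarrow> m \<le> u x"
    and \<eta>: "0 < \<eta>" and x: "\<rho> \<le> dist p x" "dist p x \<le> L"
  shows "m + \<eta> * ((1 / (dist p x)\<^sup>2 ^ DIM('a) - 1 / L\<^sup>2 ^ DIM('a)) / (1 / \<rho>\<^sup>2 ^ DIM('a) - 1 / L\<^sup>2 ^ DIM('a))) \<le> u x"
proof -
  let ?n = "DIM('a)"
  define P where "P s = 1 / s ^ ?n" for s :: real
  define \<Delta> where "\<Delta> = P (\<rho>\<^sup>2) - P (L\<^sup>2)"
  have n: "0 < ?n" by simp
  have \<Delta>: "0 < \<Delta>"
  proof -
    have "\<rho>\<^sup>2 < L\<^sup>2" using \<rho> by (intro power_strict_mono) auto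
    then have "\<rho>\<^sup>2 ^ ?n < L\<^sup>2 ^ ?n" by (rule power_strict_mono) (use n in auto)
    then show ?thesis using \<rho> unfolding \<Delta>_def P_def by (simp add: divide_strict_left_mono)
  qed
  define \<kappa> where "\<kappa> = \<eta> / \<Delta>"
  have \<kappa>: "0 < \<kappa>" unfolding \<kappa>_def using \<eta> \<Delta> by simp
  define w where "w x = u x - (m + \<kappa> * (P ((norm (x - p))\<^sup>2) - P (L\<^sup>2)))" for x
  define S where "S = ball p L \<inter> {x. \<rho> < dist p x}"
  have "open S" unfolding S_def by (intro open_Int open_ball open_Collect_less continuous_intros)
  have "bounded S" unfolding S_def by (intro bounded_Int) auto
  have clS: "closure S \<subseteq> cball p L \<inter> {x. \<rho> \<le> dist p x}"
    unfolding S_def by (intro closure_minimal closed_Int closed_cball closed_Collect_le continuous_intros) auto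
  have w_cont: "continuous_on (closure S) w"
  proof -
    have "continuous_on (closure S) u" using cont clS continuous_on_subset by blast
    moreover have "\<forall>x\<in>closure S. ((norm (x - p))\<^sup>2) ^ ?n \<noteq> 0"
      using clS \<rho> by (auto simp: dist_norm)
    ultimately show ?thesis unfolding w_def P_def by (intro continuous_intros)
  qed
  have w_lap: "\<exists>l<0. has_laplacian w l x" if x: "x \<in> S" for x
  proof -
    define s where "s = (norm (x - p))\<^sup>2"
    have "\<rho> < norm (x - p)" using x by (simp add: S_def dist_norm norm_minus_commute)
    then have s: "0 < s" using \<rho> unfolding s_def by (intro zero_less_power) linarith
    obtain l where l: "l \<le> 0" "has_laplacian u l x" using x lap[of x] by (auto simp: S_def)
    define P' where "P' t = - real ?n / t ^ Suc ?n" for t :: real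
    have dP: "(P has_real_derivative P' t) (at t)" if "0 < t" for t
    proof -
      have "((\<lambda>s. inverse (s ^ ?n)) has_real_derivative - (real ?n * t ^ (?n - 1)) / (t ^ ?n * t ^ ?n)) (at t)"
        using that by (auto intro!: derivative_eq_intros simp: power2_eq_square divide_inverse algebra_simps)
      moreover have "- (real ?n * t ^ (?n - 1)) / (t ^ ?n * t ^ ?n) = P' t"
      proof -
        have "t ^ ?n = t * t ^ (?n - 1)" using n by (simp add: power_eq_if)
        then show ?thesis using that by (simp add: P'_def field_simps)
      qed
      ultimately show ?thesis by (simp add: P_def[abs_def] inverse_eq_divide)
    qed
    have dP': "(P' has_real_derivative real ?n * real (Suc ?n) / s ^ Suc (Suc ?n)) (at s)"
    proof -
      have "((\<lambda>t. - real ?n * inverse (t ^ Suc ?n)) has_real_derivative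
          - real ?n * (- (real (Suc ?n) * s ^ ?n) / (s ^ Suc ?n * s ^ Suc ?n))) (at s)"
        using s by (auto intro!: derivative_eq_intros simp: power2_eq_square divide_inverse algebra_simps simp del: power_Suc)
      moreover have "- real ?n * (- (real (Suc ?n) * s ^ ?n) / (s ^ Suc ?n * s ^ Suc ?n)) = real ?n * real (Suc ?n) / s ^ Suc (Suc ?n)"
        using s by (simp add: field_simps)
      ultimately show ?thesis by (simp only: P'_def[abs_def] divide_inverse)
    qed
    have ev: "\<forall>\<^sub>F t in nhds s. (P has_real_derivative P' t) (at t)"
      using eventually_nhds_in_open[of "{0<..}" s] s by (auto elim!: eventually_mono intro: dP)
    have "has_laplacian (\<lambda>x. P ((norm (x - p))\<^sup>2))
        (4 * (real ?n * real (Suc ?n) / s ^ Suc (Suc ?n)) * s + real (2 * ?n) * P' s) x"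
      using has_laplacian_radial[where P=P and P'=P' and x=x and c=p and P''="real ?n * real (Suc ?n) / s ^ Suc (Suc ?n)"] ev dP'
      unfolding s_def by simp
    moreover have "4 * (real ?n * real (Suc ?n) / s ^ Suc (Suc ?n)) * s + real (2 * ?n) * P' s
        = 2 * real ?n * (real ?n + 2) / s ^ Suc ?n"
      using s by (simp add: P'_def field_simps)
    ultimately have "has_laplacian (\<lambda>x. P ((norm (x - p))\<^sup>2)) (2 * real ?n * (real ?n + 2) / s ^ Suc ?n) x"
      by simp
    from has_laplacian_diff[OF l(2) has_laplacian_add_const[OF has_laplacian_cmult[OF this, of \<kappa>], of "m - \<kappa> * P (L\<^sup>2)"]]
    have "has_laplacian w (l - \<kappa> * (2 * real ?n * (real ?n + 2) / s ^ Suc ?n)) x"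
      unfolding w_def by (simp add: algebra_simps)
    moreover have "l - \<kappa> * (2 * real ?n * (real ?n + 2) / s ^ Suc ?n) < 0"
    proof -
      have "0 < \<kappa> * (2 * real ?n * (real ?n + 2) / s ^ Suc ?n)"
        using \<kappa> s n by (intro mult_pos_pos divide_pos_pos zero_less_power) auto
      then show ?thesis using l(1) by linarith
    qed
    ultimately show ?thesis by blast
  qed
  have w_\<rho>: "0 \<le> w x" if "dist p x = \<rho>" for x
  proof -
    have "(norm (x - p))\<^sup>2 = \<rho>\<^sup>2" using that by (simp add: dist_norm norm_minus_commute)
    then have "\<kappa> * (P ((norm (x - p))\<^sup>2) - P (L\<^sup>2)) = \<eta>" using \<Delta> by (simp add: \<kappa>_def \<Delta>_def)
    then show ?thesis using inner[OF that] by (simp add: w_def)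
  qed
  have w_L: "0 \<le> w x" if "dist p x = L" for x
  proof -
    have "(norm (x - p))\<^sup>2 = L\<^sup>2" using that by (simp add: dist_norm norm_minus_commute)
    then show ?thesis using outer[OF that] by (simp add: w_def)
  qed
  have w_fr: "0 \<le> w x" if x: "x \<in> frontier S" for x
  proof -
    have "x \<in> closure S" "x \<notin> S" using x \<open>open S\<close> by (auto simp: frontier_def interior_open)
    then have "dist p x = \<rho> \<or> dist p x = L" using clS by (auto simp: S_def)
    then show ?thesis using w_\<rho> w_L by blast
  qed
  have "0 \<le> w x"
  proof (cases "x \<in> S")
    case True
    then show ?thesis
      using minimum_principle[OF \<open>bounded S\<close> \<open>open S\<close> w_cont w_lap w_fr] closure_subset by blast
  next
    case False
    then show ?thesis using x w_\<rho> w_L by (fastforce simp: S_def)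
  qed
  then show ?thesis
    by (simp add: w_def \<kappa>_def \<Delta>_def P_def dist_norm norm_minus_commute)
qed

text \<open>Scale the bump \<phi> until m + \<phi> / T touches \<open>u\<close> from below. Touching
  on the sphere is impossible since \<phi> vanishes there, and at an interior touching point the
  equation contradicts the linear growth of \<open>f\<close>, unless \<open>u\<close> at the centre
  has left the range where that growth is known. Squaring makes the bump strictly subharmonic near
  the sphere.\<close>

lemma bump_lower_bound:
  fixes u :: "'a::euclidean_space \<Rightarrow> real" and c R \<delta> :: real
  assumes R: "0 < R" "(4 * real DIM('a) + 8)\<^sup>2 < 32 * c * R\<^sup>2" and c: "0 < c" and \<delta>: "0 < \<delta>"
    and cont: "continuous_on (cball y R) u"
    and lap: "\<And>x. x \<in> ball y R \<Longrightarrow> has_laplacian u (- f (u x)) x"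
    and um: "\<And>x. x \<in> cball y R \<Longrightarrow> m < u x"
    and f: "\<And>s. m < s \<Longrightarrow> s \<le> m + \<delta> \<Longrightarrow> c * (s - m) \<le> f s"
  shows "m + \<delta> \<le> u y"
proof (rule ccontr)
  assume less: "\<not> m + \<delta> \<le> u y"
  let ?N = "real DIM('a)"
  define \<phi> where "\<phi> x = (R\<^sup>2 - (norm (x - y))\<^sup>2)\<^sup>2" for x
  have \<phi>_cont: "continuous_on (cball y R) \<phi>" unfolding \<phi>_def by (intro continuous_intros)
  have "continuous_on (cball y R) (\<lambda>x. \<phi> x / (u x - m))"
    using um by (intro continuous_intros \<phi>_cont cont) force
  from continuous_attains_sup[OF compact_cball _ this]
  obtain z where z: "z \<in> cball y R" "\<And>x. x \<in> cball y R \<Longrightarrow> \<phi> x / (u x - m) \<le> \<phi> z / (u z - m)"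
    using R(1) by fastforce
  \<comment> \<open>1 / T is the largest factor \<epsilon> for which m + \<epsilon> \<phi> stays
    below \<open>u\<close> on the ball, and \<open>z\<close> is a point of contact.\<close>
  define T where "T = \<phi> z / (u z - m)"
  have yb: "y \<in> cball y R" using R(1) by simp
  have \<phi>y: "\<phi> y = R ^ 4" by (simp add: \<phi>_def flip: power_mult)
  have "0 < \<phi> y / (u y - m)" using um[OF yb] R(1) \<phi>y by simp
  then have T: "0 < T" using z(2)[OF yb] by (simp add: T_def)
  have touch: "\<phi> x \<le> T * (u x - m)" if "x \<in> cball y R" for x
    using z(2)[OF that] um[OF that] by (simp add: T_def[symmetric] pos_divide_le_eq)
  have touchz: "\<phi> z = T * (u z - m)" using um[OF z(1)] by (simp add: T_def)
  have "dist y z \<noteq> R"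
  proof
    assume "dist y z = R"
    then have "\<phi> z = 0" by (simp add: \<phi>_def dist_norm norm_minus_commute)
    then show False using touchz T um[OF z(1)] by simp
  qed
  then have zb: "z \<in> ball y R" using z(1) by simp
  define s where "s = (norm (z - y))\<^sup>2"
  define t where "t = R\<^sup>2 - s"
  have t: "0 < t" "t \<le> R\<^sup>2"
  proof -
    have "norm (z - y) < R" using zb by (simp add: dist_norm norm_minus_commute)
    then show "0 < t" unfolding t_def s_def using power_strict_mono[of "norm (z - y)" R 2] by simp
    show "t \<le> R\<^sup>2" by (simp add: t_def s_def)
  qed
  have \<phi>z: "\<phi> z = t\<^sup>2" by (simp add: \<phi>_def t_def s_def)
  have "has_laplacian (\<lambda>x. (R\<^sup>2 - (norm (x - y))\<^sup>2)\<^sup>2)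
      (4 * 2 * (norm (z - y))\<^sup>2 + real (2 * DIM('a)) * (- 2 * (R\<^sup>2 - (norm (z - y))\<^sup>2))) z"
    by (rule has_laplacian_radial[where P="\<lambda>s. (R\<^sup>2 - s)\<^sup>2" and P'="\<lambda>s. - 2 * (R\<^sup>2 - s)"])
      (auto intro!: derivative_eq_intros always_eventually)
  then have "has_laplacian \<phi> (8 * s - 4 * ?N * t) z"
    unfolding \<phi>_def[abs_def] by (simp add: s_def t_def algebra_simps)
  from has_laplacian_lincomb[OF lap[OF zb] this, of T "-1"]
  have lw: "has_laplacian (\<lambda>x. T * u x + -1 * \<phi> x) (T * (- f (u z)) + -1 * (8 * s - 4 * ?N * t)) z" .
  have "\<forall>\<^sub>F x in nhds z. x \<in> ball y R" using zb open_ball eventually_nhds by blast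
  then have "\<forall>\<^sub>F x in nhds z. T * u z + -1 * \<phi> z \<le> T * u x + -1 * \<phi> x"
  proof eventually_elim
    case (elim x)
    then have "x \<in> cball y R" by simp
    from touch[OF this] touchz show ?case by (simp add: algebra_simps)
  qed
  from has_laplacian_local_min[OF lw this]
  have key: "T * f (u z) + 8 * s - 4 * ?N * t \<le> 0" by simp
  \<comment> \<open>\<phi> is largest at the centre, so at the contact point \<open>u\<close> is no
    higher than at \<open>y\<close>; the assumption on u(y) thus brings u(z) into the range of
    \<open>f\<close>'s linear lower bound.\<close>
  have "u z - m \<le> \<delta>"
  proof -
    have "T * (u z - m) \<le> R ^ 4"
      using power_mono[OF t(2), of 2] t(1) touchz \<phi>z by (simp flip: power_mult)
    also have "\<dots> \<le> T * (u y - m)" using touch[OF yb] \<phi>y by simp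
    finally have "u z - m \<le> u y - m" using T by simp
    then show ?thesis using less by simp
  qed
  then have "c * (u z - m) \<le> f (u z)" using f[of "u z"] um[OF z(1)] by simp
  then have "T * (c * (u z - m)) \<le> T * f (u z)" using T by (intro mult_left_mono) auto
  then have "c * t\<^sup>2 \<le> T * f (u z)" using touchz \<phi>z by (simp add: mult_ac)
  then have "c * t\<^sup>2 + 8 * (R\<^sup>2 - t) - 4 * ?N * t \<le> 0" using key by (simp add: t_def)
  then have neg: "c * t\<^sup>2 + 8 * R\<^sup>2 \<le> (4 * ?N + 8) * t" by (simp add: algebra_simps)
  \<comment> \<open>Completing the square: c \<open>t\<^sup>2\<close> - (4 N + 8) t + 8
    \<open>R\<^sup>2\<close> has negative discriminant exactly by the assumption on
    \<open>R\<close>.\<close>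
  have "0 \<le> (2 * c * t - (4 * ?N + 8))\<^sup>2" by simp
  also have "\<dots> = 4 * c * (c * t\<^sup>2 - (4 * ?N + 8) * t) + (4 * ?N + 8)\<^sup>2"
    by (simp add: power2_eq_square algebra_simps)
  also have "\<dots> \<le> 4 * c * (- 8 * R\<^sup>2) + (4 * ?N + 8)\<^sup>2"
    using neg c by (intro add_right_mono mult_left_mono) auto
  also have "\<dots> < 0" using R(2) by simp
  finally show False by simp
qed

text \<open>\<open>U\<close> is only a locally uniform limit, with no differentiability at hand.
  Each comparison is therefore carried out on a solution \<open>u n\<close> with \<open>n\<close>
  large, with tolerances chosen so that only inequalities between values reach
  \<open>U\<close>.\<close>

lemma liouville_limit:
  fixes u :: "nat \<Rightarrow> 'a::euclidean_space \<Rightarrow> real"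
  assumes f_nonneg: "\<And>s. 0 \<le> s \<Longrightarrow> 0 \<le> f s" and f_cont: "continuous_on {0..} f"
    and f_slope: "\<And>z. 0 \<le> z \<Longrightarrow> f z = 0 \<Longrightarrow>
      \<exists>c>0. \<exists>\<delta>>0. \<forall>s. z < s \<longrightarrow> s \<le> z + \<delta> \<longrightarrow> c * (s - z) \<le> f s"
    and cont: "\<And>n. continuous_on (ball 0 (real n)) (u n)"
    and sol: "\<And>n x. x \<in> ball 0 (real n) \<Longrightarrow> has_laplacian (u n) (- f (u n x)) x"
    and nonneg: "\<And>n x. x \<in> ball 0 (real n) \<Longrightarrow> 0 \<le> u n x"
    and conv: "\<And>r e. 0 < e \<Longrightarrow> \<forall>\<^sub>F n in sequentially. \<forall>x\<in>cball 0 r. \<bar>u n x - U x\<bar> < e"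
    and U_cont: "continuous_on UNIV U"
  shows "\<exists>z\<ge>0. f z = 0 \<and> (\<forall>x. U x = z)"
proof -
  let ?N = "real DIM('a)"
  have N: "0 < ?N" by simp
  have ev: "\<forall>\<^sub>F n in sequentially. cball c r \<subseteq> ball 0 (real n) \<and> (\<forall>x\<in>cball c r. \<bar>u n x - U x\<bar> < e)"
    if "0 < e" for c :: 'a and r e
  proof -
    have "\<forall>\<^sub>F n in sequentially. norm c + r < real n"
      using filterlim_at_top_dense[of real sequentially] filterlim_real_sequentially by blast
    with conv[OF that, of "norm c + r"] show ?thesis
    proof eventually_elim
      case (elim n)
      have "norm x \<le> norm c + r" if "x \<in> cball c r" for x
        using that dist_triangle[of 0 x c] by simp
      with elim show ?case by fastforce
    qed
  qed
  have U0: "0 \<le> U x" for x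
  proof (rule field_le_epsilon)
    fix e :: real assume "0 < e"
    obtain n where "cball x 0 \<subseteq> ball 0 (real n)" "\<forall>y\<in>cball x 0. \<bar>u n y - U y\<bar> < e"
      using eventually_happens[OF ev[OF \<open>0 < e\<close>, of x 0]] by auto
    then have "0 \<le> u n x" "\<bar>u n x - U x\<bar> < e" using nonneg[of x n] by auto
    then show "0 \<le> U x + e" by linarith
  qed
  define m where "m = Inf (range U)"
  have bdd: "bdd_below (range U)" using U0 by (auto intro!: bdd_belowI[of _ 0])
  have m: "m \<le> U x" for x unfolding m_def using bdd by (simp add: cInf_lower)
  have m0: "0 \<le> m" unfolding m_def using U0 by (intro cInf_greatest) auto
  have m_inf: "\<exists>x. U x < m + e" if "0 < e" for e
    using cInf_less_iff[of "range U" "m + e"] bdd that unfolding m_def by auto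
  have fm: "f m = 0"
  proof (rule ccontr)
    assume "f m \<noteq> 0"
    then have pos: "0 < f m" using f_nonneg[OF m0] by simp
    \<comment> \<open>With this \<open>a\<close> the almost minimum produces a point where f(u)
      \<le> f(m) / 4, although u is there so close to m that f(u) > f(m) / 2 by continuity.\<close>
    define a where "a = f m / (8 * ?N)"
    have a: "0 < a" using pos N by (simp add: a_def)
    obtain \<delta> where \<delta>: "0 < \<delta>" "\<And>s. 0 \<le> s \<Longrightarrow> \<bar>s - m\<bar> < \<delta> \<Longrightarrow> \<bar>f s - f m\<bar> < f m / 2"
      using f_cont m0 pos unfolding continuous_on_iff dist_real_def by (metis atLeast_iff half_gt_zero)
    define \<eta> where "\<eta> = min \<delta> a / 4"
    have \<eta>: "0 < \<eta>" "4 * \<eta> \<le> \<delta>" "4 * \<eta> \<le> a" using \<delta>(1) a by (auto simp: \<eta>_def)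
    obtain c where c: "U c < m + \<eta>" using m_inf[OF \<eta>(1)] by blast
    obtain n where n: "cball c 1 \<subseteq> ball 0 (real n)" "\<And>x. x \<in> cball c 1 \<Longrightarrow> \<bar>u n x - U x\<bar> < \<eta>"
      using eventually_happens[OF ev[OF \<eta>(1), of c 1]] by auto
    have "\<exists>y\<in>ball c 1. u n y \<le> u n c \<and> f (u n y) \<le> 2 * ?N * a"
    proof (rule almost_min_small_source)
      show "continuous_on (cball c 1) (u n)" using cont n(1) continuous_on_subset by blast
      show "has_laplacian (u n) (- f (u n x)) x" if "x \<in> ball c 1" for x
        using sol[of x n] that n(1) ball_subset_cball by blast
      show "u n c < u n x + a" if "dist c x = 1" for x
      proof -
        have "\<bar>u n x - U x\<bar> < \<eta>" "\<bar>u n c - U c\<bar> < \<eta>" using n(2)[of x] n(2)[of c] that by auto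
        then show ?thesis using c m[of x] \<eta> by linarith
      qed
    qed (use a in simp)
    then obtain y where y: "y \<in> ball c 1" "u n y \<le> u n c" "f (u n y) \<le> 2 * ?N * a" by blast
    have yc: "y \<in> cball c 1" "c \<in> cball c 1" using y(1) by auto
    have "\<bar>u n y - m\<bar> < \<delta>"
      using n(2)[OF yc(1)] n(2)[OF yc(2)] c m[of y] y(2) \<eta> by linarith
    moreover have "0 \<le> u n y" using nonneg[of y n] n(1) yc(1) by blast
    ultimately have "f m / 2 < f (u n y)" using \<delta>(2)[of "u n y"] by linarith
    moreover have "2 * ?N * a = f m / 4" using N by (simp add: a_def)
    ultimately show False using y(3) pos by linarith
  qed
  have "U x = m" for x
  proof (rule ccontr)
    assume "U x \<noteq> m"
    then have x: "m < U x" using m[of x] by linarith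
    \<comment> \<open>Strong minimum principle: one value above \<open>m\<close> spreads to every
      other point through the annulus bound around \<open>x\<close>.\<close>
    have Upos: "m < U y" for y
    proof -
      define \<eta> where "\<eta> = (U x - m) / 3"
      have \<eta>: "0 < \<eta>" and Ux: "U x = m + 3 * \<eta>" using x by (simp_all add: \<eta>_def field_simps)
      obtain r where r: "0 < r" "\<And>z. dist z x < r \<Longrightarrow> \<bar>U z - U x\<bar> < \<eta>"
        using U_cont \<eta> unfolding continuous_on_iff dist_real_def by (metis UNIV_I)
      define \<rho> where "\<rho> = r / 2"
      have \<rho>: "0 < \<rho>" "\<rho> < r" using r by (auto simp: \<rho>_def)
      show ?thesis
      proof (cases "dist x y \<le> \<rho>")
        case True
        then have "\<bar>U y - U x\<bar> < \<eta>" using r \<rho> by (simp add: dist_commute)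
        then show ?thesis using \<eta> Ux by linarith
      next
        case False
        define L where "L = dist x y + 1"
        have L: "\<rho> < dist x y" "dist x y < L" using False by (auto simp: L_def)
        define \<theta> where "\<theta> = (1 / (dist x y)\<^sup>2 ^ DIM('a) - 1 / L\<^sup>2 ^ DIM('a)) / (1 / \<rho>\<^sup>2 ^ DIM('a) - 1 / L\<^sup>2 ^ DIM('a))"
        have dec: "1 / t\<^sup>2 ^ DIM('a) < 1 / s\<^sup>2 ^ DIM('a)" if "0 < s" "s < t" for s t :: real
        proof -
          have "s\<^sup>2 < t\<^sup>2" using that by (intro power_strict_mono) auto
          then have "s\<^sup>2 ^ DIM('a) < t\<^sup>2 ^ DIM('a)" by (rule power_strict_mono) auto
          then show ?thesis using that by (simp add: divide_strict_left_mono)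
        qed
        have "0 < dist x y" "\<rho> < L" using \<rho> L by linarith+
        then have \<theta>: "0 < \<theta>"
          unfolding \<theta>_def using dec[of \<rho> L] dec[of "dist x y" L] \<rho> L by (intro divide_pos_pos) simp_all
        \<comment> \<open>The annulus gain \<eta> \<theta> is at least 4 \<kappa>; the lower level m
          - \<kappa> and the approximation of U(y) cost one \<kappa> each, so a positive excess
          remains.\<close>
        define \<kappa> where "\<kappa> = min \<eta> (\<eta> * \<theta> / 4)"
        have \<kappa>: "0 < \<kappa>" "\<kappa> \<le> \<eta>" "4 * \<kappa> \<le> \<eta> * \<theta>" using \<eta> \<theta> by (auto simp: \<kappa>_def)
        obtain n where n: "cball x L \<subseteq> ball 0 (real n)" "\<And>z. z \<in> cball x L \<Longrightarrow> \<bar>u n z - U z\<bar> < \<kappa>"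
          using eventually_happens[OF ev[OF \<kappa>(1), of x L]] by auto
        have "m - \<kappa> + \<eta> * \<theta> \<le> u n y"
          unfolding \<theta>_def
        proof (rule superharmonic_annulus_lower_bound[where p=x and \<rho>=\<rho> and L=L])
          show "continuous_on (cball x L) (u n)" using cont n(1) continuous_on_subset by blast
          show "\<exists>l\<le>0. has_laplacian (u n) l z" if "z \<in> ball x L" for z
          proof -
            have "z \<in> ball 0 (real n)" using that n(1) ball_subset_cball by blast
            from sol[OF this] f_nonneg[OF nonneg[OF this]] show ?thesis
              by (intro exI[of _ "- f (u n z)"]) simp
          qed
          show "m - \<kappa> + \<eta> \<le> u n z" if "dist x z = \<rho>" for z
          proof -
            have "z \<in> cball x L" using that L by simp
            then have "\<bar>u n z - U z\<bar> < \<kappa>" by (rule n(2))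
            moreover have "\<bar>U z - U x\<bar> < \<eta>" using that r(2) \<rho> by (simp add: dist_commute)
            ultimately show ?thesis using \<kappa> Ux by linarith
          qed
          show "m - \<kappa> \<le> u n z" if "dist x z = L" for z
          proof -
            have "z \<in> cball x L" using that by simp
            from n(2)[OF this] m[of z] show ?thesis by linarith
          qed
        qed (use \<rho> L \<eta> in auto)
        moreover have "\<bar>u n y - U y\<bar> < \<kappa>" using L by (intro n(2)) simp
        ultimately show ?thesis using \<kappa> by linarith
      qed
    qed
    obtain c \<delta> where c: "0 < c" and \<delta>: "0 < \<delta>" and slope: "\<And>s. m < s \<Longrightarrow> s \<le> m + \<delta> \<Longrightarrow> c * (s - m) \<le> f s"
      using f_slope[OF m0 fm] by blast
    \<comment> \<open>Chosen so that 32 c (R - 1) equals \<open>(4 * ?N + 8)\<^sup>2\<close>; with R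
      \<ge> 1 this gives the discriminant condition of the bump argument.\<close>
    define R where "R = 1 + (4 * ?N + 8)\<^sup>2 / (32 * c)"
    have R: "1 \<le> R" "(4 * ?N + 8)\<^sup>2 < 32 * c * R\<^sup>2"
    proof -
      show "1 \<le> R" using c by (simp add: R_def)
      have "(4 * ?N + 8)\<^sup>2 = 32 * c * (R - 1)" using c by (simp add: R_def)
      also have "\<dots> < 32 * c * R" using c by simp
      also have "\<dots> \<le> 32 * c * R\<^sup>2" using c \<open>1 \<le> R\<close> by (simp add: power2_eq_square)
      finally show "(4 * ?N + 8)\<^sup>2 < 32 * c * R\<^sup>2" .
    qed
    obtain y where y: "U y < m + \<delta> / 2" using m_inf[of "\<delta> / 2"] \<delta> by auto
    have "continuous_on (cball y R) U" using U_cont continuous_on_subset by blast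
    moreover have "cball y R \<noteq> {}" using R(1) by simp
    ultimately have "\<exists>p\<in>cball y R. \<forall>z\<in>cball y R. U p \<le> U z"
      by (intro continuous_attains_inf compact_cball)
    then obtain p where p: "p \<in> cball y R" "\<And>z. z \<in> cball y R \<Longrightarrow> U p \<le> U z" by blast
    \<comment> \<open>The first entry, positive by compactness of the ball, keeps \<open>u n\<close>
      above \<open>m\<close> on the whole ball; the second lets u n(y) \<ge> m + \<delta> contradict
      U(y) < m + \<delta> / 2.\<close>
    define \<kappa> where "\<kappa> = min (U p - m) (\<delta> / 2)"
    have \<kappa>: "0 < \<kappa>" "\<kappa> \<le> U p - m" "\<kappa> \<le> \<delta> / 2"
      using Upos[of p] \<delta> min.cobounded1[of "U p - m" "\<delta> / 2"] min.cobounded2[of "U p - m" "\<delta> / 2"]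
      by (simp_all only: \<kappa>_def)
    obtain n where n: "cball y R \<subseteq> ball 0 (real n)" "\<And>z. z \<in> cball y R \<Longrightarrow> \<bar>u n z - U z\<bar> < \<kappa>"
      using eventually_happens[OF ev[OF \<kappa>(1), of y R]] by auto
    have "m + \<delta> \<le> u n y"
    proof (rule bump_lower_bound[where u="u n" and y=y and m=m and c=c and R=R and f=f])
      show "continuous_on (cball y R) (u n)" using cont n(1) continuous_on_subset by blast
      show "has_laplacian (u n) (- f (u n z)) z" if "z \<in> ball y R" for z
        using sol[of z n] that n(1) ball_subset_cball by blast
      show "m < u n z" if "z \<in> cball y R" for z
        using n(2)[OF that] p(2)[OF that] \<kappa> by linarith
    qed (use R c \<delta> slope in auto)
    moreover have "\<bar>u n y - U y\<bar> < \<kappa>" using R by (intro n(2)) simp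
    ultimately show False using y \<kappa> by linarith
  qed
  then show ?thesis using m0 fm by blast
qed

section \<open>Compactness of families of solutions\<close>

lemma has_partials_translate:
  assumes "has_partials S v D" "\<And>x. x \<in> T \<Longrightarrow> x + k \<in> S"
  shows "has_partials T (\<lambda>x. v (x + k)) (\<lambda>e x. D e (x + k))"
  unfolding has_partials_def
proof
  fix x assume "x \<in> T"
  then have 1: "(v has_derivative (\<lambda>k'. \<Sum>c\<in>Basis. (k' \<bullet> c) * D c (x + k))) (at (x + k))"
    using assms unfolding has_partials_def by blast
  have "((\<lambda>x. x + k) has_derivative (\<lambda>h. h)) (at x)"
    by (auto intro!: derivative_eq_intros)
  from has_derivative_compose[OF this 1]
  show "((\<lambda>x. v (x + k)) has_derivative (\<lambda>k'. \<Sum>c\<in>Basis. (k' \<bullet> c) * D c (x + k))) (at x)" .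
qed

lemma has_partials_lipschitz:
  fixes v :: "'a::euclidean_space \<Rightarrow> real" and G :: real
  assumes v: "has_partials S v D" and S: "convex S" and xy: "x \<in> S" "y \<in> S"
    and bd: "\<And>z e. z \<in> S \<Longrightarrow> e \<in> Basis \<Longrightarrow> \<bar>D e z\<bar> \<le> G"
  shows "\<bar>v x - v y\<bar> \<le> DIM('a) * G * dist x y"
proof -
  have seg: "x + t *\<^sub>R (y - x) \<in> S" if "0 \<le> t" "t \<le> 1" for t
    using convexD_alt[OF S xy, of t] that by (simp add: algebra_simps)
  then obtain t where t: "0 < t" "t < 1"
    "v (x + 1 *\<^sub>R (y - x)) - v (x + 0 *\<^sub>R (y - x)) = (1 - 0) * (\<Sum>c\<in>Basis. ((y - x) \<bullet> c) * D c (x + t *\<^sub>R (y - x)))"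
    using MVT2[of 0 1 "\<lambda>t. v (x + t *\<^sub>R (y - x))" "\<lambda>t. \<Sum>c\<in>Basis. ((y - x) \<bullet> c) * D c (x + t *\<^sub>R (y - x))"]
      has_partials_line[OF v] by auto
  have "\<bar>\<Sum>c\<in>Basis. ((y - x) \<bullet> c) * D c (x + t *\<^sub>R (y - x))\<bar> \<le> (\<Sum>c\<in>(Basis::'a set). dist x y * G)"
  proof (rule order_trans[OF sum_abs], rule sum_mono)
    fix c :: 'a assume c: "c \<in> Basis"
    show "\<bar>((y - x) \<bullet> c) * D c (x + t *\<^sub>R (y - x))\<bar> \<le> dist x y * G"
      unfolding abs_mult using bd[OF seg c, of t] t Basis_le_norm[OF c, of "y - x"]
      by (intro mult_mono) (auto simp: dist_norm norm_minus_commute)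
  qed
  then show ?thesis using t(3) by (simp add: abs_minus_commute mult_ac)
qed

text \<open>Contradiction by compactness: counterexamples on ever larger balls, translated to the
  origin, would have a limit that the Liouville argument identifies as a zero of \<open>f\<close>.
  The radius is uniform over all solutions and all centres.\<close>

lemma solution_nearly_constant:
  assumes f_nonneg: "\<And>s. 0 \<le> s \<Longrightarrow> 0 \<le> f s" and f_cont: "continuous_on {0..} f"
    and f_slope: "\<And>z. 0 \<le> z \<Longrightarrow> f z = 0 \<Longrightarrow>
      \<exists>c>0. \<exists>\<delta>>0. \<forall>s. z < s \<longrightarrow> s \<le> z + \<delta> \<longrightarrow> c * (s - z) \<le> f s"
    and \<epsilon>: "0 < \<epsilon>"
  shows "\<exists>R. \<forall>(u::'a::euclidean_space \<Rightarrow> real) D c. has_partials (ball c R) u D \<longrightarrow>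
     (\<forall>x\<in>ball c R. has_laplacian u (- f (u x)) x \<and> 0 \<le> u x \<and> u x \<le> M) \<longrightarrow>
     (\<exists>z\<in>{0..M}. f z = 0 \<and> (\<forall>x\<in>cball c L. \<bar>u x - z\<bar> \<le> \<epsilon>))"
proof (rule ccontr)
  assume "\<not> ?thesis"
  \<comment> \<open>The three extra units: one for the gradient estimate on unit balls, one so that
    the closed ball of radius n + 1 lies inside the open ball where the Lipschitz bound holds, one
    so that this closed ball contains the ball of radius n with room to spare.\<close>
  then have "\<forall>n. \<exists>(u::'a \<Rightarrow> real) D c. has_partials (ball c (real n + 3)) u D \<and>
     (\<forall>x\<in>ball c (real n + 3). has_laplacian u (- f (u x)) x \<and> 0 \<le> u x \<and> u x \<le> M) \<and>
     \<not> (\<exists>z\<in>{0..M}. f z = 0 \<and> (\<forall>x\<in>cball c L. \<bar>u x - z\<bar> \<le> \<epsilon>))" by blast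
  then obtain u D and c :: "nat \<Rightarrow> 'a" where u: "\<And>n. has_partials (ball (c n) (real n + 3)) (u n) (D n)"
     "\<And>n x. x\<in>ball (c n) (real n + 3) \<Longrightarrow> has_laplacian (u n) (- f (u n x)) x \<and> 0 \<le> u n x \<and> u n x \<le> M"
     "\<And>n. \<not> (\<exists>z\<in>{0..M}. f z = 0 \<and> (\<forall>x\<in>cball (c n) L. \<bar>u n x - z\<bar> \<le> \<epsilon>))"
    by metis
  define v where "v n x = u n (x + c n)" for n x
  have shift: "x + c n \<in> ball (c n) (real n + 3)" if "x \<in> ball 0 (real n + 3)" for n x
    using that by (simp add: dist_norm)
  have v: "has_partials (ball 0 (real n + 3)) (v n) (\<lambda>e x. D n e (x + c n))" for n
    using has_partials_translate[OF u(1) shift] unfolding v_def .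
  have vsol: "has_laplacian (v n) (- f (v n x)) x" "0 \<le> v n x" "v n x \<le> M" if "x \<in> ball 0 (real n + 3)" for n x
    using u(2)[OF shift[OF that]] has_laplacian_translate[of "u n" _ x "c n"] unfolding v_def by auto
  have M: "0 \<le> M" using vsol(2,3)[of 0 0] by simp
  have "compact (f ` {0..M})"
    by (intro compact_continuous_image continuous_on_subset[OF f_cont]) auto
  from compact_imp_bounded[OF this] obtain F where "\<forall>y\<in>f ` {0..M}. norm y \<le> F"
    unfolding bounded_iff by blast
  then have F: "\<bar>f s\<bar> \<le> F" if "0 \<le> s" "s \<le> M" for s using that by simp
  define \<Lambda> where "\<Lambda> = DIM('a) * (DIM('a) * M + F)"
  have F0: "0 \<le> F" using F[of 0] M by simp
  have \<Lambda>: "0 \<le> \<Lambda>" unfolding \<Lambda>_def using M F0 by simp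
  have vlip: "\<bar>v n x - v n y\<bar> \<le> \<Lambda> * dist x y" if xy: "x \<in> ball 0 (real n + 2)" "y \<in> ball 0 (real n + 2)" for n x y
    unfolding \<Lambda>_def
  proof (rule has_partials_lipschitz[OF _ convex_ball xy])
    show "has_partials (ball 0 (real n + 2)) (v n) (\<lambda>e x. D n e (x + c n))"
      by (rule has_partials_subset[OF v]) auto
    fix z e :: 'a assume z: "z \<in> ball 0 (real n + 2)" and e: "e \<in> Basis"
    have sub: "cball z 1 \<subseteq> ball 0 (real n + 3)"
    proof
      fix w assume "w \<in> cball z 1"
      then show "w \<in> ball 0 (real n + 3)" using z dist_triangle[of 0 w z] by simp
    qed
    have osc: "\<bar>v n w - v n z\<bar> \<le> M" if "w \<in> cball z 1" for w
    proof -
      have "w \<in> ball 0 (real n + 3)" "z \<in> ball 0 (real n + 3)" using that sub z by auto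
      from vsol(2,3)[OF this(1)] vsol(2,3)[OF this(2)] show ?thesis by linarith
    qed
    have "laplacian_bounded (ball 0 (real n + 3)) (v n) F"
      unfolding laplacian_bounded_def
    proof
      fix x :: 'a assume x: "x \<in> ball 0 (real n + 3)"
      show "\<exists>l. \<bar>l\<bar> \<le> F \<and> has_laplacian (v n) l x"
        using vsol[OF x] F[of "v n x"] by (intro exI[of _ "- f (v n x)"]) auto
    qed
    from partials_estimate[OF v this _ sub e osc]
    show "\<bar>D n e (z + c n)\<bar> \<le> DIM('a) * M + F" by simp
  qed
  \<comment> \<open>Precomposing with the projection onto a ball makes the sequence Lipschitz on the whole space with one constant.\<close>
  define V where "V n x = v n (closest_point (cball 0 (real n + 1)) x)" for n x
  have cp: "closest_point (cball 0 (real n + 1)) x \<in> cball 0 (real n + 1)" for n and x :: 'a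
  proof (rule closest_point_in_set)
    have "(0::'a) \<in> cball 0 (real n + 1)" by simp
    then show "cball (0::'a) (real n + 1) \<noteq> {}" by blast
  qed simp
  have cp_in: "closest_point (cball 0 (real n + 1)) x \<in> ball 0 (real n + 2)" for n and x :: 'a
    using cp[of n x] by simp
  have Veq: "V n x = v n x" if "x \<in> cball 0 (real n + 1)" for n x
    using that by (simp add: V_def closest_point_self)
  have Vbd: "norm (V n x) \<le> M" for n x
  proof -
    have "closest_point (cball 0 (real n + 1)) x \<in> ball 0 (real n + 3)" using cp_in[of n x] by simp
    from vsol(2,3)[OF this] show ?thesis by (simp add: V_def)
  qed
  have Vlip: "\<bar>V n x - V n y\<bar> \<le> \<Lambda> * dist x y" for n x y
  proof -
    have "\<bar>V n x - V n y\<bar> \<le> \<Lambda> * dist (closest_point (cball 0 (real n + 1)) x) (closest_point (cball 0 (real n + 1)) y)"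
      unfolding V_def by (rule vlip[OF cp_in cp_in])
    also have "\<dots> \<le> \<Lambda> * dist x y"
    proof (intro mult_left_mono \<Lambda> closest_point_lipschitz)
      have "(0::'a) \<in> cball 0 (real n + 1)" by simp
      then show "cball (0::'a) (real n + 1) \<noteq> {}" by blast
    qed auto
    finally show ?thesis .
  qed
  \<comment> \<open>Arzela-Ascoli treats one compact ball at a time; the diagonal subsequence serves
    all radii at once, since convergence survives altering finitely many terms and passing to
    subsequences.\<close>
  define P where "P i r \<longleftrightarrow> (\<exists>g::'a \<Rightarrow> real. \<forall>e>0. \<exists>N. \<forall>n x. N \<le> n \<and> x \<in> cball 0 (real i) \<longrightarrow> norm (V (r n) x - g x) < e)"
    for i and r :: "nat \<Rightarrow> nat"
  obtain k :: "nat \<Rightarrow> nat" where k: "strict_mono k" "\<And>i. P i (id \<circ> k)"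
  proof (rule subsequence_diagonalization_lemma[of P id])
    fix i and r :: "nat \<Rightarrow> nat"
    have equi: "\<exists>d. 0 < d \<and> (\<forall>n y. y \<in> cball 0 (real i) \<and> norm (x - y) < d \<longrightarrow> norm (V (r n) x - V (r n) y) < e)"
      if e: "0 < e" for x e
    proof (intro exI[of _ "e / (\<Lambda> + 1)"] conjI allI impI)
      show "0 < e / (\<Lambda> + 1)" using e \<Lambda> by simp
      fix n y assume *: "y \<in> cball 0 (real i) \<and> norm (x - y) < e / (\<Lambda> + 1)"
      have "norm (V (r n) x - V (r n) y) \<le> \<Lambda> * norm (x - y)" using Vlip[of "r n" x y] by (simp add: dist_norm)
      also have "\<dots> \<le> (\<Lambda> + 1) * norm (x - y)" by (simp add: distrib_right)
      also have "\<dots> < e" using * \<Lambda> by (simp add: pos_less_divide_eq mult.commute)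
      finally show "norm (V (r n) x - V (r n) y) < e" .
    qed
    show "\<exists>k. strict_mono k \<and> P i (r \<circ> k)"
    proof (rule Arzela_Ascoli[of "cball 0 (real i)" "\<lambda>n. V (r n)" M])
      show "norm (V (r n) x) \<le> M" for n x by (rule Vbd)
      show "\<exists>d>0. \<forall>n y. y \<in> cball 0 (real i) \<and> norm (x - y) < d \<longrightarrow> norm (V (r n) x - V (r n) y) < e"
        if "0 < e" for x e by (rule equi[OF that])
      fix g and k :: "nat \<Rightarrow> nat"
      assume "strict_mono k"
        "\<And>e. 0 < e \<Longrightarrow> \<exists>N. \<forall>n x. N \<le> n \<and> x \<in> cball 0 (real i) \<longrightarrow> norm (V (r (k n)) x - g x) < e"
      then show ?thesis unfolding P_def comp_def by blast
    qed simp
  next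
    fix i and r k1 k2 :: "nat \<Rightarrow> nat" and N
    assume P1: "P i (r \<circ> k1)" and k2: "\<And>j. N \<le> j \<Longrightarrow> \<exists>j'. j \<le> j' \<and> k2 j = k1 j'"
    from P1 obtain g where g: "\<And>e. 0 < e \<Longrightarrow> \<exists>N. \<forall>n x. N \<le> n \<and> x \<in> cball 0 (real i) \<longrightarrow> norm (V ((r \<circ> k1) n) x - g x) < e"
      unfolding P_def by blast
    have "\<exists>N. \<forall>n x. N \<le> n \<and> x \<in> cball 0 (real i) \<longrightarrow> norm (V ((r \<circ> k2) n) x - g x) < e" if e: "0 < e" for e
    proof -
      obtain N' where N': "\<And>n x. N' \<le> n \<Longrightarrow> x \<in> cball 0 (real i) \<Longrightarrow> norm (V ((r \<circ> k1) n) x - g x) < e"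
        using g[OF e] by blast
      show ?thesis
      proof (intro exI[of _ "max N N'"] allI impI)
        fix n and x :: 'a assume *: "max N N' \<le> n \<and> x \<in> cball 0 (real i)"
        then obtain j' where "n \<le> j'" "k2 n = k1 j'" using k2[of n] by auto
        then show "norm (V ((r \<circ> k2) n) x - g x) < e" using N'[of j' x] * by simp
      qed
    qed
    then show "P i (r \<circ> k2)" unfolding P_def by blast
  qed blast
  \<comment> \<open>Taking the pointwise limit glues the limits on the different balls: each of them
    must coincide with it on its own ball.\<close>
  define U where "U x = lim (\<lambda>n. V (k n) x)" for x
  have unif: "\<forall>\<^sub>F n in sequentially. \<forall>x\<in>cball 0 r. \<bar>V (k n) x - U x\<bar> < e" if e: "0 < e" for r e
  proof -
    obtain i where i: "r \<le> real i" using real_arch_simple by blast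
    obtain g where g: "\<And>e. 0 < e \<Longrightarrow> \<exists>N. \<forall>n x. N \<le> n \<and> x \<in> cball 0 (real i) \<longrightarrow> norm (V (k n) x - g x) < e"
      using k(2)[of i] unfolding P_def by auto
    have "U x = g x" if "x \<in> cball 0 (real i)" for x
    proof -
      have "(\<lambda>n. V (k n) x) \<longlonglongrightarrow> g x"
        using g that by (intro LIMSEQ_I) blast
      then show ?thesis unfolding U_def by (rule limI)
    qed
    moreover obtain N where "\<And>n x. N \<le> n \<Longrightarrow> x \<in> cball 0 (real i) \<Longrightarrow> norm (V (k n) x - g x) < e"
      using g[OF e] by blast
    ultimately show ?thesis using i unfolding eventually_sequentially by (intro exI[of _ N]) auto
  qed
  have pw: "(\<lambda>n. V (k n) x) \<longlonglongrightarrow> U x" for x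
    unfolding tendsto_iff dist_real_def
  proof (intro allI impI)
    fix e :: real assume "0 < e"
    from unif[OF this, of "norm x"] show "\<forall>\<^sub>F n in sequentially. \<bar>V (k n) x - U x\<bar> < e"
      by eventually_elim simp
  qed
  have "\<bar>U x - U y\<bar> \<le> \<Lambda> * dist x y" for x y
    by (rule tendsto_upperbound[OF tendsto_rabs[OF tendsto_diff[OF pw[of x] pw[of y]]]]) (auto simp: Vlip)
  then have "\<Lambda>-lipschitz_on UNIV U" using \<Lambda> by (intro lipschitz_onI) (auto simp: dist_real_def)
  then have U_cont: "continuous_on UNIV U" by (rule lipschitz_on_continuous_on)
  have kn: "real n \<le> real (k n)" for n using strict_mono_imp_increasing[OF k(1), of n] by simp
  have conv: "\<forall>\<^sub>F n in sequentially. \<forall>x\<in>cball 0 r. \<bar>v (k n) x - U x\<bar> < e" if e: "0 < e" for r e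
  proof -
    have "\<forall>\<^sub>F n in sequentially. r < real n"
      using filterlim_at_top_dense[of real sequentially] filterlim_real_sequentially by blast
    with unif[OF e, of r] show ?thesis
    proof eventually_elim
      case (elim n)
      have "V (k n) x = v (k n) x" if "x \<in> cball 0 r" for x
        using that elim(2) kn[of n] by (intro Veq) auto
      with elim(1) show ?case by simp
    qed
  qed
  have kball: "x \<in> ball 0 (real (k n) + 3)" if "x \<in> ball 0 (real n)" for x :: 'a and n
    using that kn[of n] by simp
  have "\<exists>z\<ge>0. f z = 0 \<and> (\<forall>x. U x = z)"
  proof (rule liouville_limit[where u="\<lambda>n. v (k n)", OF f_nonneg f_cont f_slope _ _ _ conv U_cont])
    show "continuous_on (ball 0 (real n)) (v (k n))" for n
      by (rule continuous_on_subset[OF has_partials_continuous[OF v]]) (use kball in blast)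
  qed (use vsol kball in blast)+
  then obtain z where z: "0 \<le> z" "f z = 0" "\<And>x. U x = z" by blast
  have "z \<le> M"
    using LIMSEQ_le_const2[OF pw[of 0], of M] Vbd[of _ 0] z(3) by (auto simp: abs_le_iff)
  obtain n where n: "\<forall>x\<in>cball 0 L. \<bar>v (k n) x - U x\<bar> < \<epsilon>"
    using eventually_happens'[OF sequentially_bot conv[OF \<epsilon>, of L]] by blast
  have "\<forall>x\<in>cball (c (k n)) L. \<bar>u (k n) x - z\<bar> \<le> \<epsilon>"
  proof
    fix x assume "x \<in> cball (c (k n)) L"
    then have "x - c (k n) \<in> cball 0 L" by (simp add: dist_norm norm_minus_commute)
    then have "\<bar>v (k n) (x - c (k n)) - U (x - c (k n))\<bar> < \<epsilon>" using n by blast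
    then show "\<bar>u (k n) x - z\<bar> \<le> \<epsilon>" by (simp add: v_def z(3))
  qed
  with u(3)[of "k n"] z \<open>z \<le> M\<close> show False by auto
qed

section \<open>Transfer to the function spaces on the closed half-space\<close>

text \<open>The condition under which Frechet derivatives within \<open>F\<close> are unique.\<close>

definition approachable :: "'a::euclidean_space set \<Rightarrow> bool" where
  "approachable F \<longleftrightarrow> (\<forall>x\<in>F. \<forall>b\<in>Basis. \<forall>e>0. \<exists>d. 0 < \<bar>d\<bar> \<and> \<bar>d\<bar> < e \<and> x + d *\<^sub>R b \<in> F)"

lemma approachable_open:
  assumes "open S" shows "approachable S"
  unfolding approachable_def
proof (intro ballI allI impI)
  fix x b :: 'a and e :: real assume x: "x \<in> S" and b: "b \<in> Basis" and e: "0 < e"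
  obtain r where r: "0 < r" "ball x r \<subseteq> S" using assms x open_contains_ball by blast
  have "x + (min r e / 2) *\<^sub>R b \<in> ball x r" using r(1) e b by (simp add: dist_norm)
  then show "\<exists>d. 0 < \<bar>d\<bar> \<and> \<bar>d\<bar> < e \<and> x + d *\<^sub>R b \<in> S"
    using r e by (intro exI[of _ "min r e / 2"]) auto
qed

lemma approachable_half_space:
  "approachable ({0..} \<times> UNIV :: (real \<times> 'b::euclidean_space) set)"
  unfolding approachable_def
proof (intro ballI allI impI)
  fix x b :: "real \<times> 'b" and e :: real
  assume x: "x \<in> {0..} \<times> UNIV" and b: "b \<in> Basis" and e: "0 < e"
  have "0 \<le> fst b" using b by (auto simp: Basis_prod_def)
  then have "0 \<le> fst x + e / 2 * fst b" using x e by auto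
  then show "\<exists>d. 0 < \<bar>d\<bar> \<and> \<bar>d\<bar> < e \<and> x + d *\<^sub>R b \<in> {0..} \<times> UNIV"
    using e by (intro exI[of _ "e / 2"]) (auto simp: mem_Times_iff)
qed

text \<open>Uniqueness of derivatives within \<open>F\<close> identifies the value chosen by
  \<open>frechet_derivative\<close>. Only values on \<open>F\<close> matter, so functions extended
  by \<open>undefined\<close> can be compared with smooth representatives.\<close>

lemma pderiv_on_eq:
  assumes F: "approachable F" and x: "x \<in> F"
    and G: "(G has_derivative G') (at x within F)" and eq: "\<And>y. y \<in> F \<Longrightarrow> g y = G y"
  shows "g differentiable (at x within F)" "b \<in> Basis \<Longrightarrow> pderiv_on F b g x = G' b"
proof -
  have g: "(g has_derivative G') (at x within F)"
    using has_derivative_transform[OF x _ G] eq by blast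
  then show "g differentiable (at x within F)" by (rule differentiableI)
  then have "(g has_derivative frechet_derivative g (at x within F)) (at x within F)"
    by (simp add: frechet_derivative_works)
  then have "frechet_derivative g (at x within F) = G'"
    by (rule frechet_derivative_unique_within[OF _ g]) (use F x in \<open>auto simp: approachable_def\<close>)
  then show "pderiv_on F b g x = G' b" by (simp add: pderiv_on_def)
qed

lemma differentiable_on_has_partials:
  fixes w :: "'a::euclidean_space \<Rightarrow> real"
  assumes w: "w differentiable_on S" and S: "open S"
  shows "has_partials S w (\<lambda>b. pderiv_on S b w)"
  unfolding has_partials_def
proof
  fix x assume x: "x \<in> S"
  let ?w' = "frechet_derivative w (at x within S)"
  have d: "w differentiable (at x within S)" using w x by (simp add: differentiable_on_def)
  then have w': "(w has_derivative ?w') (at x within S)" by (simp only: frechet_derivative_works)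
  have "?w' k = (\<Sum>c\<in>Basis. (k \<bullet> c) * pderiv_on S c w x)" for k
  proof -
    have lin: "linear ?w'" using d by (rule linear_frechet_derivative)
    have "?w' k = ?w' (\<Sum>c\<in>Basis. (k \<bullet> c) *\<^sub>R c)" by (simp add: euclidean_representation)
    also have "\<dots> = (\<Sum>c\<in>Basis. (k \<bullet> c) * ?w' c)"
      by (simp add: linear_sum[OF lin] linear_cmul[OF lin])
    finally show ?thesis by (simp add: pderiv_on_def)
  qed
  then have "?w' = (\<lambda>k. \<Sum>c\<in>Basis. (k \<bullet> c) * pderiv_on S c w x)" by (rule ext)
  then show "(w has_derivative (\<lambda>k. \<Sum>c\<in>Basis. (k \<bullet> c) * pderiv_on S c w x)) (at x)"
    using w' at_within_open[OF x S] by metis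
qed

text \<open>\<open>H c b\<close> is the derivative of \<open>D b\<close> in direction
  \<open>c\<close>. Derivatives within the open and within the closed half-space are different
  terms; explicit data can be translated from the one to the other.\<close>

definition C2_data :: "'a::euclidean_space set \<Rightarrow> ('a \<Rightarrow> real) \<Rightarrow> ('a \<Rightarrow> 'a \<Rightarrow> real) \<Rightarrow>
    ('a \<Rightarrow> 'a \<Rightarrow> 'a \<Rightarrow> real) \<Rightarrow> bool" where
  "C2_data S w D H \<longleftrightarrow> has_partials S w D \<and> (\<forall>b\<in>Basis. has_partials S (D b) (\<lambda>c. H c b) \<and>
     (\<forall>c\<in>Basis. continuous_on S (H c b)))"

lemma C2_on_C2_data:
  assumes w: "C2_on S w" and S: "open S"
  shows "C2_data S w (\<lambda>b. pderiv_on S b w) (\<lambda>c b. pderiv_on S c (pderiv_on S b w))"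
  using w differentiable_on_has_partials[OF _ S] unfolding C2_on_def C2_data_def by blast

lemma C2_data_has_laplacian:
  assumes w: "C2_data S w D H" and S: "open S" and x: "x \<in> S"
  shows "has_laplacian w (\<Sum>b\<in>Basis. H b b x) x"
proof (rule has_laplacianI[where p="\<lambda>b t. D b (x + t *\<^sub>R b)" and q="\<lambda>b. H b b x"])
  fix b :: 'a assume b: "b \<in> Basis"
  have "((\<lambda>t. x + t *\<^sub>R b) \<longlongrightarrow> x + 0 *\<^sub>R b) (nhds 0)"
    by (intro tendsto_intros filterlim_ident)
  then have "\<forall>\<^sub>F t in nhds 0. x + t *\<^sub>R b \<in> S"
    using S x by (intro topological_tendstoD) auto
  then show "\<forall>\<^sub>F t in nhds 0. ((\<lambda>t. w (x + t *\<^sub>R b)) has_real_derivative D b (x + t *\<^sub>R b)) (at t)"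
    by eventually_elim (use w b has_partials_basis_line in \<open>auto simp: C2_data_def\<close>)
  have "has_partials S (D b) (\<lambda>c. H c b)" using w b unfolding C2_data_def by blast
  from has_partials_basis_line[OF this _ b, of x 0] x
  show "((\<lambda>t. D b (x + t *\<^sub>R b)) has_real_derivative H b b x) (at 0)" by simp
qed simp

text \<open>The bridge from genuine derivatives at points of \<open>S\<close> to derivatives within
  a possibly closed \<open>F\<close>; the second-order claim applies the first-order one to
  \<open>pderiv_on F b v\<close>, which agrees with \<open>D b\<close> on \<open>F\<close>.\<close>

lemma C2_data_restrict:
  assumes F: "approachable F" "F \<subseteq> S" and w: "C2_data S w D H" and eq: "\<And>x. x \<in> F \<Longrightarrow> v x = w x"
  shows "C2_on F v"
    and "x \<in> F \<Longrightarrow> b \<in> Basis \<Longrightarrow> pderiv_on F b v x = D b x"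
    and "x \<in> F \<Longrightarrow> b \<in> Basis \<Longrightarrow> c \<in> Basis \<Longrightarrow> pderiv_on F c (pderiv_on F b v) x = H c b x"
proof -
  have within: "(g has_derivative (\<lambda>k. \<Sum>c\<in>Basis. (k \<bullet> c) * G c x)) (at x within F)"
    if "has_partials S g G" "x \<in> F" for g G x
    using that F(2) unfolding has_partials_def by (blast intro: has_derivative_at_withinI)
  have wD: "has_partials S w D" and DH: "\<And>b. b \<in> Basis \<Longrightarrow> has_partials S (D b) (\<lambda>c. H c b)"
    and H: "\<And>b c. b \<in> Basis \<Longrightarrow> c \<in> Basis \<Longrightarrow> continuous_on S (H c b)"
    using w unfolding C2_data_def by blast+
  have 1: "v differentiable (at x within F)" "b \<in> Basis \<Longrightarrow> pderiv_on F b v x = D b x" if x: "x \<in> F" for x b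
    using pderiv_on_eq[OF F(1) x within[OF wD x] eq] by (auto simp: sum_inner_Basis_mult)
  have 2: "pderiv_on F b v differentiable (at x within F)"
    "c \<in> Basis \<Longrightarrow> pderiv_on F c (pderiv_on F b v) x = H c b x" if x: "x \<in> F" and b: "b \<in> Basis" for x b c
    using pderiv_on_eq[OF F(1) x within[OF DH[OF b] x] 1(2)[OF _ b]] by (auto simp: sum_inner_Basis_mult)
  show "x \<in> F \<Longrightarrow> b \<in> Basis \<Longrightarrow> pderiv_on F b v x = D b x" by (rule 1(2))
  show "x \<in> F \<Longrightarrow> b \<in> Basis \<Longrightarrow> c \<in> Basis \<Longrightarrow> pderiv_on F c (pderiv_on F b v) x = H c b x" by (rule 2(2))
  have "continuous_on F (pderiv_on F c (pderiv_on F b v))" if "b \<in> Basis" "c \<in> Basis" for b c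
    using continuous_on_subset[OF H[OF that] F(2)] 2(2)[OF _ that] by (simp cong: continuous_on_cong)
  moreover have "v differentiable_on F" using 1(1) by (simp add: differentiable_on_def)
  moreover have "pderiv_on F b v differentiable_on F" if "b \<in> Basis" for b
    using 2(1)[OF _ that] by (simp add: differentiable_on_def)
  ultimately show "C2_on F v"
    unfolding C2_on_def using differentiable_imp_continuous_on by blast
qed

lemma C2_data_const: "C2_data S (\<lambda>_. z) (\<lambda>_ _. 0) (\<lambda>_ _ _. 0)"
  unfolding C2_data_def has_partials_def by auto

lemma C2_data_translate_add:
  assumes w: "C2_data S w D H" and T: "\<And>x. x \<in> T \<Longrightarrow> x + k \<in> S"
  shows "C2_data T (\<lambda>x. w (x + k) + z) (\<lambda>b x. D b (x + k)) (\<lambda>c b x. H c b (x + k))"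
  unfolding C2_data_def
proof (intro conjI ballI)
  have "has_partials T (\<lambda>x. w (x + k)) (\<lambda>b x. D b (x + k))"
    using w T unfolding C2_data_def by (intro has_partials_translate) auto
  then show "has_partials T (\<lambda>x. w (x + k) + z) (\<lambda>b x. D b (x + k))"
    unfolding has_partials_def by (auto intro!: derivative_eq_intros)
  fix b :: 'a assume b: "b \<in> Basis"
  show "has_partials T (\<lambda>x. D b (x + k)) (\<lambda>c x. H c b (x + k))"
    using w T b unfolding C2_data_def by (intro has_partials_translate) auto
  fix c :: 'a assume c: "c \<in> Basis"
  have "continuous_on S (H c b)" using w b c unfolding C2_data_def by blast
  then show "continuous_on T (\<lambda>x. H c b (x + k))"
    by (rule continuous_on_compose2) (use T in \<open>auto intro!: continuous_intros\<close>)
qed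

text \<open>The factor counts the summands of the norm: one for the function, N first derivatives,
  and \<open>N\<^sup>2\<close> second derivatives with as many Hoelder seminorms.\<close>

lemma C2_norm_le:
  fixes v :: "'a::euclidean_space \<Rightarrow> real" and A :: real
  assumes v: "\<And>x. x \<in> K \<Longrightarrow> \<bar>v x\<bar> \<le> A"
    and D: "\<And>x b. x \<in> K \<Longrightarrow> b \<in> Basis \<Longrightarrow> \<bar>pderiv_on F b v x\<bar> \<le> A"
    and H: "\<And>x b c. x \<in> K \<Longrightarrow> b \<in> Basis \<Longrightarrow> c \<in> Basis \<Longrightarrow> \<bar>pderiv_on F c (pderiv_on F b v) x\<bar> \<le> A"
    and hol: "\<And>x y b c. x \<in> K \<Longrightarrow> y \<in> K \<Longrightarrow> b \<in> Basis \<Longrightarrow> c \<in> Basis \<Longrightarrow>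
       \<bar>pderiv_on F c (pderiv_on F b v) x - pderiv_on F c (pderiv_on F b v) y\<bar> \<le> A * dist x y powr \<beta>"
    and A: "0 \<le> A"
  shows "C2_norm F \<beta> K v \<le> ennreal ((1 + real DIM('a) + 2 * (real DIM('a))\<^sup>2) * A)"
proof -
  let ?N = "real DIM('a)"
  have sup: "sup_norm_on K g \<le> ennreal A" if "\<And>x. x \<in> K \<Longrightarrow> \<bar>g x\<bar> \<le> A" for g
    unfolding sup_norm_on_def using that by (intro SUP_least ennreal_leI)
  have "holder_seminorm_on \<beta> K (pderiv_on F c (pderiv_on F b v)) \<le> ennreal A" if bc: "b \<in> Basis" "c \<in> Basis" for b c
    unfolding holder_seminorm_on_def
  proof (rule SUP_least, clarify)
    fix x y assume xy: "x \<in> K" "y \<in> K" "x \<noteq> y"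
    then have "0 < dist x y powr \<beta>" by simp
    then show "ennreal (\<bar>pderiv_on F c (pderiv_on F b v) x - pderiv_on F c (pderiv_on F b v) y\<bar> / dist x y powr \<beta>) \<le> ennreal A"
      using hol[OF xy(1,2) bc] by (intro ennreal_leI) (simp add: pos_divide_le_eq)
  qed
  then have "C2_norm F \<beta> K v \<le> ennreal A + (\<Sum>b\<in>(Basis::'a set). ennreal A) +
      (\<Sum>b\<in>(Basis::'a set). \<Sum>c\<in>(Basis::'a set). ennreal A + ennreal A)"
    unfolding C2_norm_def by (intro add_mono sum_mono sup v D H)
  also have "\<dots> = ennreal (A + ?N * A + ?N * (?N * (A + A)))"
    using A by (simp add: ennreal_of_nat_eq_real_of_nat flip: ennreal_plus ennreal_mult)
  also have "A + ?N * A + ?N * (?N * (A + A)) = (1 + real DIM('a) + 2 * (real DIM('a))\<^sup>2) * A"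
    by (simp add: algebra_simps power2_eq_square)
  finally show ?thesis .
qed

lemma sup_norm_on_le_C2_norm: "sup_norm_on K v \<le> C2_norm F \<beta> K v"
  unfolding C2_norm_def by (simp add: add.assoc)

lemma C2_const_on:
  fixes v :: "'a::euclidean_space \<Rightarrow> real" and z :: real
  assumes F: "approachable F" and v: "\<And>x. x \<in> F \<Longrightarrow> v x = z"
  shows "C2_on F v" "laplacian_on F v x = 0 \<or> x \<notin> F"
    "K \<subseteq> F \<Longrightarrow> C2_norm F \<beta> K v \<le> ennreal ((1 + real DIM('a) + 2 * (real DIM('a))\<^sup>2) * \<bar>z\<bar>)"
proof -
  note r = C2_data_restrict[where v=v and w="\<lambda>_. z", OF F order_refl C2_data_const]
  have c: "C2_on F v" "\<And>x b. x \<in> F \<Longrightarrow> b \<in> Basis \<Longrightarrow> pderiv_on F b v x = 0"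
    "\<And>x b c. x \<in> F \<Longrightarrow> b \<in> Basis \<Longrightarrow> c \<in> Basis \<Longrightarrow> pderiv_on F c (pderiv_on F b v) x = 0"
    using r v by blast+
  show "C2_on F v" by (rule c(1))
  show "laplacian_on F v x = 0 \<or> x \<notin> F" unfolding laplacian_on_def using c(3) by auto
  show "C2_norm F \<beta> K v \<le> ennreal ((1 + real DIM('a) + 2 * (real DIM('a))\<^sup>2) * \<bar>z\<bar>)" if "K \<subseteq> F"
  proof (rule C2_norm_le)
    have inF: "x \<in> F" if "x \<in> K" for x using that \<open>K \<subseteq> F\<close> by blast
    show "\<bar>pderiv_on F b v x\<bar> \<le> \<bar>z\<bar>" if "x \<in> K" "b \<in> Basis" for x b
      using c(2)[OF inF[OF that(1)] that(2)] by simp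
    show "\<bar>pderiv_on F d (pderiv_on F b v) x\<bar> \<le> \<bar>z\<bar>" if "x \<in> K" "b \<in> Basis" "d \<in> Basis" for x b d
      using c(3)[OF inF[OF that(1)] that(2,3)] by simp
    show "\<bar>pderiv_on F d (pderiv_on F b v) x - pderiv_on F d (pderiv_on F b v) y\<bar> \<le> \<bar>z\<bar> * dist x y powr \<beta>"
      if "x \<in> K" "y \<in> K" "b \<in> Basis" "d \<in> Basis" for x y b d
      using c(3)[OF inF[OF that(1)] that(3,4)] c(3)[OF inF[OF that(2)] that(3,4)] by simp
  qed (use that v in auto)
qed

text \<open>The radius 9 is the unit ball plus the margin 8 of the second-order estimate. The set
  \<open>X\<close> is arbitrary: nearby pairs lie in a common unit ball, distant pairs are covered
  by the sup bound.\<close>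

lemma solution_estimates:
  assumes \<beta>: "0 \<le> \<beta>" "\<beta> < 1" and \<Lambda>: "0 \<le> \<Lambda>"
  shows "\<exists>C\<ge>1. \<forall>(u::'a::euclidean_space \<Rightarrow> real) D H f \<Omega> X z a. open \<Omega> \<longrightarrow> C2_data \<Omega> u D H \<longrightarrow> 0 \<le> a \<longrightarrow>
     (\<forall>x\<in>\<Omega>. (\<Sum>b\<in>Basis. H b b x) = - f (u x)) \<longrightarrow>
     (\<forall>x\<in>\<Omega>. \<forall>y\<in>\<Omega>. \<bar>f (u x) - f (u y)\<bar> \<le> \<Lambda> * \<bar>u x - u y\<bar>) \<longrightarrow>
     (\<forall>x\<in>X. ball x 9 \<subseteq> \<Omega> \<and> (\<forall>y\<in>ball x 9. \<bar>u y - z\<bar> \<le> a \<and> \<bar>f (u y)\<bar> \<le> \<Lambda> * a)) \<longrightarrow>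
     (\<forall>x\<in>X. \<forall>y\<in>X. \<forall>b\<in>Basis. \<forall>c\<in>Basis. \<bar>u x - z\<bar> \<le> C * a \<and> \<bar>D b x\<bar> \<le> C * a \<and> \<bar>H c b x\<bar> \<le> C * a \<and>
        \<bar>H c b x - H c b y\<bar> \<le> C * a * dist x y powr \<beta>)"
proof -
  obtain C0 where C0: "0 \<le> C0" and est: "\<And>(w::'a \<Rightarrow> real) D H g c R a. has_partials (ball c (R + 8)) w D \<Longrightarrow>
     (\<forall>x\<in>ball c (R + 8). \<forall>b\<in>Basis. \<forall>e\<in>Basis.
        ((\<lambda>t. D e (x + t *\<^sub>R b)) has_real_derivative H b e x) (at 0)) \<Longrightarrow>
     (\<forall>x\<in>ball c (R + 8). has_laplacian w (g x) x \<and> \<bar>w x\<bar> \<le> a \<and> \<bar>g x\<bar> \<le> \<Lambda> * a) \<Longrightarrow>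
     (\<forall>x\<in>ball c (R + 8). \<forall>y\<in>ball c (R + 8). \<bar>g x - g y\<bar> \<le> \<Lambda> * \<bar>w x - w y\<bar>) \<Longrightarrow>
     (\<forall>x\<in>ball c R. \<forall>y\<in>ball c R. \<forall>b\<in>Basis. \<forall>e\<in>Basis.
        \<bar>D e x\<bar> \<le> C0 * a \<and> \<bar>H b e x\<bar> \<le> C0 * a \<and> \<bar>H b e x - H b e y\<bar> \<le> C0 * a * dist x y powr \<beta>)"
    using second_partials_estimate[OF \<beta> \<Lambda>, where 'a='a] by blast
  define C where "C = 1 + 2 * C0"
  have C: "1 \<le> C" "C0 \<le> C" "2 * C0 \<le> C" using C0 by (auto simp: C_def)
  show ?thesis
  proof (rule exI[of _ C], rule conjI[OF C(1)], intro allI impI)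
    fix u f D H \<Omega> X z and a :: real
    assume op: "open \<Omega>" and u: "C2_data (\<Omega>::'a set) u D H" and a: "0 \<le> a"
      and eq: "\<forall>x\<in>\<Omega>. (\<Sum>b\<in>Basis. H b b x) = - f (u x)"
      and lip: "\<forall>x\<in>\<Omega>. \<forall>y\<in>\<Omega>. \<bar>f (u x) - f (u y)\<bar> \<le> \<Lambda> * \<bar>u x - u y\<bar>"
      and X: "\<forall>x\<in>X. ball x 9 \<subseteq> \<Omega> \<and> (\<forall>y\<in>ball x 9. \<bar>u y - z\<bar> \<le> a \<and> \<bar>f (u y)\<bar> \<le> \<Lambda> * a)"
    have w: "C2_data \<Omega> (\<lambda>x. u x - z) D H"
      using C2_data_translate_add[OF u, of \<Omega> 0 "- z"] by simp
    have loc: "\<bar>D b p\<bar> \<le> C0 * a \<and> \<bar>H c b p\<bar> \<le> C0 * a \<and> \<bar>H c b p - H c b q\<bar> \<le> C0 * a * dist p q powr \<beta>"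
      if x: "x \<in> X" and pq: "p \<in> ball x 1" "q \<in> ball x 1" and bc: "b \<in> Basis" "c \<in> Basis" for x p q b c
    proof -
      have sub: "ball x (1 + 8) \<subseteq> \<Omega>" using X x by simp
      have "\<forall>p\<in>ball x 1. \<forall>q\<in>ball x 1. \<forall>b\<in>Basis. \<forall>e\<in>Basis.
        \<bar>D e p\<bar> \<le> C0 * a \<and> \<bar>H b e p\<bar> \<le> C0 * a \<and> \<bar>H b e p - H b e q\<bar> \<le> C0 * a * dist p q powr \<beta>"
      proof (rule est[where w="\<lambda>x. u x - z" and g="\<lambda>x. - f (u x)"])
        show "has_partials (ball x (1 + 8)) (\<lambda>x. u x - z) D"
          using w sub has_partials_subset unfolding C2_data_def by blast
        show "\<forall>x\<in>ball x (1 + 8). \<forall>b\<in>Basis. \<forall>e\<in>Basis. ((\<lambda>t. D e (x + t *\<^sub>R b)) has_real_derivative H b e x) (at 0)"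
        proof (intro ballI)
          fix p b e :: 'a assume p: "p \<in> ball x (1 + 8)" and b: "b \<in> Basis" and e: "e \<in> Basis"
          have "has_partials \<Omega> (D e) (\<lambda>c. H c e)" using u e unfolding C2_data_def by blast
          from has_partials_basis_line[OF this _ b, of p 0] p sub
          show "((\<lambda>t. D e (p + t *\<^sub>R b)) has_real_derivative H b e p) (at 0)" by auto
        qed
        show "\<forall>p\<in>ball x (1 + 8). has_laplacian (\<lambda>x. u x - z) (- f (u p)) p \<and> \<bar>u p - z\<bar> \<le> a \<and> \<bar>- f (u p)\<bar> \<le> \<Lambda> * a"
        proof
          fix p assume p: "p \<in> ball x (1 + 8)"
          then have "p \<in> \<Omega>" using sub by blast
          then have "has_laplacian (\<lambda>x. u x - z) (- f (u p)) p"
            using C2_data_has_laplacian[OF w op] eq by force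
          then show "has_laplacian (\<lambda>x. u x - z) (- f (u p)) p \<and> \<bar>u p - z\<bar> \<le> a \<and> \<bar>- f (u p)\<bar> \<le> \<Lambda> * a"
            using X x p by auto
        qed
        show "\<forall>p\<in>ball x (1 + 8). \<forall>q\<in>ball x (1 + 8). \<bar>- f (u p) - - f (u q)\<bar> \<le> \<Lambda> * \<bar>u p - z - (u q - z)\<bar>"
        proof (intro ballI)
          fix p q assume "p \<in> ball x (1 + 8)" "q \<in> ball x (1 + 8)"
          then have "\<bar>f (u p) - f (u q)\<bar> \<le> \<Lambda> * \<bar>u p - u q\<bar>" using lip sub by blast
          then show "\<bar>- f (u p) - - f (u q)\<bar> \<le> \<Lambda> * \<bar>u p - z - (u q - z)\<bar>"
            by (simp add: abs_minus_commute)
        qed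
      qed
      then show ?thesis using pq bc by blast
    qed
    have Ca: "a \<le> C * a" "C0 * a \<le> C * a" "2 * (C0 * a) \<le> C * a"
      using C a mult_right_mono[of 1 C a] mult_right_mono[of C0 C a] mult_right_mono[of "2 * C0" C a] by (auto simp: mult.assoc)
    show "\<forall>x\<in>X. \<forall>y\<in>X. \<forall>b\<in>Basis. \<forall>c\<in>Basis. \<bar>u x - z\<bar> \<le> C * a \<and> \<bar>D b x\<bar> \<le> C * a \<and> \<bar>H c b x\<bar> \<le> C * a \<and>
        \<bar>H c b x - H c b y\<bar> \<le> C * a * dist x y powr \<beta>"
    proof (intro ballI)
      fix x y b c :: 'a assume xy: "x \<in> X" "y \<in> X" and bc: "b \<in> Basis" "c \<in> Basis"
      have self: "x \<in> ball x 1" "y \<in> ball y 1" "x \<in> ball x 9" by auto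
      have x1: "\<bar>D b x\<bar> \<le> C0 * a" "\<bar>H c b x\<bar> \<le> C0 * a" "\<bar>H c b y\<bar> \<le> C0 * a"
        using loc[OF xy(1) self(1) self(1) bc] loc[OF xy(2) self(2) self(2) bc] by auto
      have "\<bar>H c b x - H c b y\<bar> \<le> C * a * dist x y powr \<beta>"
      proof (cases "dist x y < 1")
        case True
        then have "y \<in> ball x 1" by simp
        then have "\<bar>H c b x - H c b y\<bar> \<le> C0 * a * dist x y powr \<beta>" using loc[OF xy(1) self(1) _ bc] by blast
        also have "\<dots> \<le> C * a * dist x y powr \<beta>" by (rule mult_right_mono[OF Ca(2)]) simp
        finally show ?thesis .
      next
        \<comment> \<open>At distance at least 1 the power of the distance is at least 1, so the sum
          of two sup bounds suffices; hence 2 * C0 in \<open>C\<close>.\<close>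
        case False
        then have "1 \<le> dist x y powr \<beta>" using \<beta> by (intro ge_one_powr_ge_zero) auto
        then have "C * a * 1 \<le> C * a * dist x y powr \<beta>" using C a by (intro mult_left_mono) auto
        then show ?thesis using x1 Ca by linarith
      qed
      moreover have "\<bar>u x - z\<bar> \<le> a" using X xy(1) self(3) by blast
      ultimately show "\<bar>u x - z\<bar> \<le> C * a \<and> \<bar>D b x\<bar> \<le> C * a \<and> \<bar>H c b x\<bar> \<le> C * a \<and>
        \<bar>H c b x - H c b y\<bar> \<le> C * a * dist x y powr \<beta>"
        using x1 Ca by linarith
    qed
  qed
qed

section \<open>Convergence of trajectories\<close>

text \<open>Compactness of \<open>E\<close> gives a cluster value l. Arbitrarily close to l on both
  sides there are values outside \<open>E\<close>, which \<open>g\<close> eventually never takes; by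
  connectedness \<open>g\<close> is trapped between them once it has come near l.\<close>

lemma tendsto_of_attraction:
  fixes g :: "real \<Rightarrow> real"
  assumes g: "continuous_on {0..} g" and E: "compact E"
    and gaps: "\<And>a b. a < b \<Longrightarrow> \<exists>t. a < t \<and> t < b \<and> t \<notin> E"
    and attr: "\<And>e. 0 < e \<Longrightarrow> \<forall>\<^sub>F h in at_top. \<exists>z\<in>E. \<bar>g h - z\<bar> \<le> e"
  shows "\<exists>z\<in>E. (g \<longlongrightarrow> z) at_top"
proof -
  have "\<exists>h z. real n \<le> h \<and> z \<in> E \<and> \<bar>g h - z\<bar> \<le> 1 / (real n + 1)" for n
  proof -
    have "\<forall>\<^sub>F h in at_top. real n \<le> h \<and> (\<exists>z\<in>E. \<bar>g h - z\<bar> \<le> 1 / (real n + 1))"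
      using eventually_ge_at_top[of "real n"] attr[of "1 / (real n + 1)"] by (intro eventually_conj) auto
    from eventually_happens'[OF _ this] show ?thesis by auto
  qed
  then obtain h z where hz: "\<And>n. real n \<le> h n" "\<And>n. z n \<in> E" "\<And>n. \<bar>g (h n) - z n\<bar> \<le> 1 / (real n + 1)"
    by metis
  obtain l r where l: "l \<in> E" "strict_mono (r :: nat \<Rightarrow> nat)" "(z \<circ> r) \<longlonglongrightarrow> l"
    using E hz(2) unfolding compact_def by meson
  have lim: "(\<lambda>n. g (h (r n))) \<longlonglongrightarrow> l"
  proof -
    have "(\<lambda>n. 1 / (real n + 1)) \<longlonglongrightarrow> 0" by real_asymp
    from LIMSEQ_subseq_LIMSEQ[OF this l(2)]
    have "(\<lambda>n. g (h (r n)) - z (r n)) \<longlonglongrightarrow> 0"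
      by (rule Lim_null_comparison[rotated]) (auto simp: hz(3))
    from tendsto_add[OF this l(3)] show ?thesis by (simp add: comp_def)
  qed
  \<comment> \<open>\<open>E\<close> is closed, so a value outside it has positive distance from
    \<open>E\<close>, while \<open>g\<close> comes arbitrarily close to \<open>E\<close>.\<close>
  have sep: "\<forall>\<^sub>F h in at_top. g h \<noteq> t" if t: "t \<notin> E" for t
  proof -
    have "open (- E)" using compact_imp_closed[OF E] by (rule open_Compl)
    then obtain d where "0 < d" "ball t d \<subseteq> - E" using t by (meson ComplI openE)
    then have d: "0 < d" "\<And>y. dist t y < d \<Longrightarrow> y \<notin> E" by auto
    have "\<forall>\<^sub>F h in at_top. \<exists>z\<in>E. \<bar>g h - z\<bar> \<le> d / 2" using d by (intro attr) simp
    then show ?thesis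
    proof eventually_elim
      case (elim h)
      then obtain z where "z \<in> E" "\<bar>g h - z\<bar> \<le> d / 2" by blast
      then show ?case using d(2)[of z] d(1) by (auto simp: dist_real_def)
    qed
  qed
  have "(g \<longlongrightarrow> l) at_top"
  proof (rule tendstoI)
    fix e :: real assume e: "0 < e"
    obtain t1 where t1: "l - e < t1" "t1 < l" "t1 \<notin> E" using gaps[of "l - e" l] e by auto
    obtain t2 where t2: "l < t2" "t2 < l + e" "t2 \<notin> E" using gaps[of l "l + e"] e by auto
    obtain H where H: "0 \<le> H" "\<And>h. H \<le> h \<Longrightarrow> g h \<noteq> t1 \<and> g h \<noteq> t2"
    proof -
      obtain H where "\<And>h. H \<le> h \<Longrightarrow> g h \<noteq> t1 \<and> g h \<noteq> t2"
        using eventually_conj[OF sep[OF t1(3)] sep[OF t2(3)]] unfolding eventually_at_top_linorder by blast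
      then show ?thesis using that[of "max 0 H"] by auto
    qed
    obtain h0 where h0: "H \<le> h0" "t1 < g h0" "g h0 < t2"
    proof -
      have "\<forall>\<^sub>F n in sequentially. t1 < g (h (r n)) \<and> g (h (r n)) < t2"
        using order_tendstoD[OF lim] t1 t2 by (intro eventually_conj) auto
      moreover have "\<forall>\<^sub>F n in sequentially. H \<le> real n"
        using filterlim_real_sequentially unfolding filterlim_at_top by blast
      ultimately have "\<forall>\<^sub>F n in sequentially. H \<le> h (r n) \<and> t1 < g (h (r n)) \<and> g (h (r n)) < t2"
      proof eventually_elim
        case (elim n)
        have "real n \<le> real (r n)" using strict_mono_imp_increasing[OF l(2), of n] by simp
        with elim hz(1)[of "r n"] show ?case by linarith
      qed
      from eventually_happens'[OF _ this] that show ?thesis by auto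
    qed
    have conn: "connected (g ` {H..})"
      using H(1) by (intro connected_continuous_image continuous_on_subset[OF g]) auto
    have "t1 < g h \<and> g h < t2" if "H \<le> h" for h
    proof (rule ccontr)
      assume "\<not> ?thesis"
      then have "g h \<le> t1 \<or> t2 \<le> g h" by auto
      then have "t1 \<in> g ` {H..} \<or> t2 \<in> g ` {H..}"
        using connectedD_interval[OF conn, of "g h" "g h0" t1] connectedD_interval[OF conn, of "g h0" "g h" t2] that h0
        by fastforce
      then show False using H(2) by auto
    qed
    then have "dist (g h) l < e" if "H \<le> h" for h
      using that t1 t2 by (fastforce simp: dist_real_def)
    then show "\<forall>\<^sub>F h in at_top. dist (g h) l < e" unfolding eventually_at_top_linorder by blast
  qed
  with l(1) show ?thesis by blast
qed

text \<open>Point evaluation is continuous because a one-point set is an admissible compact set.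
  This reduces uniqueness of limits to that of real limits.\<close>

lemma limitin_C2_loc_topology_eval:
  assumes lim: "limitin (C2_loc_topology F \<beta>) w l G" and x: "x \<in> F"
  shows "((\<lambda>h. w h x) \<longlongrightarrow> l x) G"
proof (rule tendstoI)
  fix e :: real assume e: "0 < e"
  define V where "V = {v \<in> C2_loc F \<beta>. \<bar>v x - l x\<bar> < e}"
  have "openin (C2_loc_topology F \<beta>) V"
    unfolding openin_C2_loc_topology
  proof (intro conjI ballI)
    show "V \<subseteq> C2_loc F \<beta>" by (auto simp: V_def)
    fix v assume v: "v \<in> V"
    define d where "d = e - \<bar>v x - l x\<bar>"
    have "{v' \<in> C2_loc F \<beta>. C2_norm F \<beta> {x} (\<lambda>y. v' y - v y) < ennreal d} \<subseteq> V"
    proof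
      fix v' assume v': "v' \<in> {v' \<in> C2_loc F \<beta>. C2_norm F \<beta> {x} (\<lambda>y. v' y - v y) < ennreal d}"
      have "ennreal \<bar>v' x - v x\<bar> = sup_norm_on {x} (\<lambda>y. v' y - v y)" by (simp add: sup_norm_on_def)
      also have "\<dots> \<le> C2_norm F \<beta> {x} (\<lambda>y. v' y - v y)" by (rule sup_norm_on_le_C2_norm)
      also have "\<dots> < ennreal d" using v' by simp
      finally have "\<bar>v' x - v x\<bar> < d" by (simp add: ennreal_less_iff)
      then show "v' \<in> V" using v' unfolding V_def d_def by auto
    qed
    then show "\<exists>K d. compact K \<and> K \<subseteq> F \<and> 0 < d \<and> {v' \<in> C2_loc F \<beta>. C2_norm F \<beta> K (\<lambda>y. v' y - v y) < ennreal d} \<subseteq> V"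
      using x v by (intro exI[of _ "{x}"] exI[of _ d]) (auto simp: V_def d_def)
  qed
  moreover have "l \<in> V"
    using lim e limitin_topspace[OF lim] by (simp add: V_def topspace_C2_loc_topology)
  ultimately have "\<forall>\<^sub>F h in G. w h \<in> V" using lim unfolding limitin_def by blast
  then show "\<forall>\<^sub>F h in G. dist (w h x) (l x) < e"
    by eventually_elim (simp add: V_def dist_real_def)
qed

section \<open>Constants and solutions in the function spaces\<close>

lemma const_C2_loc:
  assumes "approachable F"
  shows "restrict (\<lambda>_. z) F \<in> C2_loc F \<beta>"
proof -
  have "C2_norm F \<beta> K (restrict (\<lambda>_. z) F) < \<infinity>" if "K \<subseteq> F" for K
    by (rule le_less_trans[OF C2_const_on(3)[OF assms _ that]]) auto
  then show ?thesis using C2_const_on(1)[OF assms, of "restrict (\<lambda>_. z) F" z] by (simp add: C2_loc_def)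
qed

lemma bounded_in_C2_b_const:
  fixes F :: "'a::euclidean_space set"
  assumes F: "approachable F" and S: "S \<subseteq> {0..M}"
  shows "bounded_in_C2_b F \<beta> ((\<lambda>z. restrict (\<lambda>_. z) F) ` S)"
proof -
  define N where "N = 1 + real DIM('a) + 2 * (real DIM('a))\<^sup>2"
  have bd: "C2_b_norm F \<beta> (restrict (\<lambda>_. z) F) \<le> ennreal (N * M)" if z: "z \<in> S" for z
    unfolding C2_b_norm_def
  proof (rule SUP_least)
    fix x
    have "C2_norm F \<beta> (closure (ball x 1) \<inter> F) (restrict (\<lambda>_. z) F) \<le> ennreal (N * \<bar>z\<bar>)"
      using C2_const_on(3)[OF F, of "restrict (\<lambda>_. z) F" z] by (simp add: N_def)
    also have "\<dots> \<le> ennreal (N * M)" using z S by (intro ennreal_leI mult_left_mono) (auto simp: N_def)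
    finally show "C2_norm F \<beta> (closure (ball x 1) \<inter> F) (restrict (\<lambda>_. z) F) \<le> ennreal (N * M)" .
  qed
  have "restrict (\<lambda>_. z) F \<in> C2_b F \<beta>" if "z \<in> S" for z
    using C2_const_on(1)[OF F, of "restrict (\<lambda>_. z) F" z] le_less_trans[OF bd[OF that]] by (simp add: C2_b_def)
  with bd show ?thesis unfolding bounded_in_C2_b_def by blast
qed

text \<open>The embedding of the reals as constants is continuous, the norm of a difference of
  constants being at most a multiple of the distance; compactness passes to the image.\<close>

lemma compactin_C2_loc_const:
  fixes F :: "'a::euclidean_space set"
  assumes F: "approachable F" and E: "compact E"
  shows "compactin (C2_loc_topology F \<beta>) ((\<lambda>z. restrict (\<lambda>_. z) F) ` E)"
proof (rule image_compactin)
  show "compactin (top_of_set E) E" using E by (simp add: compactin_subtopology)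
  show "continuous_map (top_of_set E) (C2_loc_topology F \<beta>) (\<lambda>z. restrict (\<lambda>_. z) F)"
    unfolding continuous_map_def
  proof (intro conjI allI impI)
    show "(\<lambda>z. restrict (\<lambda>_. z) F) \<in> topspace (top_of_set E) \<rightarrow> topspace (C2_loc_topology F \<beta>)"
      using const_C2_loc[OF F] by (auto simp: topspace_C2_loc_topology)
    fix U assume U: "openin (C2_loc_topology F \<beta>) U"
    show "openin (top_of_set E) {z \<in> topspace (top_of_set E). restrict (\<lambda>_. z) F \<in> U}"
      unfolding openin_contains_ball
    proof (intro conjI ballI)
      fix z assume "z \<in> {z \<in> topspace (top_of_set E). restrict (\<lambda>_. z) F \<in> U}"
      then have "restrict (\<lambda>_. z) F \<in> U" by simp
      then obtain K \<epsilon> where K: "K \<subseteq> F" "0 < \<epsilon>"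
        "{v \<in> C2_loc F \<beta>. C2_norm F \<beta> K (\<lambda>x. v x - restrict (\<lambda>_. z) F x) < ennreal \<epsilon>} \<subseteq> U"
        using U unfolding openin_C2_loc_topology by meson
      define N where "N = 1 + real DIM('a) + 2 * (real DIM('a))\<^sup>2"
      have N: "0 < N" unfolding N_def by (intro add_pos_nonneg) auto
      have "restrict (\<lambda>_. z') F \<in> U" if "\<bar>z' - z\<bar> < \<epsilon> / N" for z'
      proof -
        have "C2_norm F \<beta> K (\<lambda>x. restrict (\<lambda>_. z') F x - restrict (\<lambda>_. z) F x) \<le> ennreal (N * \<bar>z' - z\<bar>)"
          using C2_const_on(3)[OF F _ K(1), of "\<lambda>x. restrict (\<lambda>_. z') F x - restrict (\<lambda>_. z) F x" "z' - z"]
          by (simp add: N_def)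
        also have "\<dots> < ennreal \<epsilon>" using that N K(2) by (intro ennreal_lessI) (auto simp: field_simps)
        finally show ?thesis using K(3) const_C2_loc[OF F] by blast
      qed
      then show "\<exists>e>0. ball z e \<inter> E \<subseteq> {z \<in> topspace (top_of_set E). restrict (\<lambda>_. z) F \<in> U}"
        using K(2) N by (intro exI[of _ "\<epsilon> / N"]) (auto simp: dist_real_def abs_minus_commute)
    qed auto
  qed
qed

lemma bnn_solution_C2_data:
  assumes u: "u \<in> bnn_solutions_le \<Omega> f M" and \<Omega>: "open \<Omega>"
  shows "C2_data \<Omega> u (\<lambda>b. pderiv_on \<Omega> b u) (\<lambda>c b. pderiv_on \<Omega> c (pderiv_on \<Omega> b u))"
    and "\<And>x. x \<in> \<Omega> \<Longrightarrow> (\<Sum>b\<in>Basis. pderiv_on \<Omega> b (pderiv_on \<Omega> b u) x) = - f (u x)"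
    and "\<And>x. x \<in> \<Omega> \<Longrightarrow> 0 \<le> u x \<and> u x \<le> M"
proof -
  show "C2_data \<Omega> u (\<lambda>b. pderiv_on \<Omega> b u) (\<lambda>c b. pderiv_on \<Omega> c (pderiv_on \<Omega> b u))"
    using u \<Omega> by (intro C2_on_C2_data) (auto simp: bnn_solutions_le_def bnn_solutions_def)
  fix x assume x: "x \<in> \<Omega>"
  have "laplacian_on \<Omega> u x + f (u x) = 0" using u x by (auto simp: bnn_solutions_le_def bnn_solutions_def)
  then show "(\<Sum>b\<in>Basis. pderiv_on \<Omega> b (pderiv_on \<Omega> b u) x) = - f (u x)" by (simp add: laplacian_on_def)
  have "x \<in> closure \<Omega>" using x closure_subset by blast
  then show "0 \<le> u x \<and> u x \<le> M" using u by (auto simp: bnn_solutions_le_def bnn_solutions_def)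
qed

text \<open>The domain is quantified after \<open>R\<close>, so that one radius serves both
  trajectories in the half-space and solutions in the whole space.\<close>

lemma bnn_solution_nearly_constant:
  assumes f_nonneg: "\<And>s. 0 \<le> s \<Longrightarrow> 0 \<le> f s" and f_cont: "continuous_on {0..} f"
    and f_slope: "\<And>z. 0 \<le> z \<Longrightarrow> f z = 0 \<Longrightarrow>
      \<exists>c>0. \<exists>\<delta>>0. \<forall>s. z < s \<longrightarrow> s \<le> z + \<delta> \<longrightarrow> c * (s - z) \<le> f s"
    and \<epsilon>: "0 < \<epsilon>"
  shows "\<exists>R. \<forall>\<Omega>. \<forall>u\<in>bnn_solutions_le \<Omega> f M. \<forall>c. open (\<Omega> :: 'a::euclidean_space set) \<longrightarrow> ball c R \<subseteq> \<Omega> \<longrightarrow>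
     (\<exists>z\<in>{0..M}. f z = 0 \<and> (\<forall>x\<in>cball c L. \<bar>u x - z\<bar> \<le> \<epsilon>))"
proof -
  have "\<exists>R. \<forall>(u::'a \<Rightarrow> real) D c. has_partials (ball c R) u D \<longrightarrow>
     (\<forall>x\<in>ball c R. has_laplacian u (- f (u x)) x \<and> 0 \<le> u x \<and> u x \<le> M) \<longrightarrow>
     (\<exists>z\<in>{0..M}. f z = 0 \<and> (\<forall>x\<in>cball c L. \<bar>u x - z\<bar> \<le> \<epsilon>))"
    by (rule solution_nearly_constant) (erule f_nonneg, rule f_cont, erule (1) f_slope, rule \<epsilon>)
  then obtain R where R: "\<forall>(u::'a \<Rightarrow> real) D c. has_partials (ball c R) u D \<longrightarrow>
     (\<forall>x\<in>ball c R. has_laplacian u (- f (u x)) x \<and> 0 \<le> u x \<and> u x \<le> M) \<longrightarrow>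
     (\<exists>z\<in>{0..M}. f z = 0 \<and> (\<forall>x\<in>cball c L. \<bar>u x - z\<bar> \<le> \<epsilon>))" ..
  show ?thesis
  proof (intro exI[of _ R] allI ballI impI)
    fix \<Omega> u and c :: 'a
    assume u: "u \<in> bnn_solutions_le \<Omega> f M" and \<Omega>: "open \<Omega>" and sub: "ball c R \<subseteq> \<Omega>"
    note data = bnn_solution_C2_data[OF u \<Omega>]
    show "\<exists>z\<in>{0..M}. f z = 0 \<and> (\<forall>x\<in>cball c L. \<bar>u x - z\<bar> \<le> \<epsilon>)"
    proof (rule R[THEN spec[of _ u], THEN spec[of _ "\<lambda>b. pderiv_on \<Omega> b u"], THEN spec[of _ c], THEN mp, THEN mp])
      show "has_partials (ball c R) u (\<lambda>b. pderiv_on \<Omega> b u)"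
        using data(1) sub has_partials_subset unfolding C2_data_def by blast
      show "\<forall>x\<in>ball c R. has_laplacian u (- f (u x)) x \<and> 0 \<le> u x \<and> u x \<le> M"
      proof
        fix x assume "x \<in> ball c R"
        then have x: "x \<in> \<Omega>" using sub by blast
        from C2_data_has_laplacian[OF data(1) \<Omega> x] data(2)[OF x] data(3)[OF x]
        show "has_laplacian u (- f (u x)) x \<and> 0 \<le> u x \<and> u x \<le> M" by simp
      qed
    qed
  qed
qed

lemma const_bnn_solution:
  assumes S: "open S" and z: "0 \<le> z" "z \<le> M" "f z = 0"
  shows "restrict (\<lambda>_. z) (closure S) \<in> bnn_solutions_le S f M"
proof -
  let ?c = "restrict (\<lambda>_. z) (closure S)"
  have c: "?c x = z" if "x \<in> S" for x using that closure_subset[of S] by auto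
  note C2 = C2_const_on[OF approachable_open[OF S], of ?c z, OF c]
  have "laplacian_on S ?c x + f (?c x) = 0" if "x \<in> S" for x
    using C2(2)[of x] that c[OF that] z by simp
  moreover have "continuous_on (closure S) ?c"
    by (rule continuous_on_eq[OF continuous_on_const[of _ z]]) simp
  moreover have "bounded (?c ` closure S)"
    by (rule bounded_subset[of "{z}"]) auto
  ultimately show ?thesis
    using C2(1) z unfolding bnn_solutions_le_def bnn_solutions_def by auto
qed

text \<open>A shift by at least 9 moves the closed half-space so far inside that all balls of radius
  9 avoid the boundary x1 = 0. The function \<open>v\<close> covers two uses: z = 0 for the shifted
  solution itself, and z a zero of \<open>f\<close> for its distance to that constant.\<close>

lemma shift_estimate:
  fixes f :: "real \<Rightarrow> real"
  assumes \<beta>: "0 \<le> \<beta>" "\<beta> < 1" and lip: "\<Lambda>-lipschitz_on {0..M} f"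
  defines "\<Omega> \<equiv> {0<..} \<times> UNIV :: (real \<times> 'b::euclidean_space) set"
    and "F \<equiv> {0..} \<times> UNIV :: (real \<times> 'b) set"
  shows "\<exists>C\<ge>1. \<forall>u\<in>bnn_solutions_le \<Omega> f M. \<forall>h\<ge>9. \<forall>z a v K. 0 \<le> a \<longrightarrow>
     (\<forall>x\<in>F. v x = u (x + (h, 0)) - z) \<longrightarrow>
     C2_on F v \<and> (K \<subseteq> F \<longrightarrow> (\<forall>x\<in>K. \<forall>y\<in>ball (x + (h, 0)) 9. \<bar>u y - z\<bar> \<le> a \<and> \<bar>f (u y)\<bar> \<le> \<Lambda> * a) \<longrightarrow>
       C2_norm F \<beta> K v \<le> ennreal (C * a))"
proof -
  have \<Lambda>: "0 \<le> \<Lambda>" using lip by (rule lipschitz_on_nonneg)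
  obtain C0 where C0: "1 \<le> C0" and est: "\<forall>(u::real \<times> 'b \<Rightarrow> real) D H f \<Omega> X z a. open \<Omega> \<longrightarrow> C2_data \<Omega> u D H \<longrightarrow> 0 \<le> a \<longrightarrow>
     (\<forall>x\<in>\<Omega>. (\<Sum>b\<in>Basis. H b b x) = - f (u x)) \<longrightarrow>
     (\<forall>x\<in>\<Omega>. \<forall>y\<in>\<Omega>. \<bar>f (u x) - f (u y)\<bar> \<le> \<Lambda> * \<bar>u x - u y\<bar>) \<longrightarrow>
     (\<forall>x\<in>X. ball x 9 \<subseteq> \<Omega> \<and> (\<forall>y\<in>ball x 9. \<bar>u y - z\<bar> \<le> a \<and> \<bar>f (u y)\<bar> \<le> \<Lambda> * a)) \<longrightarrow>
     (\<forall>x\<in>X. \<forall>y\<in>X. \<forall>b\<in>Basis. \<forall>c\<in>Basis. \<bar>u x - z\<bar> \<le> C0 * a \<and> \<bar>D b x\<bar> \<le> C0 * a \<and> \<bar>H c b x\<bar> \<le> C0 * a \<and>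
        \<bar>H c b x - H c b y\<bar> \<le> C0 * a * dist x y powr \<beta>)"
    using solution_estimates[OF \<beta> \<Lambda>, where 'a="real \<times> 'b"] by (elim exE conjE)
  define N where "N = 1 + real DIM(real \<times> 'b) + 2 * (real DIM(real \<times> 'b))\<^sup>2"
  have N: "1 \<le> N" unfolding N_def by simp
  have C: "1 \<le> N * C0" using mult_mono[of 1 N 1 C0] N C0 by simp
  have op: "open \<Omega>" unfolding \<Omega>_def by (intro open_Times) auto
  have appr: "approachable F" unfolding F_def by (rule approachable_half_space)
  show ?thesis
  proof (rule exI[of _ "N * C0"], rule conjI[OF C], intro ballI allI impI)
    fix u h z v K and a :: real
    assume u: "u \<in> bnn_solutions_le \<Omega> f M" and h: "9 \<le> (h::real)" and a: "0 \<le> a"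
      and v: "\<forall>x\<in>F. v x = u (x + (h, 0)) - z"
    define D where "D b = pderiv_on \<Omega> b u" for b
    define H where "H c b = pderiv_on \<Omega> c (pderiv_on \<Omega> b u)" for c b
    note data = bnn_solution_C2_data[OF u op]
    have uD: "C2_data \<Omega> u D H" using data(1) unfolding D_def[abs_def] H_def[abs_def] .
    have "C2_data F (\<lambda>x. u (x + (h, 0)) + - z) (\<lambda>b x. D b (x + (h, 0))) (\<lambda>c b x. H c b (x + (h, 0)))"
      by (rule C2_data_translate_add[OF uD]) (use h in \<open>auto simp: F_def \<Omega>_def\<close>)
    from C2_data_restrict[OF appr order_refl this, of v] v
    have C2: "C2_on F v" and vD: "\<And>x b. x \<in> F \<Longrightarrow> b \<in> Basis \<Longrightarrow> pderiv_on F b v x = D b (x + (h, 0))"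
      and vH: "\<And>x b c. x \<in> F \<Longrightarrow> b \<in> Basis \<Longrightarrow> c \<in> Basis \<Longrightarrow> pderiv_on F c (pderiv_on F b v) x = H c b (x + (h, 0))"
      by auto
    have "C2_norm F \<beta> K v \<le> ennreal (N * C0 * a)"
      if K: "K \<subseteq> F" and close: "\<forall>x\<in>K. \<forall>y\<in>ball (x + (h, 0)) 9. \<bar>u y - z\<bar> \<le> a \<and> \<bar>f (u y)\<bar> \<le> \<Lambda> * a"
    proof -
      let ?X = "(\<lambda>x. x + (h, 0)) ` K"
      have E: "\<forall>x\<in>?X. \<forall>y\<in>?X. \<forall>b\<in>Basis. \<forall>c\<in>Basis. \<bar>u x - z\<bar> \<le> C0 * a \<and> \<bar>D b x\<bar> \<le> C0 * a \<and> \<bar>H c b x\<bar> \<le> C0 * a \<and>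
        \<bar>H c b x - H c b y\<bar> \<le> C0 * a * dist x y powr \<beta>"
      proof (rule est[THEN spec[of _ u], THEN spec[of _ D], THEN spec[of _ H], THEN spec[of _ f], THEN spec[of _ \<Omega>],
            THEN spec[of _ ?X], THEN spec[of _ z], THEN spec[of _ a], THEN mp, THEN mp, THEN mp, THEN mp, THEN mp, THEN mp,
            OF op uD a])
        show "\<forall>x\<in>\<Omega>. (\<Sum>b\<in>Basis. H b b x) = - f (u x)" using data(2) by (simp add: H_def)
        show "\<forall>x\<in>\<Omega>. \<forall>y\<in>\<Omega>. \<bar>f (u x) - f (u y)\<bar> \<le> \<Lambda> * \<bar>u x - u y\<bar>"
          using data(3) lipschitz_onD[OF lip] by (auto simp: dist_real_def)
        show "\<forall>x\<in>?X. ball x 9 \<subseteq> \<Omega> \<and> (\<forall>y\<in>ball x 9. \<bar>u y - z\<bar> \<le> a \<and> \<bar>f (u y)\<bar> \<le> \<Lambda> * a)"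
        proof (intro ballI conjI)
          fix x assume "x \<in> ?X"
          then obtain x0 where x0: "x0 \<in> K" "x = x0 + (h, 0)" by blast
          show "ball x 9 \<subseteq> \<Omega>"
          proof
            fix y assume "y \<in> ball x 9"
            then have "\<bar>fst x - fst y\<bar> < 9" using dist_fst_le[of x y] by (simp add: dist_real_def)
            moreover have "0 \<le> fst x0" using x0(1) K by (auto simp: F_def)
            ultimately have "0 < fst y" using h x0(2) by simp
            then show "y \<in> \<Omega>" by (simp add: \<Omega>_def mem_Times_iff)
          qed
        qed (use close in auto)
      qed
      have inF: "x \<in> F" if "x \<in> K" for x using that K by blast
      \<comment> \<open>In \<open>E\<close> the bound on u - z stands under quantifiers over the
        basis, so a basis vector has to be supplied.\<close>
      obtain b0 :: "real \<times> 'b" where b0: "b0 \<in> Basis" using nonempty_Basis by blast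
      have "C2_norm F \<beta> K v \<le> ennreal (N * (C0 * a))"
        unfolding N_def
      proof (rule C2_norm_le)
        show "\<bar>v x\<bar> \<le> C0 * a" if "x \<in> K" for x
          using E that v inF[OF that] b0 by auto
        show "\<bar>pderiv_on F b v x\<bar> \<le> C0 * a" if "x \<in> K" "b \<in> Basis" for x b
          using E that vD inF[OF that(1)] by auto
        show "\<bar>pderiv_on F c (pderiv_on F b v) x\<bar> \<le> C0 * a" if "x \<in> K" "b \<in> Basis" "c \<in> Basis" for x b c
          using E that vH inF[OF that(1)] by auto
        show "\<bar>pderiv_on F c (pderiv_on F b v) x - pderiv_on F c (pderiv_on F b v) y\<bar> \<le> C0 * a * dist x y powr \<beta>"
          if xy: "x \<in> K" "y \<in> K" and bc: "b \<in> Basis" "c \<in> Basis" for x y b c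
        proof -
          have "\<bar>H c b (x + (h, 0)) - H c b (y + (h, 0))\<bar> \<le> C0 * a * dist (x + (h, 0)) (y + (h, 0)) powr \<beta>"
            using E xy bc by blast
          then show ?thesis using vH[OF inF[OF xy(1)] bc] vH[OF inF[OF xy(2)] bc] by simp
        qed
      qed (use C0 a in simp)
      then show ?thesis by (simp add: mult.assoc)
    qed
    with C2 show "C2_on F v \<and> (K \<subseteq> F \<longrightarrow> (\<forall>x\<in>K. \<forall>y\<in>ball (x + (h, 0)) 9. \<bar>u y - z\<bar> \<le> a \<and> \<bar>f (u y)\<bar> \<le> \<Lambda> * a) \<longrightarrow>
       C2_norm F \<beta> K v \<le> ennreal (N * C0 * a))" by blast
  qed
qed

section \<open>The global attractor\<close>

theorem theorem4p6:
  fixes f :: "real \<Rightarrow> real" and \<Omega> :: "(real \<times> (real ^ 'm)) set"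
  assumes f_lipschitz: "local_lipschitz (UNIV :: real set) {0..} (\<lambda>_. f)"
    and f_nonneg: "\<forall>s\<ge>0. 0 \<le> f s"
    and f_liminf: "\<forall>z\<in>zero_set f. 0 < Liminf (at_right z) (\<lambda>s. ereal (f s / (s - z)))"
    and half_space: "\<Omega> = {0<..} \<times> UNIV"
    and nonempty: "bnn_solutions \<Omega> f \<noteq> {}"
  shows "\<exists>M0\<ge>0. \<forall>M\<ge>M0.
    (\<exists>A. global_attractor (closure \<Omega>) (shift (closure \<Omega>)) (bnn_solutions_le \<Omega> f M) A \<and>
       (\<forall>\<beta>\<in>{0..<1}. bounded_in_C2_b (closure \<Omega>) \<beta> A \<and>
          compactin (C2_loc_topology (closure \<Omega>) \<beta>) A) \<and>
       A = (\<lambda>u. restrict u (closure \<Omega>)) ` bnn_solutions_le UNIV f M) \<and>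
    (\<forall>u\<in>bnn_solutions_le \<Omega> f M. \<exists>!z. z \<in> zero_set f \<inter> {0..M} \<and>
       (\<forall>\<beta>\<in>{0..<1}. limitin (C2_loc_topology (closure \<Omega>) \<beta>)
          (\<lambda>h. shift (closure \<Omega>) h u) (restrict (\<lambda>_. z) (closure \<Omega>)) at_top))"
proof -
  define F :: "(real \<times> (real ^ 'm)) set" where "F = {0..} \<times> UNIV"
  have clF: "closure \<Omega> = F" unfolding half_space F_def by (simp add: closure_Times)
  have op: "open \<Omega>" unfolding half_space by (intro open_Times) auto
  have appr: "approachable F" unfolding F_def by (rule approachable_half_space)
  have f_cont: "continuous_on {0..} f"
    using local_lipschitz_continuous_on[OF f_lipschitz, of 0] by simp
  have f0: "\<And>s. 0 \<le> s \<Longrightarrow> 0 \<le> f s" using f_nonneg by blast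
  have f_slope: "\<exists>c>0. \<exists>\<delta>>0. \<forall>s. z < s \<longrightarrow> s \<le> z + \<delta> \<longrightarrow> c * (s - z) \<le> f s"
    if "0 \<le> z" "f z = 0" for z
  proof -
    have "0 < Liminf (at_right z) (\<lambda>s. ereal (f s / (s - z)))"
      using f_liminf that by (simp add: zero_set_def)
    then obtain c where c: "0 < ereal c" "ereal c < Liminf (at_right z) (\<lambda>s. ereal (f s / (s - z)))"
      using ereal_dense2 by blast
    have "\<forall>\<^sub>F s in at_right z. ereal c < ereal (f s / (s - z))"
      using less_LiminfD[OF c(2)] .
    then obtain b where b: "z < b" "\<And>s. z < s \<Longrightarrow> s < b \<Longrightarrow> c < f s / (s - z)"
      unfolding eventually_at_right_field by auto
    have "c * (s - z) \<le> f s" if s: "z < s" "s \<le> z + (b - z) / 2" for s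
    proof -
      have "s < b" using b(1) s by (simp add: field_simps)
      from b(2)[OF s(1) this] s(1) show "c * (s - z) \<le> f s" by (simp add: field_simps)
    qed
    moreover have "0 < c" "0 < (b - z) / 2" using c(1) b(1) by auto
    ultimately show ?thesis by blast
  qed
  have main: "(\<exists>A. global_attractor F (shift F) (bnn_solutions_le \<Omega> f M) A \<and>
       (\<forall>\<beta>\<in>{0..<1}. bounded_in_C2_b F \<beta> A \<and> compactin (C2_loc_topology F \<beta>) A) \<and>
       A = (\<lambda>u. restrict u F) ` bnn_solutions_le UNIV f M) \<and>
    (\<forall>u\<in>bnn_solutions_le \<Omega> f M. \<exists>!z. z \<in> zero_set f \<inter> {0..M} \<and>
       (\<forall>\<beta>\<in>{0..<1}. limitin (C2_loc_topology F \<beta>) (\<lambda>h. shift F h u) (restrict (\<lambda>_. z) F) at_top))"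
    if M: "0 \<le> M" for M
  proof -
    let ?X = "bnn_solutions_le \<Omega> f M"
    define E where "E = zero_set f \<inter> {0..M}"
    have E_iff: "z \<in> E \<longleftrightarrow> 0 \<le> z \<and> z \<le> M \<and> f z = 0" for z by (auto simp: E_def zero_set_def)
    define c where "c z = restrict (\<lambda>_. z) F" for z :: real
    \<comment> \<open>\<Lambda> \<ge> 1 allows |f(0)| to be absorbed into \<Lambda> a in the crude
      bound used for membership in \<open>C2_loc\<close>.\<close>
    obtain \<Lambda> where lip: "\<Lambda>-lipschitz_on {0..M} f" and \<Lambda>1: "1 \<le> \<Lambda>"
    proof -
      have "local_lipschitz {0::real} {0..M} (\<lambda>_. f)"
        using f_lipschitz by (rule local_lipschitz_subset) auto
      then obtain L where "L-lipschitz_on {0..M} f"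
      proof (rule local_lipschitz_compact_implies_lipschitz)
        fix L assume that: "\<And>L. L-lipschitz_on {0..M} f \<Longrightarrow> thesis"
          and "\<And>t::real. t \<in> {0} \<Longrightarrow> L-lipschitz_on {0..M} f"
        then show thesis by simp
      qed auto
      then have "(max 1 L)-lipschitz_on {0..M} f" by (rule lipschitz_on_le) simp
      then show ?thesis by (rule that) simp
    qed
    have \<Lambda>: "0 \<le> \<Lambda>" using \<Lambda>1 by simp
    have f_lip: "\<bar>f s - f t\<bar> \<le> \<Lambda> * \<bar>s - t\<bar>" if "0 \<le> s" "s \<le> M" "0 \<le> t" "t \<le> M" for s t
      using lipschitz_onD[OF lip, of s t] that by (simp add: dist_real_def)
    have E: "compact E"
    proof -
      have "closed ({0..M} \<inter> f -` {0})"
        by (rule continuous_closed_preimage[OF continuous_on_subset[OF f_cont]]) auto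
      then have "compact ({0..M} \<inter> ({0..M} \<inter> f -` {0}))" by (intro compact_Int_closed) auto
      moreover have "E = {0..M} \<inter> ({0..M} \<inter> f -` {0})" by (auto simp: E_iff)
      ultimately show ?thesis by (simp only:)
    qed
    \<comment> \<open>An interval contained in \<open>E\<close> would make \<open>f\<close> vanish
      immediately to the right of one of its points, against the linear growth there.\<close>
    have gaps: "\<exists>t. a < t \<and> t < b \<and> t \<notin> E" if ab: "a < b" for a b
    proof (rule ccontr)
      assume "\<not> ?thesis"
      then have all: "\<And>t. a < t \<Longrightarrow> t < b \<Longrightarrow> t \<in> E" by blast
      define t where "t = (a + b) / 2"
      have t: "a < t" "t < b" using ab by (auto simp: t_def)
      obtain k d where kd: "0 < k" "0 < d" "\<And>s. t < s \<Longrightarrow> s \<le> t + d \<Longrightarrow> k * (s - t) \<le> f s"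
        using f_slope[of t] all[OF t] by (auto simp: E_iff)
      define s where "s = t + min d (b - t) / 2"
      have s: "t < s" "s \<le> t + d" "s < b" using t kd(2) by (auto simp: s_def min_def field_simps)
      have "f s = 0" using all[of s] s t by (simp add: E_iff)
      moreover have "0 < k * (s - t)" using kd s by simp
      ultimately show False using kd(3)[OF s(1,2)] by linarith
    qed
    have u_bd: "0 \<le> u y \<and> u y \<le> M" if "u \<in> ?X" "y \<in> F" for u y
      using that clF by (auto simp: bnn_solutions_le_def bnn_solutions_def)
    have ball_F: "y \<in> F" if "x \<in> F" "9 \<le> h" "y \<in> ball (x + (h, 0)) 9" for x y h
    proof -
      have "\<bar>fst (x + (h, 0)) - fst y\<bar> < 9"
        using dist_fst_le[of "x + (h, 0)" y] that(3) by (simp add: dist_real_def)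
      then show ?thesis using that(1,2) by (auto simp: F_def mem_Times_iff)
    qed
    have shift_eq: "shift F h u x = u (x + (h, 0))" if "x \<in> F" for h u x
      using that by (cases x) (simp add: shift_def)
    \<comment> \<open>The upgrade from uniform to \<open>C\<^sup>2\<^sup>,\<^sup>\<beta>\<close>
      closeness. The pair a, L depends on K and \<epsilon> but not on the solution, the shift or the
      zero.\<close>
    have shift_close: "\<exists>a>0. \<exists>L. \<forall>u\<in>?X. \<forall>h\<ge>9. \<forall>z\<in>E. (\<forall>y\<in>cball (h, 0) L. \<bar>u y - z\<bar> \<le> a) \<longrightarrow>
        shift F h u \<in> C2_loc F \<beta> \<and> C2_norm F \<beta> K (\<lambda>x. shift F h u x - c z x) < ennreal \<epsilon>"
      if \<beta>: "\<beta> \<in> {0..<1}" and K: "compact K" "K \<subseteq> F" and \<epsilon>: "0 < \<epsilon>" for \<beta> K \<epsilon>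
    proof -
      have \<beta>': "0 \<le> \<beta>" "\<beta> < 1" using \<beta> by auto
      obtain C where C: "1 \<le> C" and C_est: "\<forall>u\<in>?X. \<forall>h\<ge>9. \<forall>z a v K. 0 \<le> a \<longrightarrow>
          (\<forall>x\<in>F. v x = u (x + (h, 0)) - z) \<longrightarrow>
          C2_on F v \<and> (K \<subseteq> F \<longrightarrow> (\<forall>x\<in>K. \<forall>y\<in>ball (x + (h, 0)) 9. \<bar>u y - z\<bar> \<le> a \<and> \<bar>f (u y)\<bar> \<le> \<Lambda> * a) \<longrightarrow>
            C2_norm F \<beta> K v \<le> ennreal (C * a))"
        using shift_estimate[OF \<beta>' lip, where 'b="real ^ 'm", folded F_def half_space] by (elim exE conjE)
      have est: "C2_on F v \<and> (K \<subseteq> F \<longrightarrow> (\<forall>x\<in>K. \<forall>y\<in>ball (x + (h, 0)) 9. \<bar>u y - z\<bar> \<le> a \<and> \<bar>f (u y)\<bar> \<le> \<Lambda> * a) \<longrightarrow>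
            C2_norm F \<beta> K v \<le> ennreal (C * a))"
        if "u \<in> ?X" "9 \<le> h" "0 \<le> a" "\<forall>x\<in>F. v x = u (x + (h, 0)) - z" for u h a v z K
        by (rule C_est[THEN bspec[of _ _ u], THEN spec[of _ h], THEN mp, THEN spec[of _ z], THEN spec[of _ a],
              THEN spec[of _ v], THEN spec[of _ K], THEN mp, THEN mp, OF that])
      have loc: "shift F h u \<in> C2_loc F \<beta>" if u: "u \<in> ?X" and h: "9 \<le> h" for u h
      proof -
        \<comment> \<open>Here the estimate is used with z = 0, which need not be a zero of
          \<open>f\<close>: any finite bound will do.\<close>
        define a where "a = M + \<bar>f 0\<bar>"
        have a: "0 \<le> a" using M by (simp add: a_def)
        have v: "\<forall>x\<in>F. shift F h u x = u (x + (h, 0)) - 0" using shift_eq by simp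
        have "C2_norm F \<beta> K (shift F h u) < \<infinity>" if K: "K \<subseteq> F" for K
        proof -
          have "\<forall>x\<in>K. \<forall>y\<in>ball (x + (h, 0)) 9. \<bar>u y - 0\<bar> \<le> a \<and> \<bar>f (u y)\<bar> \<le> \<Lambda> * a"
          proof (intro ballI)
            fix x y assume x: "x \<in> K" and y: "y \<in> ball (x + (h, 0)) 9"
            have "y \<in> F" using ball_F[OF _ h y] x K by blast
            then have uy: "0 \<le> u y" "u y \<le> M" using u_bd[OF u] by auto
            have "\<bar>f (u y) - f 0\<bar> \<le> \<Lambda> * u y" using f_lip[of "u y" 0] uy M by simp
            also have "\<dots> \<le> \<Lambda> * M" using uy \<Lambda> by (intro mult_left_mono)
            finally have "\<bar>f (u y)\<bar> \<le> \<Lambda> * M + 1 * \<bar>f 0\<bar>" by linarith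
            also have "\<dots> \<le> \<Lambda> * M + \<Lambda> * \<bar>f 0\<bar>" using \<Lambda>1 by (intro add_left_mono mult_right_mono) auto
            finally show "\<bar>u y - 0\<bar> \<le> a \<and> \<bar>f (u y)\<bar> \<le> \<Lambda> * a"
              using uy by (simp add: a_def distrib_left)
          qed
          with est[OF u h a v, of K] K have "C2_norm F \<beta> K (shift F h u) \<le> ennreal (C * a)" by blast
          then show ?thesis by (rule le_less_trans) simp
        qed
        moreover have "shift F h u \<in> extensional F" by (simp add: shift_def)
        ultimately show ?thesis using est[OF u h a v] unfolding C2_loc_def by blast
      qed
      obtain L where L: "\<And>x. x \<in> K \<Longrightarrow> norm x \<le> L"
        using compact_imp_bounded[OF K(1)] unfolding bounded_iff by blast
      define a where "a = \<epsilon> / (2 * C)"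
      have a: "0 < a" "C * a < \<epsilon>" using C \<epsilon> by (auto simp: a_def)
      show ?thesis
      \<comment> \<open>\<open>K\<close> lies within distance L of the origin, and the estimate
        looks 9 further.\<close>
      proof (rule exI[of _ a], rule conjI[OF a(1)], rule exI[of _ "L + 9"], intro ballI allI impI)
        fix u h z assume u: "u \<in> ?X" and h: "9 \<le> (h::real)" and z: "z \<in> E"
          and close: "\<forall>y\<in>cball (h, 0) (L + 9). \<bar>u y - z\<bar> \<le> a"
        have "\<forall>x\<in>K. \<forall>y\<in>ball (x + (h, 0)) 9. \<bar>u y - z\<bar> \<le> a \<and> \<bar>f (u y)\<bar> \<le> \<Lambda> * a"
        proof (intro ballI conjI)
          fix x y assume x: "x \<in> K" and y: "y \<in> ball (x + (h, 0)) 9"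
          have "dist (h, 0) y \<le> dist (h, 0) (x + (h, 0)) + dist (x + (h, 0)) y" by (rule dist_triangle)
          also have "dist (h, 0) (x + (h, 0)) = norm x" by (simp add: dist_norm norm_minus_commute)
          finally have "y \<in> cball (h, 0) (L + 9)" using L[OF x] y by simp
          then show uz: "\<bar>u y - z\<bar> \<le> a" using close by blast
          have "y \<in> F" using ball_F[OF _ h y] x K(2) by blast
          then have "\<bar>f (u y) - f z\<bar> \<le> \<Lambda> * \<bar>u y - z\<bar>"
            using u_bd[OF u] z by (intro f_lip) (auto simp: E_iff)
          also have "\<dots> \<le> \<Lambda> * a" using uz \<Lambda> by (intro mult_left_mono)
          finally show "\<bar>f (u y)\<bar> \<le> \<Lambda> * a" using z by (simp add: E_iff)
        qed
        then have "C2_norm F \<beta> K (\<lambda>x. shift F h u x - c z x) \<le> ennreal (C * a)"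
          using est[OF u h, of a "\<lambda>x. shift F h u x - c z x" z K] a K shift_eq by (auto simp: c_def)
        also have "\<dots> < ennreal \<epsilon>" using a \<epsilon> by (intro ennreal_lessI)
        finally show "shift F h u \<in> C2_loc F \<beta> \<and> C2_norm F \<beta> K (\<lambda>x. shift F h u x - c z x) < ennreal \<epsilon>"
          using loc[OF u h] by blast
      qed
    qed
    have near_U: "\<exists>a>0. \<exists>L. \<forall>u\<in>?X. \<forall>h\<ge>9. (\<forall>y\<in>cball (h, 0) L. \<bar>u y - z\<bar> \<le> a) \<longrightarrow> shift F h u \<in> U"
      if \<beta>: "\<beta> \<in> {0..<1}" and U: "openin (C2_loc_topology F \<beta>) U" and z: "z \<in> E" "c z \<in> U" for \<beta> U z
    proof -
      obtain K \<epsilon> where K: "compact K" "K \<subseteq> F" "0 < \<epsilon>"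
        "{v \<in> C2_loc F \<beta>. C2_norm F \<beta> K (\<lambda>x. v x - c z x) < ennreal \<epsilon>} \<subseteq> U"
        using U z(2) unfolding openin_C2_loc_topology by meson
      from shift_close[OF \<beta> K(1-3)] show ?thesis using K(4) z(1) by blast
    qed
    have nearly_const: "\<exists>R. \<forall>\<Omega>'. \<forall>u\<in>bnn_solutions_le \<Omega>' f M. \<forall>c. open (\<Omega>' :: (real \<times> (real ^ 'm)) set) \<longrightarrow> ball c R \<subseteq> \<Omega>' \<longrightarrow>
       (\<exists>z\<in>{0..M}. f z = 0 \<and> (\<forall>x\<in>cball c L. \<bar>u x - z\<bar> \<le> \<epsilon>))" if "0 < \<epsilon>" for \<epsilon> L
      by (rule bnn_solution_nearly_constant) (erule f0, rule f_cont, erule (1) f_slope, rule that)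
    \<comment> \<open>For h \<ge> R the ball of radius R about (h, 0) lies in the half-space, so
      near constancy applies at the shifted origin. The zero may still vary with h and u.\<close>
    have deep: "\<exists>h1\<ge>9. \<forall>u\<in>?X. \<forall>h\<ge>h1. \<exists>z\<in>E. \<forall>y\<in>cball (h, 0) L. \<bar>u y - z\<bar> \<le> \<epsilon>"
      if \<epsilon>: "0 < \<epsilon>" for \<epsilon> L
    proof -
      from nearly_const[OF \<epsilon>, of L] obtain R where R: "\<forall>\<Omega>'. \<forall>u\<in>bnn_solutions_le \<Omega>' f M. \<forall>c. open (\<Omega>' :: (real \<times> (real ^ 'm)) set) \<longrightarrow> ball c R \<subseteq> \<Omega>' \<longrightarrow>
         (\<exists>z\<in>{0..M}. f z = 0 \<and> (\<forall>x\<in>cball c L. \<bar>u x - z\<bar> \<le> \<epsilon>))" ..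
      have "\<exists>z\<in>E. \<forall>y\<in>cball (h, 0) L. \<bar>u y - z\<bar> \<le> \<epsilon>" if u: "u \<in> ?X" and h: "max 9 R \<le> h" for u h
      proof -
        have "ball (h, 0) R \<subseteq> \<Omega>"
        proof
          fix y :: "real \<times> (real ^ 'm)" assume "y \<in> ball (h, 0) R"
          then have "\<bar>h - fst y\<bar> < R" using dist_fst_le[of "(h, 0)" y] by (simp add: dist_real_def)
          then show "y \<in> \<Omega>" using h by (auto simp: half_space mem_Times_iff)
        qed
        from R[THEN spec, THEN bspec, OF u, THEN spec[of _ "(h, 0)"]] op this show ?thesis by (auto simp: E_iff)
      qed
      then show ?thesis by (intro exI[of _ "max 9 R"]) auto
    qed
    define A where "A = c ` E"
    have A_eq: "A = (\<lambda>u. restrict u F) ` bnn_solutions_le UNIV f M"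
    proof (rule set_eqI, rule iffI)
      fix w assume "w \<in> A"
      then obtain z where z: "z \<in> E" "w = c z" by (auto simp: A_def)
      have "restrict (\<lambda>_. z) (closure UNIV) \<in> bnn_solutions_le UNIV f M"
        using z(1) by (intro const_bnn_solution) (auto simp: E_iff)
      then show "w \<in> (\<lambda>u. restrict u F) ` bnn_solutions_le UNIV f M"
        using z(2) by (intro image_eqI[of _ _ "restrict (\<lambda>_. z) UNIV"]) (auto simp: c_def)
    next
      fix w assume "w \<in> (\<lambda>u. restrict u F) ` bnn_solutions_le UNIV f M"
      then obtain u where u: "u \<in> bnn_solutions_le UNIV f M" "w = restrict u F" by blast
      \<comment> \<open>In the whole space balls of every radius are available, so the solution is
        within every tolerance of a constant on every ball.\<close>
      have const: "u x = u 0" for x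
      proof -
        have "\<bar>u x - u 0\<bar> \<le> 0 + e" if e: "0 < e" for e
        proof -
          have "0 < e / 2" using e by simp
          from nearly_const[OF this, of "norm x"] obtain R where R: "\<forall>\<Omega>'. \<forall>u\<in>bnn_solutions_le \<Omega>' f M. \<forall>c. open (\<Omega>' :: (real \<times> (real ^ 'm)) set) \<longrightarrow> ball c R \<subseteq> \<Omega>' \<longrightarrow>
         (\<exists>z\<in>{0..M}. f z = 0 \<and> (\<forall>x\<in>cball c (norm x). \<bar>u x - z\<bar> \<le> e / 2))" ..
          from R[THEN spec, THEN bspec, OF u(1), THEN spec[of _ 0]] obtain z where "\<forall>y\<in>cball 0 (norm x). \<bar>u y - z\<bar> \<le> e / 2" by auto
          then have "\<bar>u x - z\<bar> \<le> e / 2" "\<bar>u 0 - z\<bar> \<le> e / 2" by auto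
          then show ?thesis by linarith
        qed
        then have "\<bar>u x - u 0\<bar> \<le> 0" by (rule field_le_epsilon)
        then show ?thesis by simp
      qed
      have "laplacian_on UNIV u 0 = 0"
        using C2_const_on(2)[OF approachable_open[OF open_UNIV], of u "u 0" 0] const by auto
      moreover have "laplacian_on UNIV u 0 + f (u 0) = 0" "0 \<le> u 0" "u 0 \<le> M"
        using u(1) by (simp_all add: bnn_solutions_le_def bnn_solutions_def del: split_paired_All)
      ultimately have "u 0 \<in> E" by (simp add: E_iff)
      moreover have "w = c (u 0)" using u(2) const by (auto simp: c_def)
      ultimately show "w \<in> A" by (simp add: A_def)
    qed
    have A_X: "A \<subseteq> ?X"
      using const_bnn_solution[OF op] by (auto simp: A_def E_iff c_def clF)
    have shift_c: "shift F h (c z) = c z" if "0 \<le> h" for h z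
      using that by (auto simp: shift_def c_def F_def fun_eq_iff)
    have A_inv: "shift F h ` A = A" if "0 \<le> h" for h
      using shift_c[OF that] by (auto simp: A_def image_iff)
    have A_comp: "compactin (C2_loc_topology F \<beta>) A" for \<beta>
      unfolding A_def c_def[abs_def] by (rule compactin_C2_loc_const[OF appr E])
    have A_bdd: "bounded_in_C2_b F \<beta> A" for \<beta>
      unfolding A_def c_def[abs_def] by (rule bounded_in_C2_b_const[OF appr]) (auto simp: E_iff)
    have A_attr: "\<exists>h0>0. \<forall>h\<ge>h0. shift F h ` B \<subseteq> U"
      if B: "B \<subseteq> ?X" and \<beta>: "\<beta> \<in> {0..<1}" and U: "openin (C2_loc_topology F \<beta>) U" "A \<subseteq> U" for B \<beta> U
    proof -
      \<comment> \<open>Closeness thresholds depend on the zero. A finite cover of the compact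
        \<open>E\<close> by balls of half the threshold makes them uniform; the other half is left
        for the distance between \<open>u\<close> and the nearby zero.\<close>
      have "\<forall>z\<in>E. \<exists>a L. 0 < a \<and> (\<forall>u\<in>?X. \<forall>h\<ge>9. (\<forall>y\<in>cball (h, 0) L. \<bar>u y - z\<bar> \<le> a) \<longrightarrow> shift F h u \<in> U)"
        using near_U[OF \<beta> U(1)] U(2) unfolding A_def by blast
      then obtain a L where aL: "\<And>z. z \<in> E \<Longrightarrow> 0 < a z"
        "\<And>z u h. z \<in> E \<Longrightarrow> u \<in> ?X \<Longrightarrow> 9 \<le> h \<Longrightarrow> \<forall>y\<in>cball (h, 0) (L z). \<bar>u y - z\<bar> \<le> a z \<Longrightarrow> shift F h u \<in> U"
        by metis
      have "E \<subseteq> (\<Union>z\<in>E. ball z (a z / 2))" using aL(1) by force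
      then obtain D where D: "D \<subseteq> E" "finite D" "E \<subseteq> (\<Union>z\<in>D. ball z (a z / 2))"
        using compactE_image[OF E, of E "\<lambda>z. ball z (a z / 2)"] by auto
      \<comment> \<open>The inserted 1 and 0 keep minimum and maximum meaningful when
        \<open>E\<close>, and with it \<open>D\<close>, is empty.\<close>
      define a0 where "a0 = Min (insert 1 ((\<lambda>z. a z / 2) ` D))"
      define L0 where "L0 = Max (insert 0 (L ` D))"
      have a0: "0 < a0" "\<And>z. z \<in> D \<Longrightarrow> a0 \<le> a z / 2"
      proof -
        show "0 < a0" using D(1,2) aL(1) unfolding a0_def by (auto simp: subset_iff)
        show "a0 \<le> a z / 2" if "z \<in> D" for z
          unfolding a0_def by (rule Min_le) (use D(2) that in auto)
      qed
      have L0: "\<And>z. z \<in> D \<Longrightarrow> L z \<le> L0" using D unfolding L0_def by auto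
      obtain h1 where h1: "9 \<le> h1" "\<forall>u\<in>?X. \<forall>h\<ge>h1. \<exists>z\<in>E. \<forall>y\<in>cball (h, 0) L0. \<bar>u y - z\<bar> \<le> a0"
        using deep[OF a0(1), of L0] by blast
      have "shift F h u \<in> U" if h: "h1 \<le> h" and u: "u \<in> ?X" for h u
      proof -
        obtain z where z: "z \<in> E" "\<forall>y\<in>cball (h, 0) L0. \<bar>u y - z\<bar> \<le> a0" using h1(2) h u by blast
        then obtain z' where z': "z' \<in> D" "dist z' z < a z' / 2" using D(3) by auto
        have "\<forall>y\<in>cball (h, 0) (L z'). \<bar>u y - z'\<bar> \<le> a z'"
        proof
          fix y :: "real \<times> (real ^ 'm)" assume "y \<in> cball (h, 0) (L z')"
          then have "y \<in> cball (h, 0) L0" using L0[OF z'(1)] by simp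
          then have "\<bar>u y - z\<bar> \<le> a0" using z(2) by blast
          moreover have "\<bar>z' - z\<bar> < a z' / 2" using z'(2) by (simp add: dist_real_def)
          ultimately show "\<bar>u y - z'\<bar> \<le> a z'" using a0(2)[OF z'(1)] by linarith
        qed
        then show ?thesis using aL(2)[of z' u h] z'(1) D(1) u h h1(1) by auto
      qed
      then show ?thesis using B h1(1) by (intro exI[of _ h1]) auto
    qed
    have "global_attractor F (shift F) ?X A"
      unfolding global_attractor_def using A_X A_comp A_inv A_attr by blast
    moreover have "\<exists>!z. z \<in> E \<and> (\<forall>\<beta>\<in>{0..<1}. limitin (C2_loc_topology F \<beta>) (\<lambda>h. shift F h u) (c z) at_top)"
      if u: "u \<in> ?X" for u
    proof -
      \<comment> \<open>Values on the axis decide the limit: \<open>deep\<close> only says that each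
        late shift is near some zero, and the intermediate value argument along the axis selects
        one.\<close>
      define g where "g h = u (h, 0)" for h
      have "continuous_on F u" using u clF by (auto simp: bnn_solutions_le_def bnn_solutions_def)
      then have g_cont: "continuous_on {0..} g"
        unfolding g_def by (rule continuous_on_compose2) (auto intro!: continuous_intros simp: F_def)
      have g_attr: "\<forall>\<^sub>F h in at_top. \<exists>z\<in>E. \<bar>g h - z\<bar> \<le> e" if e: "0 < e" for e
      proof -
        obtain h1 where "\<forall>h\<ge>h1. \<exists>z\<in>E. \<forall>y\<in>cball (h, 0) 0. \<bar>u y - z\<bar> \<le> e" using deep[OF e, of 0] u by blast
        then show ?thesis unfolding eventually_at_top_linorder g_def by auto
      qed
      obtain z where z: "z \<in> E" "(g \<longlongrightarrow> z) at_top"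
        using tendsto_of_attraction[OF g_cont E gaps g_attr] by blast
      have lim: "limitin (C2_loc_topology F \<beta>) (\<lambda>h. shift F h u) (c z) at_top" if \<beta>: "\<beta> \<in> {0..<1}" for \<beta>
        unfolding limitin_def
      proof (intro conjI allI impI)
        show "c z \<in> topspace (C2_loc_topology F \<beta>)"
          unfolding topspace_C2_loc_topology c_def by (rule const_C2_loc[OF appr])
        fix U assume "openin (C2_loc_topology F \<beta>) U \<and> c z \<in> U"
        then obtain a L where a: "0 < a"
          and U: "\<And>h. 9 \<le> h \<Longrightarrow> \<forall>y\<in>cball (h, 0) L. \<bar>u y - z\<bar> \<le> a \<Longrightarrow> shift F h u \<in> U"
          using near_U[OF \<beta> _ z(1)] u by meson
        \<comment> \<open>The three thirds are spent on u(y) to z', z' to g(h), and g(h) to z.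
          Taking max 0 L guarantees that the centre, where \<open>g\<close> is read off, belongs to
          the ball.\<close>
        obtain h1 where h1: "9 \<le> h1" "\<forall>h\<ge>h1. \<exists>z\<in>E. \<forall>y\<in>cball (h, 0) (max 0 L). \<bar>u y - z\<bar> \<le> a / 3"
          using deep[of "a / 3" "max 0 L"] a u by auto
        have "\<forall>\<^sub>F h in at_top. dist (g h) z < a / 3" using z(2) a by (intro tendstoD) auto
        with eventually_ge_at_top[of h1] show "\<forall>\<^sub>F h in at_top. shift F h u \<in> U"
        proof eventually_elim
          case (elim h)
          then obtain z' where z': "\<And>y. y \<in> cball (h, 0) (max 0 L) \<Longrightarrow> \<bar>u y - z'\<bar> \<le> a / 3" using h1(2) by blast
          have "\<bar>g h - z'\<bar> \<le> a / 3" unfolding g_def by (rule z') simp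
          moreover have "\<bar>g h - z\<bar> < a / 3" using elim(2) by (simp add: dist_real_def)
          ultimately have "\<bar>u y - z\<bar> \<le> a" if "y \<in> cball (h, 0) L" for y
          proof -
            have "\<bar>u y - z'\<bar> \<le> a / 3" by (rule z') (use that in auto)
            with \<open>\<bar>g h - z'\<bar> \<le> a / 3\<close> \<open>\<bar>g h - z\<bar> < a / 3\<close> show ?thesis by linarith
          qed
          then show ?case using U elim(1) h1(1) by auto
        qed
      qed
      show ?thesis
      proof (rule ex1I[of _ z])
        show "z \<in> E \<and> (\<forall>\<beta>\<in>{0..<1}. limitin (C2_loc_topology F \<beta>) (\<lambda>h. shift F h u) (c z) at_top)"
          using z(1) lim by blast
        fix z' assume "z' \<in> E \<and> (\<forall>\<beta>\<in>{0..<1}. limitin (C2_loc_topology F \<beta>) (\<lambda>h. shift F h u) (c z') at_top)"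
        \<comment> \<open>A single exponent determines the limit, by evaluation at the
          origin.\<close>
        then have "limitin (C2_loc_topology F 0) (\<lambda>h. shift F h u) (c z') at_top" by auto
        moreover have "0 \<in> F" by (simp add: F_def zero_prod_def)
        ultimately have "((\<lambda>h. shift F h u 0) \<longlongrightarrow> c z' 0) at_top" by (rule limitin_C2_loc_topology_eval)
        moreover have "shift F h u 0 = g h" for h using shift_eq[OF \<open>0 \<in> F\<close>] by (simp add: g_def)
        moreover have "c z' 0 = z'" using \<open>0 \<in> F\<close> by (simp add: c_def)
        ultimately show "z' = z" using z(2) tendsto_unique[OF trivial_limit_at_top_linorder] by auto
      qed
    qed
    ultimately show ?thesis
      unfolding E_def[symmetric] c_def[symmetric] using A_eq A_bdd A_comp by blast
  qed
  \<comment> \<open>Every M \<ge> 0 is large enough: if \<open>E\<close> is empty for some M, then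
    by \<open>deep\<close> the phase space is empty as well, and so is the attractor.\<close>
  show ?thesis unfolding clF using main by (intro exI[of _ 0]) simp
qed

end
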